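(* Let $n\ge2$, let $\mu$ be a symmetric log-concave measure on $\mathbb{R}^n$, and let $K$ be an origin-symmetric $p$-convex body in $\mathbb{R}^n$ for some $p\in(0,1]$. Then the intersection body $I_\mu K$ of $K$ with respect to $\mu$ is $q$-convex with $$q=\left[\left(\frac1p-1\right)(n-1)+1\right]^{-1}.$$
   Context: A body is a compact set with nonempty interior. For a body $K\subset\mathbb{R}^n$ that is star-shaped with respect to the origin, its Minkowski functional is $\|x\|_K=\min\{\lambda\ge 0: x\in\lambda K\}$ and its radial function is $\rho_K(u)=\max\{\lambda\ge 0:\lambda u\in K\}$ for $u\in S^{n-1}$, so $\rho_K(u)=\|u\|_K^{-1}$. $K$ is a star body if it is star-shaped at the origin and $\rho_K$ is positive and continuous on $S^{n-1}$. For $p\in(0,1]$, a body $K$ is $p$-convex if $\|x+y\|_K^p\le\|x\|_K^p+\|y\|_K^p$ for all $x,y\in\mathbb{R}^n$; equivalently, $t^{1/p}x+(1-t)^{1/p}y\in K$ whenever $x,y\in K$ and $t\in(0,1)$. (An origin-symmetric $p$-convex body is a star body.) A measure $\mu$ on $\mathbb{R}^n$ is log-concave if $\mu(\lambda A+(1-\lambda)B)\ge\mu(A)^\lambda\mu(B)^{1-\lambda}$ for all measurable $A,B\subset\mathbb{R}^n$ and $0<\lambda<1$ such that $\lambda A+(1-\lambda)B$ is measurable. The measures considered have support not contained in any affine hyperplane; by a theorem of Borell, such a $\mu$ is log-concave if and only if it is absolutely continuous with respect to Lebesgue measure with a log-concave density $f:\mathbb{R}^n\to[0,\infty)$, i.e.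 $f(\lambda x+(1-\lambda)y)\ge f(x)^\lambda f(y)^{1-\lambda}$. Symmetric means $\mu(-A)=\mu(A)$, i.e. $f$ is even. On $(n-1)$-dimensional subspaces, $\mu_{n-1}=f\,m_{n-1}$ is the measure with density $f$ with respect to $(n-1)$-dimensional Lebesgue measure $m_{n-1}$. The intersection body $I_\mu K$ of a star body $K$ with respect to $\mu$ is defined by its radial function $\rho_{I_\mu K}(u)=\mu_{n-1}(K\cap u^\perp)$ for $u\in S^{n-1}$, where $u^\perp=\{x\in\mathbb{R}^n:x\cdot u=0\}$. *)

theory Defs
  imports "HOL-Analysis.Analysis"
begin

definition body :: "'a::euclidean_space set \<Rightarrow> bool" where
  "body K \<longleftrightarrow> compact K \<and> interior K \<noteq> {}"

definition origin_star_shaped :: "'a::euclidean_space set \<Rightarrow> bool" where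
  "origin_star_shaped K \<longleftrightarrow> 0 \<in> K \<and> (\<forall>x\<in>K. closed_segment 0 x \<subseteq> K)"

definition origin_symmetric :: "'a::euclidean_space set \<Rightarrow> bool" where
  "origin_symmetric K \<longleftrightarrow> uminus ` K = K"

text \<open>For compact origin-star-shaped \<open>K\<close> the infimum (supremum) is attained as soon as the set is
  nonempty (if \<open>u \<noteq> 0\<close>), so it is the minimum (maximum).\<close>

definition minkowski_functional :: "'a::euclidean_space set \<Rightarrow> 'a \<Rightarrow> real" where
  "minkowski_functional K x = Inf {c. 0 \<le> c \<and> x \<in> (\<lambda>y. c *\<^sub>R y) ` K}"

definition radial_function :: "'a::euclidean_space set \<Rightarrow> 'a \<Rightarrow> real" where
  "radial_function K u = Sup {c. 0 \<le> c \<and> c *\<^sub>R u \<in> K}"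

text \<open>The third conjunct says that the Minkowski functional is finite everywhere, so that
  \<open>minkowski_functional\<close> is never evaluated at the unspecified infimum of the empty set.\<close>

definition p_convex :: "real \<Rightarrow> 'a::euclidean_space set \<Rightarrow> bool" where
  "p_convex p K \<longleftrightarrow> body K \<and> origin_star_shaped K \<and>
     (\<forall>x. \<exists>c\<ge>0. x \<in> (\<lambda>y. c *\<^sub>R y) ` K) \<and>
     (\<forall>x y. minkowski_functional K (x + y) powr p
              \<le> minkowski_functional K x powr p + minkowski_functional K y powr p)"

text \<open>Powers of extended nonnegative reals with a positive real exponent; with the library's
  \<open>0 * \<infinity> = 0\<close>, the log-concavity inequality below is trivial if \<open>A\<close> or \<open>B\<close> is a null set.\<close>

definition ennreal_powr :: "ennreal \<Rightarrow> real \<Rightarrow> ennreal" where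
  "ennreal_powr x a = (if x = \<infinity> then \<infinity> else ennreal (enn2real x powr a))"

definition log_concave_measure :: "'a::euclidean_space measure \<Rightarrow> bool" where
  "log_concave_measure \<mu> \<longleftrightarrow> sets \<mu> = sets borel \<and>
     (\<forall>A\<in>sets borel. \<forall>B\<in>sets borel. \<forall>t. 0 < t \<longrightarrow> t < 1 \<longrightarrow>
        {t *\<^sub>R a + (1 - t) *\<^sub>R b |a b. a \<in> A \<and> b \<in> B} \<in> sets borel \<longrightarrow>
        emeasure \<mu> {t *\<^sub>R a + (1 - t) *\<^sub>R b |a b. a \<in> A \<and> b \<in> B}
          \<ge> ennreal_powr (emeasure \<mu> A) t * ennreal_powr (emeasure \<mu> B) (1 - t))"

definition symmetric_measure :: "'a::euclidean_space measure \<Rightarrow> bool" where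
  "symmetric_measure \<mu> \<longleftrightarrow> (\<forall>A\<in>sets \<mu>. emeasure \<mu> (uminus ` A) = emeasure \<mu> A)"

definition measure_support :: "'a::euclidean_space measure \<Rightarrow> 'a set" where
  "measure_support \<mu> = {x. \<forall>U. open U \<longrightarrow> x \<in> U \<longrightarrow> emeasure \<mu> U > 0}"

definition nondegenerate_measure :: "'a::euclidean_space measure \<Rightarrow> bool" where
  "nondegenerate_measure \<mu> \<longleftrightarrow> (\<forall>a b. a \<noteq> 0 \<longrightarrow> \<not> measure_support \<mu> \<subseteq> {x. a \<bullet> x = b})"

definition log_concave_function :: "('a::euclidean_space \<Rightarrow> real) \<Rightarrow> bool" where
  "log_concave_function f \<longleftrightarrow> (\<forall>x. 0 \<le> f x) \<and>
     (\<forall>x y t. 0 < t \<longrightarrow> t < 1 \<longrightarrow>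
        f (t *\<^sub>R x + (1 - t) *\<^sub>R y) \<ge> f x powr t * f y powr (1 - t))"

definition log_concave_density :: "'a::euclidean_space measure \<Rightarrow> ('a \<Rightarrow> real) \<Rightarrow> bool" where
  "log_concave_density \<mu> f \<longleftrightarrow> f \<in> borel_measurable borel \<and> log_concave_function f \<and>
     \<mu> = density lborel (\<lambda>x. ennreal (f x))"

definition orthonormal_basis_of :: "'a::euclidean_space set \<Rightarrow> 'a set \<Rightarrow> bool" where
  "orthonormal_basis_of S B \<longleftrightarrow> B \<subseteq> S \<and> pairwise orthogonal B \<and> (\<forall>b\<in>B. norm b = 1) \<and> span B = S"

lemma orthonormal_basis_of_exists:
  assumes "subspace S"
  shows "\<exists>B. orthonormal_basis_of S B"
  using orthonormal_basis_subspace[OF assms] unfolding orthonormal_basis_of_def by metis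

text \<open>Lebesgue measure of a linear subspace \<open>S\<close>, of dimension \<open>dim S\<close> and carried by \<open>S\<close>. The
  construction is that of \<^const>\<open>lborel\<close>, with an orthonormal basis of \<open>S\<close> in place of
  \<^const>\<open>Basis\<close>; the result does not depend on the basis, by rotation invariance.\<close>

definition subspace_lborel :: "'a::euclidean_space set \<Rightarrow> 'a measure" where
  "subspace_lborel S = (let B = (SOME B. orthonormal_basis_of S B) in
     distr (\<Pi>\<^sub>M b\<in>B. (lborel :: real measure)) borel (\<lambda>g. \<Sum>b\<in>B. g b *\<^sub>R b))"

definition section_measure :: "('a::euclidean_space \<Rightarrow> real) \<Rightarrow> 'a set \<Rightarrow> 'a measure" where
  "section_measure f S = density (subspace_lborel S) (\<lambda>x. ennreal (f x))"

text \<open>The origin-star-shaped set with radial function \<open>u \<mapsto> \<mu>\<^bsub>n-1\<^esub>(K \<inter> u\<^sup>\<bottom>)\<close>,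
  where \<open>\<mu>\<close> has density \<open>f\<close>.\<close>

definition intersection_body :: "('a::euclidean_space \<Rightarrow> real) \<Rightarrow> 'a set \<Rightarrow> 'a set" where
  "intersection_body f K = {r *\<^sub>R u |r u. norm u = 1 \<and> 0 \<le> r \<and>
     ennreal r \<le> emeasure (section_measure f {x. x \<bullet> u = 0}) (K \<inter> {x. x \<bullet> u = 0})}"

lemma radial_function_intersection_body:
  assumes u: "norm u = 1"
    and fin: "emeasure (section_measure f {x. x \<bullet> u = 0}) (K \<inter> {x. x \<bullet> u = 0}) < \<infinity>"
  shows "ennreal (radial_function (intersection_body f K) u)
           = emeasure (section_measure f {x. x \<bullet> u = 0}) (K \<inter> {x. x \<bullet> u = 0})"
proof -
  let ?m = "\<lambda>u. emeasure (section_measure f {x. x \<bullet> u = 0}) (K \<inter> {x. x \<bullet> u = 0})"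
  obtain c where c: "0 \<le> c" "?m u = ennreal c"
    using fin by (cases "?m u") auto
  have "{t. 0 \<le> t \<and> t *\<^sub>R u \<in> intersection_body f K} = {0..c}"
  proof (intro set_eqI iffI)
    fix t assume "t \<in> {t. 0 \<le> t \<and> t *\<^sub>R u \<in> intersection_body f K}"
    then obtain r v where t: "0 \<le> t" "t *\<^sub>R u = r *\<^sub>R v" "norm v = 1" "0 \<le> r" "ennreal r \<le> ?m v"
      unfolding intersection_body_def by blast
    have "norm (t *\<^sub>R u) = norm (r *\<^sub>R v)" using t(2) by simp
    then have tr: "t = r" unfolding norm_scaleR using t(1,3,4) u by simp
    show "t \<in> {0..c}"
    proof (cases "t = 0")
      case False
      then have "u = v" using t(2) tr by simp
      then have "ennreal t \<le> ennreal c" using t(5) tr c(2) by simp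
      then show ?thesis using c(1) t(1) by simp
    qed (use c in simp)
  next
    fix t assume "t \<in> {0..c}"
    then show "t \<in> {t. 0 \<le> t \<and> t *\<^sub>R u \<in> intersection_body f K}"
      unfolding intersection_body_def using c u by (auto intro!: exI[of _ t] exI[of _ u] ennreal_leI)
  qed
  then show ?thesis using c by (simp add: radial_function_def)
qed

end

theory Submission
  imports Defs
begin

text \<open>
  Fix \<open>x\<close> and \<open>y\<close> in a plane \<open>E\<close> and let \<open>F\<close> be its orthogonal complement, of dimension \<open>n - 2\<close>.
  Integrating \<open>f\<close> over \<open>K \<inter> (e + F)\<close> gives a function \<open>J\<close> of \<open>e \<in> E\<close>. Rotating \<open>E\<close> by a right angle,
  \<open>x \<mapsto> x'\<close>, turns the norm of the intersection body into \<open>\<parallel>x\<parallel> = 1 / (2 * \<Phi> x')\<close> with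
  \<open>\<Phi> w = \<integral> J (r w) dr\<close> over \<open>r > 0\<close>, because \<open>u\<^sup>\<bottom>\<close> is spanned by \<open>F\<close> and the rotated \<open>u\<close>.
  For positive \<open>r\<^sub>1\<close>, \<open>r\<^sub>2\<close> put \<open>s = r\<^sub>1 powr - p + r\<^sub>2 powr - p\<close>, \<open>r\<^sub>3 = s powr (- 1 / p)\<close> and
  \<open>t = r\<^sub>1 powr - p / s\<close>. Then \<open>r\<^sub>3 (w\<^sub>1 + w\<^sub>2)\<close> is the combination of \<open>r\<^sub>1 w\<^sub>1\<close> and \<open>r\<^sub>2 w\<^sub>2\<close> with
  coefficients \<open>t powr (1 / p)\<close> and \<open>(1 - t) powr (1 / p)\<close>, so \<open>p\<close>-convexity of \<open>K\<close>, log-concavity of \<open>f\<close>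
  with maximum at the origin, and the Prekopa--Leindler inequality in \<open>F\<close> bound \<open>J (r\<^sub>3 (w\<^sub>1 + w\<^sub>2))\<close>
  from below. As in Busemann's theorem, parametrising \<open>r\<^sub>1\<close> and \<open>r\<^sub>2\<close> by quantiles of \<open>J\<close> along the
  two rays and integrating over the quantile gives
  \<open>\<Phi> (w\<^sub>1 + w\<^sub>2) powr - q \<le> \<Phi> w\<^sub>1 powr - q + \<Phi> w\<^sub>2 powr - q\<close>. The body is closed because this triangle
  inequality, with a positive lower bound on the sections, makes its norm continuous.
\<close>

section \<open>The Prekopa--Leindler inequality\<close>

text \<open>The exponent is the sum of two losses. The body combines points with coefficients
  \<open>t powr (1 / p)\<close> where Prekopa--Leindler wants \<open>t\<close>; correcting this by a
  dilation of the fibre costs the Jacobian \<open>t powr ((1 / p - 1) * (n - 2))\<close>.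
  Differentiating \<open>s powr (- 1 / p)\<close> contributes \<open>t powr (1 / p)\<close>. Hence
  \<open>1 / q = (1 / p - 1) * (n - 2) + 1 / p\<close>, which equals
  \<open>(1 / p - 1) * (n - 1) + 1\<close>. Three irregularities shape the proof. Along a ray
  \<open>J\<close> need not be continuous, so its quantiles need not be differentiable; the growth
  condition \<open>l ^ (n - 2) * J e \<le> J (l e)\<close> for \<open>0 < l \<le> 1\<close> yields
  smooth approximate quantiles with arbitrarily small loss. Symmetry makes \<open>f\<close> even
  only almost everywhere, which says nothing about a single hyperplane; a comparison of
  \<open>f\<close> at \<open>x\<close> and \<open>- l x\<close>, whose loss disappears as
  \<open>l\<close> tends to 1, replaces evenness. Finally, Lebesgue measure on a subspace rests on
  an arbitrarily chosen basis, so independence of that choice must precede the use of coordinates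
  adapted to \<open>E\<close> and \<open>F\<close>.\<close>

lemma ennreal_powr_ennreal: "0 \<le> x \<Longrightarrow> ennreal_powr (ennreal x) a = ennreal (x powr a)"
  by (simp add: ennreal_powr_def)

lemma ennreal_powr_0 [simp]: "ennreal_powr 0 a = 0"
  by (simp add: ennreal_powr_def)

lemma ennreal_powr_top [simp]: "ennreal_powr top a = top"
  by (simp add: ennreal_powr_def)

lemma ennreal_powr_eq_0_iff [simp]: "ennreal_powr x a = 0 \<longleftrightarrow> x = 0"
  by (cases x) (auto simp: ennreal_powr_ennreal ennreal_eq_0_iff powr_def split: if_splits)

lemma ennreal_powr_mono: "x \<le> y \<Longrightarrow> 0 \<le> a \<Longrightarrow> ennreal_powr x a \<le> ennreal_powr y a"
  by (cases x; cases y) (auto simp: ennreal_powr_ennreal intro!: ennreal_leI powr_mono2 simp: top_unique)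

lemma ennreal_powr_strict_mono:
  assumes "x < y" "0 < a" shows "ennreal_powr x a < ennreal_powr y a"
  using assms by (cases x; cases y) (auto simp: ennreal_powr_ennreal ennreal_less_iff intro: powr_less_mono2)

lemma ennreal_powr_mult: "ennreal_powr (x * y) a = ennreal_powr x a * ennreal_powr y a"
proof (cases "x = 0 \<or> y = 0")
  case False
  then show ?thesis
    by (cases x; cases y)
       (auto simp: ennreal_powr_ennreal ennreal_mult_top ennreal_top_mult powr_mult
             simp flip: ennreal_mult)
qed auto

lemma ennreal_mult_less_mono:
  fixes a b c d :: ennreal
  assumes "a < b" "c < d"
  shows "a * c < b * d"
proof -
  have "a * c \<le> a * d" using assms by (intro mult_left_mono) auto
  show ?thesis
  proof (cases "a = 0")
    case True
    then show ?thesis using assms by (auto simp: ennreal_zero_less_mult_iff intro: le_less_trans[OF zero_le])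
  next
    case False
    have "a * c < a * d"
      using assms False by (subst (1 2) mult.commute, intro ennreal_mult_strict_right_mono)
        (auto simp: less_le top_unique not_gr_zero)
    also have "\<dots> \<le> b * d" using assms by (intro mult_right_mono) auto
    finally show ?thesis .
  qed
qed

lemma ennreal_weighted_am_gm:
  assumes "0 < t" "t < 1"
  shows "ennreal_powr x t * ennreal_powr y (1 - t) \<le> ennreal t * x + ennreal (1 - t) * y"
proof (cases "x = 0 \<or> y = 0")
  case False
  show ?thesis
  proof (cases "x = \<infinity> \<or> y = \<infinity>")
    case True
    then have "ennreal t * x = top \<or> ennreal (1 - t) * y = top"
      using assms by (auto simp: ennreal_mult_top)
    then have "ennreal t * x + ennreal (1 - t) * y = top" by auto
    then show ?thesis by (metis top_greatest)
  next
    case fin: False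
    then obtain a b where ab: "x = ennreal a" "y = ennreal b" "0 \<le> a" "0 \<le> b"
      by (cases x; cases y) auto
    with False have "a > 0" "b > 0" by (auto simp: ennreal_eq_0_iff)
    then have "a powr t * b powr (1 - t) \<le> t * a + (1 - t) * b"
      using assms by (intro Youngs_inequality_0) auto
    then show ?thesis using ab assms
      by (simp add: ennreal_powr_ennreal ennreal_leI flip: ennreal_mult ennreal_plus)
  qed
qed auto

lemma ennreal_powr_weights:
  assumes "0 < t" "t < 1"
  shows "ennreal_powr x t * ennreal_powr x (1 - t) = x"
  by (cases x) (auto simp: ennreal_powr_ennreal ennreal_mult_top simp flip: ennreal_mult powr_add)

text \<open>Serves to remove truncations. One factor is treated at a time: were \<open>z\<close>
  below \<open>ennreal_powr X s * c\<close>, then \<open>z\<close> would be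
  \<open>v powr s * c'\<close> with \<open>ennreal v < X\<close>, and any \<open>x\<close> strictly
  between \<open>v\<close> and \<open>X\<close> contradicts the hypothesis. Zero factors are
  separate because nothing lies strictly below \<open>0\<close>.\<close>

lemma ennreal_powr_product_le_limit:
  assumes t: "0 < t" "t < 1"
    and le: "\<And>x y. x < X \<Longrightarrow> y < Y \<Longrightarrow> ennreal_powr x t * ennreal_powr y (1 - t) \<le> z"
  shows "ennreal_powr X t * ennreal_powr Y (1 - t) \<le> z"
proof -
  have gen: "ennreal_powr X s * c \<le> z" if s: "0 < s" and l: "\<And>x. x < X \<Longrightarrow> ennreal_powr x s * c \<le> z" 
    for X c s
  proof (cases "c = 0 \<or> X = 0")
    case nz: False
    show ?thesis
    proof (rule ccontr)
      assume "\<not> ?thesis"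
      then have zl: "z < ennreal_powr X s * c" by simp
      then obtain zr where zr: "z = ennreal zr" "0 \<le> zr" by (cases z) auto
      \<comment> \<open>An infinite \<open>c\<close> has to give way to a finite positive
        \<open>c'\<close>, since \<open>v\<close> is obtained by dividing by it.\<close>
      obtain c' where c': "0 < c'" "ennreal c' \<le> c" "z < ennreal_powr X s * ennreal c'"
      proof (cases "c = \<infinity>")
        case False
        then show ?thesis using that zl nz by (cases c) (auto simp: ennreal_eq_0_iff less_le)
      next
        case True
        obtain w where w: "0 < w" "ennreal w \<le> ennreal_powr X s"
        proof -
          have "ennreal_powr X s \<noteq> 0" using nz by simp
          then show ?thesis using that[of 1] that
            by (cases "ennreal_powr X s") (auto simp: ennreal_eq_0_iff less_le)
        qed
        have "z < ennreal w * ennreal ((zr + 1) / w)"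
          using w zr by (simp add: ennreal_less_iff flip: ennreal_mult)
        also have "\<dots> \<le> ennreal_powr X s * ennreal ((zr + 1) / w)"
          using w by (intro mult_right_mono) auto
        finally show ?thesis using that[of "(zr+1)/w"] True w zr by (auto simp: less_le)
      qed
      define v where "v = (zr / c') powr (1 / s)"
      have v: "v \<ge> 0" "v powr s = zr / c'"
        using c' zr s by (auto simp: v_def powr_powr)
      have "ennreal v < X"
      proof (rule ccontr)
        assume "\<not> ?thesis"
        then have "ennreal_powr X s \<le> ennreal_powr (ennreal v) s"
          using s by (intro ennreal_powr_mono) auto
        then have "ennreal_powr X s * ennreal c' \<le> ennreal (zr / c') * ennreal c'"
          using v by (intro mult_right_mono) (auto simp: ennreal_powr_ennreal)
        also have "\<dots> = z" using c' zr by (simp flip: ennreal_mult)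
        finally show False using c'(3) by simp
      qed
      then obtain x where x: "ennreal v < x" "x < X" using dense by blast
      have "z = ennreal_powr (ennreal v) s * ennreal c'"
        using v c' zr by (simp add: ennreal_powr_ennreal flip: ennreal_mult)
      also have "\<dots> < ennreal_powr x s * ennreal c'"
        using ennreal_powr_strict_mono[OF x(1) s] c' 
        by (intro ennreal_mult_strict_right_mono) auto
      also have "\<dots> \<le> ennreal_powr x s * c" using c' by (intro mult_left_mono) auto
      also have "\<dots> \<le> z" by (rule l[OF x(2)])
      finally show False by simp
    qed
  qed auto
  have 1: "ennreal_powr X t * ennreal_powr y (1 - t) \<le> z" if "y < Y" for y
    using gen[of t X "ennreal_powr y (1 - t)"] le that t by blast
  show ?thesis using gen[of "1 - t" Y "ennreal_powr X t"] 1 t by (simp add: mult.commute)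
qed

text \<open>The value \<open>f x\<close> is the length of
  \<open>{s. 0 < s \<and> ennreal s < f x}\<close>, a half-line if \<open>f x\<close> is infinite;
  Tonelli exchanges the two integrations.\<close>

lemma nn_integral_layer_cake:
  fixes f :: "'a \<Rightarrow> ennreal"
  assumes [measurable]: "f \<in> borel_measurable M" and "sigma_finite_measure M"
  shows "(\<integral>\<^sup>+x. f x \<partial>M) = (\<integral>\<^sup>+s. indicator {0<..} s * emeasure M {x\<in>space M. ennreal s < f x} \<partial>lborel)"
proof -
  interpret M: sigma_finite_measure M by fact
  interpret pair_sigma_finite M "lborel :: real measure" ..
  have f: "f x = (\<integral>\<^sup>+s. indicator {s. 0 < s \<and> ennreal s < f x} s \<partial>lborel)" for x
  proof (cases "f x")
    case (real r)
    then have "{s. 0 < s \<and> ennreal s < f x} = {0<..<r}" by (auto simp: ennreal_less_iff)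
    then show ?thesis using real by simp
  next
    case top
    then have "{s. 0 < s \<and> ennreal s < f x} = {0<..}" by auto
    moreover have "emeasure lborel {0::real<..} = \<infinity>"
    proof -
      have "ennreal (real n) \<le> emeasure lborel {0::real<..}" for n
      proof -
        have "emeasure lborel {0<..<real n} \<le> emeasure lborel {0::real<..}"
          by (intro emeasure_mono) auto
        then show ?thesis by simp
      qed
      then show ?thesis
        using ennreal_Ex_less_of_nat[of "emeasure lborel {0::real<..}"]
        by (metis ennreal_of_nat_eq_real_of_nat infinity_ennreal_def leD top.not_eq_extremum)
    qed
    ultimately show ?thesis using top by simp
  qed
  have "(\<integral>\<^sup>+x. f x \<partial>M) = (\<integral>\<^sup>+x. \<integral>\<^sup>+s. indicator {s. 0 < s \<and> ennreal s < f x} s \<partial>lborel \<partial>M)"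
    using f by simp
  also have "\<dots> = (\<integral>\<^sup>+x. \<integral>\<^sup>+s. indicator {0<..} s * indicator {x\<in>space M. ennreal s < f x} x \<partial>lborel \<partial>M)"
    by (intro nn_integral_cong) (auto split: split_indicator)
  also have "\<dots> = (\<integral>\<^sup>+s. \<integral>\<^sup>+x. indicator {0<..} s * indicator {x\<in>space M. ennreal s < f x} x \<partial>M \<partial>lborel)"
    by (intro Fubini'[symmetric]) measurable
  also have "\<dots> = (\<integral>\<^sup>+s. indicator {0<..} s * emeasure M {x\<in>space M. ennreal s < f x} \<partial>lborel)"
    by (intro nn_integral_cong) (simp add: nn_integral_cmult)
  finally show ?thesis .
qed

section \<open>Brunn--Minkowski on the line\<close>

text \<open>Stands in for a maximum, which a Borel set need not have: the cut is made at a point of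
  \<open>A\<close>, so that translation by this point remains available. If there is no maximum, the
  rationals dominated by points of \<open>A\<close> are cofinal in \<open>A\<close>, and countably
  many cuts exhaust it.\<close>

lemma emeasure_up_to_max_approx:
  fixes A :: "real set"
  assumes [measurable]: "A \<in> sets borel" and "A \<noteq> {}" and c: "c < emeasure lborel A"
  shows "\<exists>a\<in>A. c < emeasure lborel (A \<inter> {..a})"
proof (cases "\<exists>m\<in>A. \<forall>x\<in>A. x \<le> m")
  case True
  then obtain m where "m \<in> A" "\<forall>x\<in>A. x \<le> m" by blast
  moreover from this have "A \<inter> {..m} = A" by auto
  ultimately show ?thesis using c by (intro bexI[of _ m]) simp_all
next
  case False
  then have up: "\<exists>y\<in>A. x < y" if "x \<in> A" for x using that by (meson not_le)
  define Q where "Q = {q\<in>\<rat>. \<exists>a\<in>A. q \<le> a}"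
  have Qne: "Q \<noteq> {}"
  proof -
    obtain a y where "a \<in> A" "y \<in> A" "a < y" using \<open>A \<noteq> {}\<close> up by blast
    with Rats_dense_in_real[of a y] obtain q where "q \<in> \<rat>" "q < y" by blast
    then show ?thesis unfolding Q_def using \<open>y \<in> A\<close> less_imp_le by blast
  qed
  have Qc: "countable Q" unfolding Q_def using countable_rat by (rule countable_subset[rotated]) auto
  \<comment> \<open>Maxima over initial segments of an enumeration make the cuts increase, as
    continuity from below requires.\<close>
  define b where "b n = Max (from_nat_into Q ` {..n})" for n
  have bQ: "b n \<in> Q" for n
  proof -
    have "b n \<in> from_nat_into Q ` {..n}" unfolding b_def by (intro Max_in) auto
    then show ?thesis using from_nat_into[OF Qne] by auto
  qed
  have bmono: "mono b" unfolding b_def by (intro monoI Max_mono) auto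
  have un: "(\<Union>n. A \<inter> {..b n}) = A"
  proof -
    have "\<exists>n. x \<le> b n" if x: "x \<in> A" for x
    proof -
      obtain y where y: "y \<in> A" "x < y" using up[OF x] by blast
      obtain q where q: "q \<in> \<rat>" "x < q" "q < y" using Rats_dense_in_real[OF y(2)] by blast
      have "\<exists>a\<in>A. q \<le> a" using y(1) q(3) by (intro bexI[of _ y] less_imp_le)
      with q(1) have "q \<in> Q" unfolding Q_def by simp
      then obtain n where n: "from_nat_into Q n = q" using from_nat_into_surj[OF Qc] by metis
      have "q \<le> b n" unfolding b_def by (intro Max_ge) (auto simp flip: n)
      then show ?thesis using q by (intro exI[of _ n]) auto
    qed
    then show ?thesis by auto
  qed
  have "(SUP n. emeasure lborel (A \<inter> {..b n})) = emeasure lborel (\<Union>n. A \<inter> {..b n})"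
  proof (rule SUP_emeasure_incseq)
    show "incseq (\<lambda>n. A \<inter> {..b n})" using monoD[OF bmono] by (intro monoI Int_mono) auto
  qed auto
  then have "c < (SUP n. emeasure lborel (A \<inter> {..b n}))" using c unfolding un by simp
  then obtain n where n: "c < emeasure lborel (A \<inter> {..b n})" unfolding less_SUP_iff by blast
  obtain a where a: "a \<in> A" "b n \<le> a" using bQ[of n] by (auto simp: Q_def)
  have "emeasure lborel (A \<inter> {..b n}) \<le> emeasure lborel (A \<inter> {..a})"
    using a by (intro emeasure_mono Int_mono) auto
  with n have "c < emeasure lborel (A \<inter> {..a})" by (rule less_le_trans)
  then show ?thesis using a(1) by blast
qed

lemma emeasure_lborel_affine_image:
  fixes A :: "real set"
  assumes [measurable]: "A \<in> sets borel" and c: "c \<noteq> 0"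
  shows "emeasure lborel {x. t + c * x \<in> A} = emeasure lborel A / ennreal \<bar>c\<bar>"
proof -
  have "emeasure lborel A = (\<integral>\<^sup>+x. indicator A x \<partial>lborel)" by simp
  also have "\<dots> = \<bar>c\<bar> * (\<integral>\<^sup>+x. indicator A (t + c * x) \<partial>lborel)"
    by (rule nn_integral_real_affine) (use c in auto)
  also have "(\<integral>\<^sup>+x. indicator A (t + c * x) \<partial>lborel) = (\<integral>\<^sup>+x. indicator {x. t + c * x \<in> A} x \<partial>lborel)"
    by (simp add: indicator_def)
  also have "\<dots> = emeasure lborel {x. t + c * x \<in> A}" by (intro nn_integral_indicator) simp
  finally show ?thesis using c
    by (simp add: ennreal_times_divide mult.commute[of "ennreal \<bar>c\<bar>"] ennreal_mult_divide_eq)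
qed

text \<open>The one-sided hypotheses cover \<open>X = 0\<close> and \<open>Y = 0\<close>: nothing
  lies strictly below \<open>0\<close>, so the joint hypothesis is then vacuous.\<close>

lemma ennreal_add_le_approx:
  fixes X Y z :: ennreal
  assumes X: "\<And>x. x < X \<Longrightarrow> x \<le> z" and Y: "\<And>y. y < Y \<Longrightarrow> y \<le> z"
    and XY: "\<And>x y. x < X \<Longrightarrow> y < Y \<Longrightarrow> x + y \<le> z"
  shows "X + Y \<le> z"
proof -
  have aux: "X + y \<le> z" if y: "y \<le> z" and le: "\<And>x. x < X \<Longrightarrow> x + y \<le> z" for X y
  proof (rule ccontr)
    assume "\<not> ?thesis"
    then have l: "z < X + y" by simp
    then obtain zr where zr: "z = ennreal zr" "0 \<le> zr" by (cases z) auto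
    with y obtain yr where yr: "y = ennreal yr" "0 \<le> yr" "yr \<le> zr" by (cases y) (auto simp: top_unique)
    have "ennreal (zr - yr) < X"
      using l zr yr by (cases X) (auto simp: ennreal_less_iff simp flip: ennreal_plus)
    then obtain x where x: "ennreal (zr - yr) < x" "x < X" using dense by blast
    then have "x + y \<le> z" using le by blast
    then show False using x(1) zr yr
      by (cases x) (auto simp: ennreal_less_iff top_unique simp flip: ennreal_plus)
  qed
  have "X \<le> z" "Y \<le> z" using X Y by (meson dense_le)+
  have "X + y \<le> z" if "y < Y" for y using aux[of y X] Y[OF that] XY[OF _ that] by blast
  then show ?thesis using aux[of X Y] \<open>X \<le> z\<close> by (simp add: add.commute)
qed

text \<open>The pieces of \<open>A\<close> below \<open>a\<close> and of \<open>B\<close> above \<open>b\<close>, translated by \<open>b\<close> and \<open>a\<close>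
  respectively, overlap at most in the point \<open>a + b\<close>.\<close>

lemma brunn_minkowski_real:
  fixes A B C :: "real set"
  assumes [measurable]: "A \<in> sets borel" "B \<in> sets borel" "C \<in> sets borel"
    and ne: "A \<noteq> {}" "B \<noteq> {}"
    and C: "\<And>x y. x \<in> A \<Longrightarrow> y \<in> B \<Longrightarrow> x + y \<in> C"
  shows "emeasure lborel A + emeasure lborel B \<le> emeasure lborel C"
proof -
  have refl: "emeasure lborel {x. - x \<in> D} = emeasure lborel D" if "D \<in> sets borel" for D :: "real set"
    using emeasure_lborel_affine_image[OF that, of "-1" 0]
    by (simp add: divide_ennreal_def)
  have trans: "emeasure lborel {x. x - s \<in> D} = emeasure lborel D" if "D \<in> sets borel" for D :: "real set" and s
    using emeasure_lborel_affine_image[OF that, of 1 "-s"]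
    by (simp add: algebra_simps divide_ennreal_def)
  have pieces: "emeasure lborel (A \<inter> {..a}) + emeasure lborel (B \<inter> {b..}) \<le> emeasure lborel C"
    if ab: "a \<in> A" "b \<in> B" for a b
  proof -
    define P where "P = {x. x - b \<in> A \<inter> {..a}}"
    define Q where "Q = {x. x - a \<in> B \<inter> {b..}}"
    have [measurable]: "P \<in> sets borel" "Q \<in> sets borel" unfolding P_def Q_def by measurable
    have PQ: "P \<inter> Q \<subseteq> {a + b}" unfolding P_def Q_def by auto
    have sub: "P \<union> Q \<subseteq> C" 
    proof
      fix x assume "x \<in> P \<union> Q"
      then show "x \<in> C" using C[of "x - b" b] C[of a "x - a"] ab by (auto simp: P_def Q_def)
    qed
    have "emeasure lborel (A \<inter> {..a}) + emeasure lborel (B \<inter> {b..}) = emeasure lborel P + emeasure lborel Q"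
      unfolding P_def Q_def by (subst (1 2) trans) auto
    also have "\<dots> = emeasure lborel (P - {a + b}) + emeasure lborel Q"
      using emeasure_Diff_null_set[of "{a+b}" lborel P] by (simp add: null_sets_def)
    also have "\<dots> = emeasure lborel ((P - {a + b}) \<union> Q)"
      using PQ by (intro plus_emeasure) auto
    also have "\<dots> \<le> emeasure lborel C" using sub by (intro emeasure_mono) auto
    finally show ?thesis .
  qed
  \<comment> \<open>Reflection at the origin turns the approximation by cuts from above into one by
    cuts from below.\<close>
  have Bapp: "\<exists>b\<in>B. d < emeasure lborel (B \<inter> {b..})" if "d < emeasure lborel B" for d
  proof -
    have 1: "{x. - x \<in> B} \<in> sets borel" by measurable
    have "{x. - x \<in> B} \<noteq> {}" using ne by (metis (mono_tags, lifting) equals0I mem_Collect_eq minus_minus empty_iff)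
    from emeasure_up_to_max_approx[OF 1 this, of d] that
    obtain a where a: "- a \<in> B" "d < emeasure lborel ({x. - x \<in> B} \<inter> {..a})" by (auto simp: refl)
    have "{x. - x \<in> B} \<inter> {..a} = {x. - x \<in> B \<inter> {-a..}}" by auto
    then have "emeasure lborel ({x. - x \<in> B} \<inter> {..a}) = emeasure lborel (B \<inter> {-a..})"
      using refl[of "B \<inter> {-a..}"] by simp
    then show ?thesis using a by (intro bexI[of _ "-a"]) auto
  qed
  show ?thesis
  proof (rule ennreal_add_le_approx)
    obtain a0 b0 where ab0: "a0 \<in> A" "b0 \<in> B" using ne by auto
    have Aapp: "\<exists>a\<in>A. x < emeasure lborel (A \<inter> {..a})" if "x < emeasure lborel A" for x
      using emeasure_up_to_max_approx[OF assms(1) ne(1) that] .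
    show "x \<le> emeasure lborel C" if "x < emeasure lborel A" for x
    proof -
      obtain a where a: "a \<in> A" "x < emeasure lborel (A \<inter> {..a})" using Aapp[OF \<open>x < _\<close>] by blast
      have "x \<le> emeasure lborel (A \<inter> {..a}) + emeasure lborel (B \<inter> {b0..})"
        by (rule add_increasing2[OF zero_le less_imp_le[OF a(2)]])
      also note pieces[OF a(1) ab0(2)]
      finally show ?thesis .
    qed
    show "y \<le> emeasure lborel C" if "y < emeasure lborel B" for y
    proof -
      obtain b where b: "b \<in> B" "y < emeasure lborel (B \<inter> {b..})" using Bapp[OF \<open>y < _\<close>] by blast
      have "y \<le> emeasure lborel (A \<inter> {..a0}) + emeasure lborel (B \<inter> {b..})"
        by (rule add_increasing[OF zero_le less_imp_le[OF b(2)]])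
      also note pieces[OF ab0(1) b(1)]
      finally show ?thesis .
    qed
    show "x + y \<le> emeasure lborel C" if "x < emeasure lborel A" "y < emeasure lborel B" for x y
    proof -
      obtain a b where ab: "a \<in> A" "x < emeasure lborel (A \<inter> {..a})"
        "b \<in> B" "y < emeasure lborel (B \<inter> {b..})"
        using Aapp[OF \<open>x < _\<close>] Bapp[OF \<open>y < _\<close>] by blast
      show ?thesis
        using add_mono[OF less_imp_le[OF ab(2)] less_imp_le[OF ab(4)]] pieces[OF ab(1,3)] by (rule order_trans)
    qed
  qed
qed

text \<open>Normalising the suprema to \<open>1\<close> makes all superlevel sets
  at heights below \<open>1\<close> nonempty, so the Brunn--Minkowski inequality applies to each of them.\<close>

lemma prekopa_leindler_real_bounded:
  fixes f g h :: "real \<Rightarrow> ennreal"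
  assumes [measurable]: "f \<in> borel_measurable borel" "g \<in> borel_measurable borel" "h \<in> borel_measurable borel"
    and t: "0 < t" "t < 1"
    and h: "\<And>x y. ennreal_powr (f x) t * ennreal_powr (g y) (1 - t) \<le> h (t * x + (1 - t) * y)"
    and bd: "(SUP x. f x) < \<infinity>" "(SUP x. g x) < \<infinity>"
  shows "ennreal_powr (\<integral>\<^sup>+x. f x \<partial>lborel) t * ennreal_powr (\<integral>\<^sup>+x. g x \<partial>lborel) (1 - t) \<le> (\<integral>\<^sup>+x. h x \<partial>lborel)"
proof (cases "(SUP x. f x) = 0 \<or> (SUP x. g x) = 0")
  case True
  then have "f = (\<lambda>x. 0) \<or> g = (\<lambda>x. 0)"
    using SUP_bot_conv(1)[of f UNIV] SUP_bot_conv(1)[of g UNIV] by (auto simp: bot_ennreal fun_eq_iff)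
  then show ?thesis by (elim disjE) simp_all
next
  case False
  obtain \<alpha> where \<alpha>: "(SUP x. f x) = ennreal \<alpha>" "\<alpha> > 0"
    using False bd by (cases "SUP x. f x") (auto simp: ennreal_eq_0_iff less_le)
  obtain \<beta> where \<beta>: "(SUP x. g x) = ennreal \<beta>" "\<beta> > 0"
    using False bd by (cases "SUP x. g x") (auto simp: ennreal_eq_0_iff less_le)
  define \<gamma> where "\<gamma> = \<alpha> powr t * \<beta> powr (1 - t)"
  have \<gamma>: "\<gamma> > 0" using \<alpha> \<beta> by (simp add: \<gamma>_def)
  define F where "F x = ennreal (1/\<alpha>) * f x" for x
  define G where "G x = ennreal (1/\<beta>) * g x" for x
  define H where "H x = ennreal (1/\<gamma>) * h x" for x
  have [measurable]: "F \<in> borel_measurable borel" "G \<in> borel_measurable borel" "H \<in> borel_measurable borel"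
    unfolding F_def G_def H_def by measurable
  have \<gamma>i: "ennreal (1/\<gamma>) = ennreal_powr (ennreal (1/\<alpha>)) t * ennreal_powr (ennreal (1/\<beta>)) (1 - t)"
    using \<alpha> \<beta> by (simp add: \<gamma>_def ennreal_powr_ennreal powr_divide flip: ennreal_mult)
  have FGH: "ennreal_powr (F x) t * ennreal_powr (G y) (1 - t) \<le> H (t * x + (1 - t) * y)" for x y
  proof -
    have "ennreal_powr (F x) t * ennreal_powr (G y) (1 - t)
        = ennreal (1/\<gamma>) * (ennreal_powr (f x) t * ennreal_powr (g y) (1 - t))"
      unfolding F_def G_def ennreal_powr_mult \<gamma>i by (simp add: mult_ac)
    also have "\<dots> \<le> H (t * x + (1 - t) * y)" unfolding H_def using h by (intro mult_left_mono) auto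
    finally show ?thesis .
  qed
  have Fex: "\<exists>x. ennreal s < F x" if "0 < s" "s < 1" for s
  proof -
    have "ennreal (s * \<alpha>) < (SUP x. f x)" using that \<alpha> by (simp add: ennreal_less_iff)
    then obtain x where "ennreal (s * \<alpha>) < f x" by (auto simp: less_SUP_iff)
    then have "ennreal (s * \<alpha>) * ennreal (1/\<alpha>) < f x * ennreal (1/\<alpha>)"
      using \<alpha> by (intro ennreal_mult_strict_right_mono) auto
    then show ?thesis using \<alpha> that by (auto simp: F_def mult.commute simp flip: ennreal_mult)
  qed
  have Gex: "\<exists>x. ennreal s < G x" if "0 < s" "s < 1" for s
  proof -
    have "ennreal (s * \<beta>) < (SUP x. g x)" using that \<beta> by (simp add: ennreal_less_iff)
    then obtain x where "ennreal (s * \<beta>) < g x" by (auto simp: less_SUP_iff)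
    then have "ennreal (s * \<beta>) * ennreal (1/\<beta>) < g x * ennreal (1/\<beta>)"
      using \<beta> by (intro ennreal_mult_strict_right_mono) auto
    then show ?thesis using \<beta> that by (auto simp: G_def mult.commute simp flip: ennreal_mult)
  qed
  have Fle: "F x \<le> 1" for x
  proof -
    have "F x \<le> ennreal (1/\<alpha>) * ennreal \<alpha>" unfolding F_def \<alpha>(1)[symmetric] 
      by (intro mult_left_mono SUP_upper) auto
    then show ?thesis using \<alpha> by (simp flip: ennreal_mult)
  qed
  have Gle: "G x \<le> 1" for x
  proof -
    have "G x \<le> ennreal (1/\<beta>) * ennreal \<beta>" unfolding G_def \<beta>(1)[symmetric] 
      by (intro mult_left_mono SUP_upper) auto
    then show ?thesis using \<beta> by (simp flip: ennreal_mult)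
  qed
  have level: "ennreal t * (indicator {0<..} s * emeasure lborel {x\<in>space lborel. ennreal s < F x})
     + ennreal (1-t) * (indicator {0<..} s * emeasure lborel {x\<in>space lborel. ennreal s < G x})
     \<le> indicator {0<..} s * emeasure lborel {x\<in>space lborel. ennreal s < H x}" for s :: real
  proof (cases "0 < s \<and> s < 1")
    case True
    have s1: "emeasure lborel {x. 0 + (1/r) * x \<in> {x. ennreal s < k x}} = ennreal r * emeasure lborel {x. ennreal s < k x}"
      if [measurable]: "k \<in> borel_measurable borel" and "0 < r" for k and r :: real
      using that by (subst emeasure_lborel_affine_image) (auto simp: divide_ennreal_def inverse_ennreal mult.commute)
    have "ennreal t * emeasure lborel {x. ennreal s < F x} + ennreal (1-t) * emeasure lborel {x. ennreal s < G x}
      = emeasure lborel {x. 0 + (1/t) * x \<in> {x. ennreal s < F x}} + emeasure lborel {x. 0 + (1/(1-t)) * x \<in> {x. ennreal s < G x}}"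
      using t by (simp only: s1 \<open>F \<in> _\<close> \<open>G \<in> _\<close> diff_gt_0_iff_gt)
    also have "\<dots> \<le> emeasure lborel {x. ennreal s < H x}"
    proof (rule brunn_minkowski_real)
      obtain x where "ennreal s < F x" using Fex True by auto
      then have "t * x \<in> {x. 0 + 1 / t * x \<in> {x. ennreal s < F x}}" using t by simp
      then show "{x. 0 + 1 / t * x \<in> {x. ennreal s < F x}} \<noteq> {}" by blast
      obtain x where "ennreal s < G x" using Gex True by auto
      then have "(1 - t) * x \<in> {x. 0 + 1 / (1 - t) * x \<in> {x. ennreal s < G x}}" using t by simp
      then show "{x. 0 + 1 / (1 - t) * x \<in> {x. ennreal s < G x}} \<noteq> {}" by blast
    next
      fix x y assume "x \<in> {x. 0 + 1 / t * x \<in> {x. ennreal s < F x}}"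
          "y \<in> {x. 0 + 1 / (1 - t) * x \<in> {x. ennreal s < G x}}"
      then have xy: "ennreal s < F (x/t)" "ennreal s < G (y / (1-t))" by auto
      have "ennreal s = ennreal_powr (ennreal s) t * ennreal_powr (ennreal s) (1 - t)"
        using t by (simp add: ennreal_powr_weights)
      also have "\<dots> < ennreal_powr (F (x/t)) t * ennreal_powr (G (y / (1-t))) (1 - t)"
        using xy t by (intro ennreal_mult_less_mono ennreal_powr_strict_mono) auto
      also have "\<dots> \<le> H (t * (x/t) + (1-t) * (y/(1-t)))" by (rule FGH)
      also have "t * (x/t) + (1-t) * (y/(1-t)) = x + y" using t by simp
      finally show "x + y \<in> {x. ennreal s < H x}" by simp
    qed (use t in measurable)
    finally show ?thesis using True by simp
  next
    case False
    then consider "s \<le> 0" | "s \<ge> 1" by linarith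
    then show ?thesis
    proof cases
      case 2
      then have "\<not> ennreal s < F x" "\<not> ennreal s < G x" for x
        using Fle[of x] Gle[of x] by (auto simp: not_less intro: order_trans)
      then show ?thesis by simp
    qed auto
  qed
  have sf: "sigma_finite_measure (lborel :: real measure)" ..
  \<comment> \<open>Once the suprema are normalised the stronger bound by the arithmetic mean holds,
    and this form is linear, so it can be integrated over the heights.\<close>
  have "ennreal_powr (\<integral>\<^sup>+x. F x \<partial>lborel) t * ennreal_powr (\<integral>\<^sup>+x. G x \<partial>lborel) (1 - t)
     \<le> ennreal t * (\<integral>\<^sup>+x. F x \<partial>lborel) + ennreal (1-t) * (\<integral>\<^sup>+x. G x \<partial>lborel)"
    using t by (rule ennreal_weighted_am_gm)
  also have "\<dots> = (\<integral>\<^sup>+s. ennreal t * (indicator {0<..} s * emeasure lborel {x\<in>space lborel. ennreal s < F x})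
     + ennreal (1-t) * (indicator {0<..} s * emeasure lborel {x\<in>space lborel. ennreal s < G x}) \<partial>lborel)"
    by (subst (1 2) nn_integral_layer_cake[OF _ sf]) (simp_all add: nn_integral_add nn_integral_cmult)
  also have "\<dots> \<le> (\<integral>\<^sup>+s. indicator {0<..} s * emeasure lborel {x\<in>space lborel. ennreal s < H x} \<partial>lborel)"
    by (intro nn_integral_mono level)
  also have "\<dots> = (\<integral>\<^sup>+x. H x \<partial>lborel)"
    by (subst nn_integral_layer_cake[OF _ sf, of H]) simp_all
  finally have "ennreal (1/\<gamma>) * (ennreal_powr (\<integral>\<^sup>+x. f x \<partial>lborel) t * ennreal_powr (\<integral>\<^sup>+x. g x \<partial>lborel) (1 - t))
     \<le> ennreal (1/\<gamma>) * (\<integral>\<^sup>+x. h x \<partial>lborel)"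
    unfolding F_def G_def H_def
    by (simp add: nn_integral_cmult ennreal_powr_mult) (simp add: \<gamma>i mult_ac)
  then have "ennreal \<gamma> * (ennreal (1/\<gamma>) * (ennreal_powr (\<integral>\<^sup>+x. f x \<partial>lborel) t * ennreal_powr (\<integral>\<^sup>+x. g x \<partial>lborel) (1 - t)))
     \<le> ennreal \<gamma> * (ennreal (1/\<gamma>) * (\<integral>\<^sup>+x. h x \<partial>lborel))" by (rule mult_left_mono) simp
  then show ?thesis using \<gamma> by (simp flip: mult.assoc ennreal_mult)
qed

text \<open>Truncating \<open>f\<close> and \<open>g\<close> at integer heights makes the suprema
  finite and keeps the hypothesis; the truncated integrals increase to the full ones.\<close>

lemma prekopa_leindler_real:
  fixes f g h :: "real \<Rightarrow> ennreal"
  assumes [measurable]: "f \<in> borel_measurable borel" "g \<in> borel_measurable borel" "h \<in> borel_measurable borel"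
    and t: "0 < t" "t < 1"
    and h: "\<And>x y. ennreal_powr (f x) t * ennreal_powr (g y) (1 - t) \<le> h (t * x + (1 - t) * y)"
  shows "ennreal_powr (\<integral>\<^sup>+x. f x \<partial>lborel) t * ennreal_powr (\<integral>\<^sup>+x. g x \<partial>lborel) (1 - t) \<le> (\<integral>\<^sup>+x. h x \<partial>lborel)"
proof (rule ennreal_powr_product_le_limit[OF t])
  have trunc: "(\<integral>\<^sup>+x. k x \<partial>lborel) = (SUP n::nat. \<integral>\<^sup>+x. min (k x) (of_nat n) \<partial>lborel)"
    if [measurable]: "k \<in> borel_measurable borel" for k :: "real \<Rightarrow> ennreal"
  proof -
    have "(SUP n::nat. min (k x) (of_nat n)) = k x" for x
    proof -
      have "(SUP n::nat. inf (k x) (of_nat n)) = inf (k x) (SUP n. of_nat n)" by (simp add: inf_SUP)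
      then show ?thesis by (simp add: inf_min ennreal_SUP_of_nat_eq_top)
    qed
    then have "(\<integral>\<^sup>+x. k x \<partial>lborel) = (\<integral>\<^sup>+x. (SUP n::nat. min (k x) (of_nat n)) \<partial>lborel)" by simp
    also have "\<dots> = (SUP n::nat. \<integral>\<^sup>+x. min (k x) (of_nat n) \<partial>lborel)"
      by (intro nn_integral_monotone_convergence_SUP) (auto simp: incseq_def le_fun_def min_def intro: order_trans)
    finally show ?thesis .
  qed
  fix X Y assume "X < (\<integral>\<^sup>+x. f x \<partial>lborel)" "Y < (\<integral>\<^sup>+x. g x \<partial>lborel)"
  then obtain m n :: nat where mn: "X < (\<integral>\<^sup>+x. min (f x) (of_nat m) \<partial>lborel)" "Y < (\<integral>\<^sup>+x. min (g x) (of_nat n) \<partial>lborel)"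
    unfolding trunc[OF assms(1)] trunc[OF assms(2)] by (auto simp: less_SUP_iff)
  have "ennreal_powr X t * ennreal_powr Y (1 - t)
    \<le> ennreal_powr (\<integral>\<^sup>+x. min (f x) (of_nat m) \<partial>lborel) t * ennreal_powr (\<integral>\<^sup>+x. min (g x) (of_nat n) \<partial>lborel) (1 - t)"
    using mn t by (intro mult_mono ennreal_powr_mono) auto
  also have "\<dots> \<le> (\<integral>\<^sup>+x. h x \<partial>lborel)"
  proof (rule prekopa_leindler_real_bounded[OF _ _ _ t])
    fix x y
    have "ennreal_powr (min (f x) (of_nat m)) t * ennreal_powr (min (g y) (of_nat n)) (1 - t)
      \<le> ennreal_powr (f x) t * ennreal_powr (g y) (1 - t)"
      using t by (intro mult_mono ennreal_powr_mono) auto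
    then show "ennreal_powr (min (f x) (of_nat m)) t * ennreal_powr (min (g y) (of_nat n)) (1 - t)
      \<le> h (t * x + (1 - t) * y)" using h order_trans by blast
  next
    have "(SUP x. min (k x) (of_nat m :: ennreal)) \<le> of_nat m" for m and k :: "real \<Rightarrow> ennreal"
      by (rule SUP_least) auto
    then show "(SUP x. min (f x) (of_nat m)) < \<infinity>" "(SUP x. min (g x) (of_nat n)) < \<infinity>"
      by (metis infinity_ennreal_def le_less_trans of_nat_less_top)+
  qed measurable
  finally show "ennreal_powr X t * ennreal_powr Y (1 - t) \<le> (\<integral>\<^sup>+x. h x \<partial>lborel)" .
qed

section \<open>Tensorisation to finite products\<close>

interpretation lborel_product: product_sigma_finite "\<lambda>_::'i. lborel :: real measure"
  by standard

lemma measurable_PiM_slice: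
  assumes [measurable]: "f \<in> borel_measurable (\<Pi>\<^sub>M i\<in>insert i I. (lborel :: real measure))"
    and x: "x \<in> extensional I"
  shows "(\<lambda>a. f (x(i := a))) \<in> borel_measurable borel"
proof -
  have "x \<in> space (\<Pi>\<^sub>M i\<in>I. lborel :: real measure)" using x by (simp add: space_PiM PiE_UNIV_domain PiE_def)
  then have [measurable]: "(\<lambda>a. x) \<in> borel \<rightarrow>\<^sub>M (\<Pi>\<^sub>M i\<in>I. lborel :: real measure)" by simp
  show ?thesis by measurable
qed

text \<open>By the one-dimensional inequality, the integrals over the new coordinate satisfy the
  hypothesis in the remaining ones, so induction applies. Points are restricted to
  \<open>extensional I\<close> because they make up the space of the product measure.\<close>

lemma prekopa_leindler_PiM:
  fixes f g h :: "('i \<Rightarrow> real) \<Rightarrow> ennreal"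
  assumes "finite I"
    and "f \<in> borel_measurable (\<Pi>\<^sub>M i\<in>I. lborel)" "g \<in> borel_measurable (\<Pi>\<^sub>M i\<in>I. lborel)"
      "h \<in> borel_measurable (\<Pi>\<^sub>M i\<in>I. lborel)"
    and t: "0 < t" "t < 1"
    and "\<And>x y. x \<in> extensional I \<Longrightarrow> y \<in> extensional I \<Longrightarrow>
      ennreal_powr (f x) t * ennreal_powr (g y) (1 - t) \<le> h (\<lambda>i\<in>I. t * x i + (1 - t) * y i)"
  shows "ennreal_powr (\<integral>\<^sup>+x. f x \<partial>(\<Pi>\<^sub>M i\<in>I. lborel)) t * ennreal_powr (\<integral>\<^sup>+x. g x \<partial>(\<Pi>\<^sub>M i\<in>I. lborel)) (1 - t)
    \<le> (\<integral>\<^sup>+x. h x \<partial>(\<Pi>\<^sub>M i\<in>I. lborel))"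
  using assms(1-4,7)
proof (induction I arbitrary: f g h)
  case empty
  have "ennreal_powr (f (\<lambda>_. undefined)) t * ennreal_powr (g (\<lambda>_. undefined)) (1 - t) \<le> h (\<lambda>_. undefined)"
    using empty(4)[of "\<lambda>_. undefined" "\<lambda>_. undefined"] by (simp add: restrict_def)
  then show ?case by (simp add: PiM_empty nn_integral_count_space_finite)
next
  case (insert i I)
  note [measurable] = insert.prems(1-3)
  have restr: "(\<lambda>j\<in>insert i I. t * (x(i := a)) j + (1 - t) * (y(i := b)) j)
      = (\<lambda>j\<in>I. t * x j + (1 - t) * y j)(i := t * a + (1 - t) * b)" for x y and a b :: real
    using insert.hyps by (auto simp: restrict_def fun_eq_iff)
  note slice = measurable_PiM_slice
  have par: "(\<lambda>x. \<integral>\<^sup>+a. k (x(i := a)) \<partial>lborel) \<in> borel_measurable (\<Pi>\<^sub>M i\<in>I. lborel)"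
    if [measurable]: "k \<in> borel_measurable (\<Pi>\<^sub>M i\<in>insert i I. lborel)" for k :: "('i \<Rightarrow> real) \<Rightarrow> ennreal"
    by measurable
  have "ennreal_powr (\<integral>\<^sup>+x. \<integral>\<^sup>+a. f (x(i := a)) \<partial>lborel \<partial>(\<Pi>\<^sub>M i\<in>I. lborel)) t
      * ennreal_powr (\<integral>\<^sup>+x. \<integral>\<^sup>+a. g (x(i := a)) \<partial>lborel \<partial>(\<Pi>\<^sub>M i\<in>I. lborel)) (1 - t)
    \<le> (\<integral>\<^sup>+x. \<integral>\<^sup>+a. h (x(i := a)) \<partial>lborel \<partial>(\<Pi>\<^sub>M i\<in>I. lborel))"
  proof (rule insert.IH[OF par par par])
    fix x y :: "'i \<Rightarrow> real" assume xy: "x \<in> extensional I" "y \<in> extensional I"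
    show "ennreal_powr (\<integral>\<^sup>+a. f (x(i := a)) \<partial>lborel) t * ennreal_powr (\<integral>\<^sup>+a. g (y(i := a)) \<partial>lborel) (1 - t)
      \<le> (\<integral>\<^sup>+a. h ((\<lambda>i\<in>I. t * x i + (1 - t) * y i)(i := a)) \<partial>lborel)"
    proof (rule prekopa_leindler_real[OF slice slice slice[OF _ restrict_extensional] t])
      fix a b
      have "x(i := a) \<in> extensional (insert i I)" "y(i := b) \<in> extensional (insert i I)"
        using xy by (auto simp: extensional_def)
      from insert.prems(4)[OF this] 
      show "ennreal_powr (f (x(i := a))) t * ennreal_powr (g (y(i := b))) (1 - t)
        \<le> h ((\<lambda>i\<in>I. t * x i + (1 - t) * y i)(i := t * a + (1 - t) * b))" unfolding restr .
    qed (use xy insert.prems(1-3) in simp_all)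
  qed (use insert.prems in auto)
  then show ?case
    using insert.hyps by (simp add: lborel_product.product_nn_integral_insert)
qed

section \<open>Lebesgue measure in orthonormal frames\<close>

text \<open>The construction of \<open>subspace_lborel\<close> with the basis as a parameter, so
  that a basis can be prescribed or enlarged by one vector.\<close>

definition frame_measure :: "'a::euclidean_space set \<Rightarrow> 'a measure" where
  "frame_measure B = distr (\<Pi>\<^sub>M b\<in>B. (lborel :: real measure)) borel (\<lambda>g. \<Sum>b\<in>B. g b *\<^sub>R b)"

definition orthonormal :: "'a::euclidean_space set \<Rightarrow> bool" where
  "orthonormal B \<longleftrightarrow> pairwise orthogonal B \<and> (\<forall>b\<in>B. norm b = 1)"

lemma sets_cball_borel [measurable]: "cball (x::'a::euclidean_space) r \<in> sets borel"
  by (intro borel_closed closed_cball)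

lemma subspace_lborel_eq: "subspace_lborel S = frame_measure (SOME B. orthonormal_basis_of S B)"
  by (simp add: subspace_lborel_def frame_measure_def Let_def)

lemma orthonormal_independent: "orthonormal B \<Longrightarrow> independent B"
  unfolding orthonormal_def by (intro pairwise_orthogonal_independent) auto

lemma orthonormal_finite: "orthonormal B \<Longrightarrow> finite B"
  using orthonormal_independent independent_imp_finite by blast

lemma measurable_frame [measurable]:
  "(\<lambda>g. \<Sum>b\<in>B. g b *\<^sub>R (b::'a::euclidean_space)) \<in> (\<Pi>\<^sub>M b\<in>B. (lborel :: real measure)) \<rightarrow>\<^sub>M borel"
  by measurable

lemma sets_frame_measure [measurable_cong, simp]: "sets (frame_measure B) = sets borel"
  by (simp add: frame_measure_def)

lemma space_frame_measure [simp]: "space (frame_measure B) = UNIV"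
  by (simp add: frame_measure_def)

lemma nn_integral_frame_measure:
  assumes [measurable]: "f \<in> borel_measurable borel"
  shows "(\<integral>\<^sup>+x. f x \<partial>frame_measure B) = (\<integral>\<^sup>+g. f (\<Sum>b\<in>B. g b *\<^sub>R b) \<partial>(\<Pi>\<^sub>M b\<in>B. lborel))"
  unfolding frame_measure_def by (subst nn_integral_distr) auto

lemma nn_integral_frame_measure_cong:
  assumes [measurable]: "f \<in> borel_measurable borel" "h \<in> borel_measurable borel"
    and eq: "\<And>x. x \<in> span B \<Longrightarrow> f x = h x"
  shows "(\<integral>\<^sup>+x. f x \<partial>frame_measure B) = (\<integral>\<^sup>+x. h x \<partial>frame_measure B)"
  unfolding nn_integral_frame_measure[OF assms(1)] nn_integral_frame_measure[OF assms(2)]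
  by (intro nn_integral_cong eq span_sum span_scale span_base)

lemma nn_integral_frame_measure_mono:
  assumes [measurable]: "f \<in> borel_measurable borel" "h \<in> borel_measurable borel"
    and le: "\<And>x. x \<in> span B \<Longrightarrow> f x \<le> h x"
  shows "(\<integral>\<^sup>+x. f x \<partial>frame_measure B) \<le> (\<integral>\<^sup>+x. h x \<partial>frame_measure B)"
  unfolding nn_integral_frame_measure[OF assms(1)] nn_integral_frame_measure[OF assms(2)]
  by (intro nn_integral_mono le span_sum span_scale span_base)

lemma nn_integral_PiM_affine:
  fixes f :: "('i \<Rightarrow> real) \<Rightarrow> ennreal"
  assumes "finite I" "f \<in> borel_measurable (\<Pi>\<^sub>M i\<in>I. lborel)" and c: "c \<noteq> 0"
  shows "(\<integral>\<^sup>+x. f x \<partial>(\<Pi>\<^sub>M i\<in>I. lborel))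
    = ennreal (\<bar>c\<bar> ^ card I) * (\<integral>\<^sup>+x. f (\<lambda>i\<in>I. s i + c * x i) \<partial>(\<Pi>\<^sub>M i\<in>I. lborel))"
  using assms(1,2)
proof (induction I arbitrary: f)
  case empty
  then show ?case by (simp add: PiM_empty nn_integral_count_space_finite restrict_def)
next
  case (insert i I)
  note [measurable] = insert.prems
  have restr: "(\<lambda>j\<in>insert i I. s j + c * (x(i := a)) j) = (\<lambda>j\<in>I. s j + c * x j)(i := s i + c * a)" for x a
    using insert.hyps by (auto simp: restrict_def fun_eq_iff)
  have "(\<integral>\<^sup>+x. f x \<partial>(\<Pi>\<^sub>M i\<in>insert i I. lborel)) = (\<integral>\<^sup>+x. \<integral>\<^sup>+a. f (x(i := a)) \<partial>lborel \<partial>(\<Pi>\<^sub>M i\<in>I. lborel))"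
    using insert.hyps by (simp add: lborel_product.product_nn_integral_insert)
  also have "\<dots> = ennreal (\<bar>c\<bar> ^ card I) *
     (\<integral>\<^sup>+x. \<integral>\<^sup>+a. f ((\<lambda>i\<in>I. s i + c * x i)(i := a)) \<partial>lborel \<partial>(\<Pi>\<^sub>M i\<in>I. lborel))"
    by (subst insert.IH) (simp_all)
  also have "\<dots> = ennreal (\<bar>c\<bar> ^ card I) *
     (\<integral>\<^sup>+x. ennreal \<bar>c\<bar> * (\<integral>\<^sup>+a. f ((\<lambda>i\<in>I. s i + c * x i)(i := s i + c * a)) \<partial>lborel) \<partial>(\<Pi>\<^sub>M i\<in>I. lborel))"
    by (subst nn_integral_real_affine[OF measurable_PiM_slice[OF insert.prems restrict_extensional] c, of _ "s i"]) simp
  also have "\<dots> = ennreal (\<bar>c\<bar> ^ card (insert i I)) *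
     (\<integral>\<^sup>+x. \<integral>\<^sup>+a. f (\<lambda>j\<in>insert i I. s j + c * (x(i := a)) j) \<partial>lborel \<partial>(\<Pi>\<^sub>M i\<in>I. lborel))"
  proof -
    have "(\<lambda>x. \<integral>\<^sup>+a. f (\<lambda>j\<in>insert i I. s j + c * (x(i := a)) j) \<partial>lborel) \<in> borel_measurable (\<Pi>\<^sub>M i\<in>I. lborel)"
      by measurable
    then show ?thesis
      unfolding restr using insert.hyps
      by (subst nn_integral_cmult) (auto simp: ennreal_mult mult_ac)
  qed
  also have "\<dots> = ennreal (\<bar>c\<bar> ^ card (insert i I)) *
     (\<integral>\<^sup>+x. f (\<lambda>j\<in>insert i I. s j + c * x j) \<partial>(\<Pi>\<^sub>M i\<in>insert i I. lborel))"
    using insert.hyps by (subst lborel_product.product_nn_integral_insert) simp_all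
  finally show ?case .
qed

lemma nn_integral_frame_measure_affine:
  assumes [measurable]: "f \<in> borel_measurable borel" and B: "finite B" and s: "s \<in> span B" and c: "c \<noteq> 0"
  shows "(\<integral>\<^sup>+x. f x \<partial>frame_measure B) = ennreal (\<bar>c\<bar> ^ card B) * (\<integral>\<^sup>+x. f (s + c *\<^sub>R x) \<partial>frame_measure B)"
proof -
  obtain v where v: "s = (\<Sum>b\<in>B. v b *\<^sub>R b)" using s by (auto simp: span_finite[OF B])
  have e: "(\<Sum>b\<in>B. (\<lambda>i\<in>B. v i + c * g i) b *\<^sub>R b) = s + c *\<^sub>R (\<Sum>b\<in>B. g b *\<^sub>R b)" for g
    by (simp add: v scaleR_add_left sum.distrib scaleR_sum_right)
  have 1: "(\<lambda>g. f (\<Sum>b\<in>B. g b *\<^sub>R b)) \<in> borel_measurable (\<Pi>\<^sub>M b\<in>B. lborel)" by measurable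
  have 2: "(\<lambda>x. f (s + c *\<^sub>R x)) \<in> borel_measurable borel" by measurable
  show ?thesis
    unfolding nn_integral_frame_measure[OF assms(1)] nn_integral_frame_measure[OF 2]
    by (subst nn_integral_PiM_affine[OF B 1 c, of v]) (simp only: e)
qed

section \<open>Independence of the orthonormal basis\<close>

text \<open>Peels one coordinate off each index set and absorbs its square into \<open>k\<close>,
  which is why the induction leaves \<open>k\<close> arbitrary. It shows that balls have the same
  mass in all orthonormal frames of equal size, which fixes the normalisation of the invariant
  measure.\<close>

lemma nn_integral_PiM_sum_squares_cong:
  fixes I :: "'i set" and J :: "'j set" and k :: "real \<Rightarrow> ennreal"
  assumes "finite I" "finite J" "card I = card J" "k \<in> borel_measurable borel"
  shows "(\<integral>\<^sup>+g. k (\<Sum>i\<in>I. (g i)\<^sup>2) \<partial>(\<Pi>\<^sub>M i\<in>I. lborel)) = (\<integral>\<^sup>+g. k (\<Sum>i\<in>J. (g i)\<^sup>2) \<partial>(\<Pi>\<^sub>M i\<in>J. lborel))"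
  using assms
proof (induction I arbitrary: J k)
  case empty
  then show ?case by (simp add: PiM_empty nn_integral_count_space_finite)
next
  case (insert i I)
  note [measurable] = insert.prems(3)
  from insert.prems(1,2) insert.hyps obtain j J' where J: "J = insert j J'" "j \<notin> J'"
    by (metis card.empty card_insert_disjoint equals0I insert_absorb mk_disjoint_insert nat.distinct(1))
  with insert.prems insert.hyps have J': "finite J'" "card I = card J'" by auto
  have s1: "(\<Sum>l\<in>insert i I. ((x(i := a)) l)\<^sup>2) = a\<^sup>2 + (\<Sum>l\<in>I. (x l)\<^sup>2)" for x :: "'i \<Rightarrow> real" and a
    using insert.hyps by (auto intro!: sum.cong)
  have s2: "(\<Sum>l\<in>insert j J'. ((x(j := a)) l)\<^sup>2) = a\<^sup>2 + (\<Sum>l\<in>J'. (x l)\<^sup>2)" for x :: "'j \<Rightarrow> real" and a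
    using J J' by (auto intro!: sum.cong)
  have "(\<integral>\<^sup>+g. k (\<Sum>i\<in>insert i I. (g i)\<^sup>2) \<partial>(\<Pi>\<^sub>M i\<in>insert i I. lborel))
    = (\<integral>\<^sup>+a. \<integral>\<^sup>+x. k (a\<^sup>2 + (\<Sum>i\<in>I. (x i)\<^sup>2)) \<partial>(\<Pi>\<^sub>M i\<in>I. lborel) \<partial>lborel)"
    using insert.hyps by (subst lborel_product.product_nn_integral_insert_rev) (simp_all only: s1, measurable)
  also have "\<dots> = (\<integral>\<^sup>+a. \<integral>\<^sup>+x. k (a\<^sup>2 + (\<Sum>i\<in>J'. (x i)\<^sup>2)) \<partial>(\<Pi>\<^sub>M i\<in>J'. lborel) \<partial>lborel)"
    using J' insert.IH[of J' "\<lambda>s. k (a\<^sup>2 + s)" for a] by simp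
  also have "\<dots> = (\<integral>\<^sup>+g. k (\<Sum>i\<in>J. (g i)\<^sup>2) \<partial>(\<Pi>\<^sub>M i\<in>J. lborel))"
    unfolding J(1) using J J' by (subst lborel_product.product_nn_integral_insert_rev) (simp_all only: s2, measurable)
  finally show ?case .
qed

lemma norm_orthonormal_sum:
  assumes "orthonormal B"
  shows "(norm (\<Sum>b\<in>B. g b *\<^sub>R b))\<^sup>2 = (\<Sum>b\<in>B. (g b)\<^sup>2)"
proof -
  have "(norm (\<Sum>b\<in>B. g b *\<^sub>R b))\<^sup>2 = (\<Sum>b\<in>B. (norm (g b *\<^sub>R b))\<^sup>2)"
    using assms by (intro norm_sum_Pythagorean orthonormal_finite)
      (auto simp: orthonormal_def pairwise_def orthogonal_clauses)
  also have "\<dots> = (\<Sum>b\<in>B. (g b)\<^sup>2)"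
    using assms by (intro sum.cong) (auto simp: orthonormal_def)
  finally show ?thesis .
qed

lemma emeasure_frame_measure_cball_le:
  fixes B :: "'a::euclidean_space set"
  assumes B: "orthonormal B" and r: "0 \<le> r"
  shows "emeasure (frame_measure B) (cball 0 r) \<le> ennreal ((2 * r) ^ card B)"
proof -
  have "emeasure (frame_measure B) (cball 0 r)
      = emeasure (\<Pi>\<^sub>M b\<in>B. lborel) {g\<in>space (\<Pi>\<^sub>M b\<in>B. lborel). (\<Sum>b\<in>B. g b *\<^sub>R b) \<in> cball 0 r}"
    unfolding frame_measure_def by (subst emeasure_distr) (auto simp: vimage_def Int_def conj_commute)
  also have "\<dots> \<le> emeasure (\<Pi>\<^sub>M b\<in>B. lborel) (\<Pi>\<^sub>E b\<in>B. {-r..r})"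
  proof (rule emeasure_mono)
    show "{g\<in>space (\<Pi>\<^sub>M b\<in>B. lborel). (\<Sum>b\<in>B. g b *\<^sub>R b) \<in> cball 0 r} \<subseteq> (\<Pi>\<^sub>E b\<in>B. {-r..r})"
    proof
      fix g :: "'a \<Rightarrow> real" assume "g \<in> {g\<in>space (\<Pi>\<^sub>M b\<in>B. lborel). (\<Sum>b\<in>B. g b *\<^sub>R b) \<in> cball 0 r}"
      then have g: "g \<in> space (\<Pi>\<^sub>M b\<in>B. lborel)" "(\<Sum>b\<in>B. g b *\<^sub>R b) \<in> cball 0 r" by auto
      have "\<bar>g b\<bar> \<le> r" if b: "b \<in> B" for b
      proof -
        have "(g b)\<^sup>2 \<le> (\<Sum>b\<in>B. (g b)\<^sup>2)" using orthonormal_finite[OF B] b by (intro member_le_sum) auto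
        also have "\<dots> \<le> r\<^sup>2" using g(2)
          unfolding norm_orthonormal_sum[OF B, symmetric] by (intro power_mono) auto
        finally show ?thesis using r by (simp add: abs_le_square_iff[symmetric] flip: abs_of_nonneg)
      qed
      then have "\<forall>b\<in>B. - r \<le> g b \<and> g b \<le> r" by (meson abs_le_D1 abs_le_D2 minus_le_iff)
      then show "g \<in> (\<Pi>\<^sub>E b\<in>B. {-r..r})" using g(1) by (auto simp: space_PiM PiE_iff)
    qed
  qed (use orthonormal_finite[OF B] in auto)
  also have "\<dots> = ennreal ((2 * r) ^ card B)"
    using r orthonormal_finite[OF B] by (subst lborel_product.emeasure_PiM) (auto simp: ennreal_power)
  finally show ?thesis .
qed

text \<open>The cube of half side \<open>r / m\<close> fits into the ball since
  \<open>card B * (r / m)^2 \<le> r^2\<close>. With the bound by the enclosing cube, the mass of a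
  ball is positive and finite without being computed.\<close>

lemma emeasure_frame_measure_cball_ge:
  fixes B :: "'a::euclidean_space set"
  assumes B: "orthonormal B" and r: "0 \<le> r" and n: "real (card B) \<le> m\<^sup>2" "0 < m"
  shows "ennreal ((2 * r / m) ^ card B) \<le> emeasure (frame_measure B) (cball 0 r)"
proof -
  have "ennreal ((2 * r / m) ^ card B) = emeasure (\<Pi>\<^sub>M b\<in>B. lborel) (\<Pi>\<^sub>E b\<in>B. {-r/m..r/m})"
    using r n orthonormal_finite[OF B] by (subst lborel_product.emeasure_PiM) (auto simp: ennreal_power)
  also have "\<dots> \<le> emeasure (\<Pi>\<^sub>M b\<in>B. lborel) {g\<in>space (\<Pi>\<^sub>M b\<in>B. lborel). (\<Sum>b\<in>B. g b *\<^sub>R b) \<in> cball 0 r}"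
  proof (rule emeasure_mono)
    show "(\<Pi>\<^sub>E b\<in>B. {-r/m..r/m}) \<subseteq> {g\<in>space (\<Pi>\<^sub>M b\<in>B. lborel). (\<Sum>b\<in>B. g b *\<^sub>R b) \<in> cball 0 r}"
    proof safe
      fix g assume g: "g \<in> (\<Pi>\<^sub>E b\<in>B. {-r/m..r/m})"
      then show "g \<in> space (\<Pi>\<^sub>M b\<in>B. lborel)" by (auto simp: space_PiM PiE_iff)
      have "(norm (\<Sum>b\<in>B. g b *\<^sub>R b))\<^sup>2 = (\<Sum>b\<in>B. (g b)\<^sup>2)" by (rule norm_orthonormal_sum[OF B])
      also have "\<dots> \<le> (\<Sum>b\<in>B. (r/m)\<^sup>2)"
      proof (rule sum_mono)
        fix b assume "b \<in> B"
        then have "- r / m \<le> g b \<and> g b \<le> r / m" using g by (auto simp: PiE_iff)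
        then have "\<bar>g b\<bar> \<le> r / m" by (auto simp: abs_le_iff)
        then show "(g b)\<^sup>2 \<le> (r/m)\<^sup>2" using r n by (simp add: abs_le_square_iff[symmetric])
      qed
      also have "\<dots> = real (card B) * r\<^sup>2 / m\<^sup>2" by (simp add: power_divide)
      also have "\<dots> \<le> m\<^sup>2 * r\<^sup>2 / m\<^sup>2" using n by (intro divide_right_mono mult_right_mono) auto
      also have "\<dots> = r\<^sup>2" using n by simp
      finally show "(\<Sum>b\<in>B. g b *\<^sub>R b) \<in> cball 0 r" using r by (simp add: power2_le_iff_abs_le)
    qed
  qed measurable
  also have "\<dots> = emeasure (frame_measure B) (cball 0 r)"
    unfolding frame_measure_def by (subst emeasure_distr) (auto simp: vimage_def Int_def conj_commute)
  finally show ?thesis .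
qed

lemma emeasure_frame_measure_cball_cong:
  fixes B B' :: "'a::euclidean_space set"
  assumes "orthonormal B" "orthonormal B'" "card B = card B'" "0 \<le> r"
  shows "emeasure (frame_measure B) (cball 0 r) = emeasure (frame_measure B') (cball 0 r)"
proof -
  have i: "emeasure (frame_measure B) (cball 0 r) = (\<integral>\<^sup>+g. indicator {..r\<^sup>2} (\<Sum>b\<in>B. (g b)\<^sup>2) \<partial>(\<Pi>\<^sub>M b\<in>B. lborel))"
    if B: "orthonormal B" for B :: "'a set"
  proof -
    have "emeasure (frame_measure B) (cball 0 r) = (\<integral>\<^sup>+x. indicator (cball 0 r) x \<partial>frame_measure B)"
      by simp
    also have "\<dots> = (\<integral>\<^sup>+g. indicator (cball 0 r) (\<Sum>b\<in>B. g b *\<^sub>R b) \<partial>(\<Pi>\<^sub>M b\<in>B. lborel))"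
      by (rule nn_integral_frame_measure) simp
    also have "\<dots> = (\<integral>\<^sup>+g. indicator {..r\<^sup>2} (\<Sum>b\<in>B. (g b)\<^sup>2) \<partial>(\<Pi>\<^sub>M b\<in>B. lborel))"
      using \<open>0 \<le> r\<close> by (auto intro!: nn_integral_cong simp: indicator_def power2_le_iff_abs_le 
        simp flip: norm_orthonormal_sum[OF B])
    finally show ?thesis .
  qed
  show ?thesis unfolding i[OF assms(1)] i[OF assms(2)]
    using assms by (intro nn_integral_PiM_sum_squares_cong orthonormal_finite) auto
qed

text \<open>Uniqueness of Haar measure: Fubini and the invariances turn both sides into
  \<open>\<integral>\<integral> indicator A x * indicator C (x + y)\<close>.\<close>

lemma frame_measure_exchange:
  assumes B: "finite B" "finite B'" "span B = span B'" and [measurable]: "A \<in> sets borel" "C \<in> sets borel"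
  shows "emeasure (frame_measure B) A * emeasure (frame_measure B') C
    = emeasure (frame_measure B) C * emeasure (frame_measure B') A"
proof -
  let ?P = "\<Pi>\<^sub>M b\<in>B. (lborel :: real measure)" and ?P' = "\<Pi>\<^sub>M b\<in>B'. (lborel :: real measure)"
  let ?s = "\<lambda>g. \<Sum>b\<in>B. g b *\<^sub>R b" and ?s' = "\<lambda>g. \<Sum>b\<in>B'. g b *\<^sub>R b"
  interpret P: sigma_finite_measure ?P by (rule lborel_product.sigma_finite[OF B(1)])
  interpret P': sigma_finite_measure ?P' by (rule lborel_product.sigma_finite[OF B(2)])
  interpret pair_sigma_finite ?P ?P' ..
  have sp: "?s g \<in> span B" "?s g \<in> span B'" "?s' g \<in> span B" "?s' g \<in> span B'" for g
  proof -
    have "?s g \<in> span B" "?s' g \<in> span B'" by (intro span_sum span_scale span_base; assumption)+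
    then show "?s g \<in> span B" "?s g \<in> span B'" "?s' g \<in> span B" "?s' g \<in> span B'" by (simp_all add: B(3))
  qed
  have em: "emeasure (frame_measure D) E = (\<integral>\<^sup>+x. indicator E x \<partial>frame_measure D)" if "E \<in> sets borel" for D and E :: "'a set"
    using that by simp
  have "emeasure (frame_measure B) A * emeasure (frame_measure B') C
     = (\<integral>\<^sup>+g. indicator A (?s g) * emeasure (frame_measure B') C \<partial>?P)"
    unfolding em[of A B, OF \<open>A \<in> _\<close>]
    by (subst nn_integral_frame_measure) (simp_all add: nn_integral_multc)
  also have "\<dots> = (\<integral>\<^sup>+g. (\<integral>\<^sup>+g'. indicator A (?s g) * indicator C (?s g + ?s' g') \<partial>?P') \<partial>?P)"
  proof (rule nn_integral_cong)
    fix g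
    have "emeasure (frame_measure B') C = (\<integral>\<^sup>+y. indicator C (?s g + 1 *\<^sub>R y) \<partial>frame_measure B')"
      unfolding em[OF \<open>C \<in> _\<close>] using sp by (subst nn_integral_frame_measure_affine[OF _ B(2), of _ "?s g" 1]) auto
    then show "indicator A (?s g) * emeasure (frame_measure B') C
      = (\<integral>\<^sup>+g'. indicator A (?s g) * indicator C (?s g + ?s' g') \<partial>?P')"
      by (simp add: nn_integral_frame_measure nn_integral_cmult)
  qed
  also have "\<dots> = (\<integral>\<^sup>+g'. (\<integral>\<^sup>+g. indicator A (?s g) * indicator C (?s g + ?s' g') \<partial>?P) \<partial>?P')"
    by (rule Fubini'[symmetric]) measurable
  also have "\<dots> = (\<integral>\<^sup>+g'. (\<integral>\<^sup>+g. indicator A (?s g - ?s' g') * indicator C (?s g) \<partial>?P) \<partial>?P')"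
  proof (rule nn_integral_cong)
    fix g'
    have "(\<integral>\<^sup>+x. indicator A x * indicator C (x + ?s' g') \<partial>frame_measure B)
       = (\<integral>\<^sup>+x. indicator A (- ?s' g' + 1 *\<^sub>R x) * indicator C ((- ?s' g' + 1 *\<^sub>R x) + ?s' g') \<partial>frame_measure B)"
      using sp by (subst nn_integral_frame_measure_affine[OF _ B(1), of _ "- ?s' g'" 1]) (auto intro: span_neg)
    then show "(\<integral>\<^sup>+g. indicator A (?s g) * indicator C (?s g + ?s' g') \<partial>?P)
      = (\<integral>\<^sup>+g. indicator A (?s g - ?s' g') * indicator C (?s g) \<partial>?P)"
      by (simp add: nn_integral_frame_measure)
  qed
  also have "\<dots> = (\<integral>\<^sup>+g. (\<integral>\<^sup>+g'. indicator A (?s g - ?s' g') * indicator C (?s g) \<partial>?P') \<partial>?P)"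
    by (rule Fubini') measurable
  also have "\<dots> = (\<integral>\<^sup>+g. emeasure (frame_measure B') A * indicator C (?s g) \<partial>?P)"
  proof (rule nn_integral_cong)
    fix g
    \<comment> \<open>The invariance used here is that under the reflection sending \<open>y\<close>
      to \<open>?s g - y\<close>, hence the factor \<open>-1\<close>.\<close>
    have "emeasure (frame_measure B') A = (\<integral>\<^sup>+y. indicator A (?s g + (- 1) *\<^sub>R y) \<partial>frame_measure B')"
      unfolding em[OF \<open>A \<in> _\<close>] using sp by (subst nn_integral_frame_measure_affine[OF _ B(2), of _ "?s g" "-1"]) auto
    then show "(\<integral>\<^sup>+g'. indicator A (?s g - ?s' g') * indicator C (?s g) \<partial>?P')
      = emeasure (frame_measure B') A * indicator C (?s g)"
      by (simp add: nn_integral_frame_measure nn_integral_multc)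
  qed
  also have "\<dots> = emeasure (frame_measure B') A * emeasure (frame_measure B) C"
    unfolding em[of C B, OF \<open>C \<in> _\<close>]
    by (subst nn_integral_frame_measure) (simp_all add: nn_integral_cmult)
  finally show ?thesis by (simp add: mult.commute)
qed

text \<open>Apply the exchange identity to a set and the unit ball, and cancel the mass of the ball:
  it is positive, finite and common to both frames.\<close>

lemma frame_measure_cong:
  assumes B: "orthonormal B" "orthonormal B'" "span B = span B'"
  shows "frame_measure B = frame_measure B'"
proof (rule measure_eqI)
  fix C assume "C \<in> sets (frame_measure B)"
  then have C: "C \<in> sets borel" by simp
  have fin: "finite B" "finite B'" using B orthonormal_finite by auto
  have card: "card B = card B'"
    using B orthonormal_independent by (metis dim_span_eq_card_independent)
  define v where "v = emeasure (frame_measure B) (cball 0 1)"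
  have v': "v = emeasure (frame_measure B') (cball 0 1)"
    unfolding v_def using B card by (intro emeasure_frame_measure_cball_cong) auto
  have "v \<le> ennreal ((2 * 1) ^ card B)" unfolding v_def by (intro emeasure_frame_measure_cball_le B) auto
  then have vt: "v \<noteq> \<infinity>" by (auto simp: top_unique)
  have "real (card B) \<le> (real (card B + 1))\<^sup>2" by (simp add: power2_eq_square algebra_simps)
  then have "ennreal ((2 * 1 / real (card B + 1)) ^ card B) \<le> v"
    unfolding v_def by (intro emeasure_frame_measure_cball_ge B) auto
  moreover have "0 < ennreal ((2 * 1 / real (card B + 1)) ^ card B)" by simp
  ultimately have v0: "v \<noteq> 0" by (metis leD)
  have "v * emeasure (frame_measure B') C = emeasure (frame_measure B) C * v"
    using frame_measure_exchange[OF fin B(3), of "cball 0 1" C] C v' by (simp add: v_def)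
  then show "emeasure (frame_measure B) C = emeasure (frame_measure B') C"
    using v0 vt by (simp add: mult.commute[of _ v] ennreal_mult_cancel_left)
qed simp

text \<open>Eliminates the choice operator in \<open>subspace_lborel\<close>: the chosen basis and
  \<open>B\<close> are orthonormal with the same span.\<close>

lemma subspace_lborel_eq_frame_measure:
  assumes "orthonormal B" "span B = S"
  shows "subspace_lborel S = frame_measure B"
proof -
  have "orthonormal_basis_of S B"
    using assms by (auto simp: orthonormal_basis_of_def orthonormal_def span_base)
  then have "orthonormal_basis_of S (SOME B. orthonormal_basis_of S B)" by (rule someI)
  then have "orthonormal (SOME B. orthonormal_basis_of S B)" "span (SOME B. orthonormal_basis_of S B) = S"
    unfolding orthonormal_basis_of_def[of S "Eps _"] orthonormal_def by simp_all
  with assms show ?thesis unfolding subspace_lborel_eq by (intro frame_measure_cong) simp_all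
qed

lemma nn_integral_frame_measure_insert:
  assumes [measurable]: "f \<in> borel_measurable borel" and B: "finite B" "w \<notin> B"
  shows "(\<integral>\<^sup>+x. f x \<partial>frame_measure (insert w B)) = (\<integral>\<^sup>+r. \<integral>\<^sup>+x. f (r *\<^sub>R w + x) \<partial>frame_measure B \<partial>lborel)"
proof -
  have s: "(\<Sum>b\<in>insert w B. (g(w := r)) b *\<^sub>R b) = r *\<^sub>R w + (\<Sum>b\<in>B. g b *\<^sub>R b)" for g r
    using B by (auto intro!: sum.cong)
  show ?thesis
    using B by (simp add: nn_integral_frame_measure lborel_product.product_nn_integral_insert_rev s 
        del: sum.insert fun_upd_apply)
qed

lemma prekopa_leindler_frame_measure:
  assumes [measurable]: "f \<in> borel_measurable borel" "g \<in> borel_measurable borel" "h \<in> borel_measurable borel"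
    and B: "finite B" and t: "0 < t" "t < 1"
    and le: "\<And>x y. x \<in> span B \<Longrightarrow> y \<in> span B \<Longrightarrow>
      ennreal_powr (f x) t * ennreal_powr (g y) (1 - t) \<le> h (t *\<^sub>R x + (1 - t) *\<^sub>R y)"
  shows "ennreal_powr (\<integral>\<^sup>+x. f x \<partial>frame_measure B) t * ennreal_powr (\<integral>\<^sup>+x. g x \<partial>frame_measure B) (1 - t)
    \<le> (\<integral>\<^sup>+x. h x \<partial>frame_measure B)"
  unfolding nn_integral_frame_measure[OF assms(1)] nn_integral_frame_measure[OF assms(2)]
    nn_integral_frame_measure[OF assms(3)]
proof (rule prekopa_leindler_PiM[OF B _ _ _ t])
  fix x y :: "'a \<Rightarrow> real"
  have "(\<Sum>b\<in>B. (\<lambda>i\<in>B. t * x i + (1 - t) * y i) b *\<^sub>R b)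
    = t *\<^sub>R (\<Sum>b\<in>B. x b *\<^sub>R b) + (1 - t) *\<^sub>R (\<Sum>b\<in>B. y b *\<^sub>R b)"
    by (simp add: scaleR_add_left sum.distrib scaleR_sum_right)
  then show "ennreal_powr (f (\<Sum>b\<in>B. x b *\<^sub>R b)) t * ennreal_powr (g (\<Sum>b\<in>B. y b *\<^sub>R b)) (1 - t)
    \<le> h (\<Sum>b\<in>B. (\<lambda>i\<in>B. t * x i + (1 - t) * y i) b *\<^sub>R b)"
    by (simp only:) (intro le span_sum span_scale span_base)
qed measurable

section \<open>Transport between rays\<close>

lemma nn_integral_compact_exhaust:
  fixes H :: "real \<Rightarrow> ennreal"
  assumes [measurable]: "H \<in> borel_measurable borel" and b: "0 < b"
    and less: "c < (\<integral>\<^sup>+x. H x * indicator {0<..<b} x \<partial>lborel)"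
  shows "\<exists>\<alpha> \<beta>. 0 < \<alpha> \<and> \<alpha> < \<beta> \<and> \<beta> < b \<and> c < (\<integral>\<^sup>+x. H x * indicator {\<alpha>..\<beta>} x \<partial>lborel)"
proof -
  \<comment> \<open>The shift by 3 keeps \<open>e n\<close> below \<open>b / 2\<close>, so that
    every interval \<open>{e n..b - e n}\<close> is nondegenerate.\<close>
  define e where "e n = b / real (n + 3)" for n :: nat
  have e: "0 < e n" "e n < b / 2" for n
  proof -
    show "0 < e n" using b by (simp add: e_def)
    show "e n < b / 2" unfolding e_def using b by (intro divide_strict_left_mono) auto
  qed
  have dec: "e n \<le> e m" if "m \<le> n" for m n
    using that b unfolding e_def by (intro divide_left_mono) auto
  have lim: "e \<longlonglongrightarrow> 0" 
    unfolding e_def using LIMSEQ_ignore_initial_segment[OF lim_const_over_n[of b], of 3] by simp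
  have sup: "(SUP n. indicator {e n..b - e n} x) = (indicator {0<..<b} x :: ennreal)" for x
  proof (cases "x \<in> {0<..<b}")
    case True
    then have "eventually (\<lambda>n. e n < x) sequentially" "eventually (\<lambda>n. e n < b - x) sequentially"
      using lim by (auto intro!: order_tendstoD(2)[OF lim])
    then have "eventually (\<lambda>n. e n < x \<and> e n < b - x) sequentially" by eventually_elim simp
    then obtain n where "e n < x" "e n < b - x" by (auto simp: eventually_sequentially)
    then have n: "indicator {e n..b - e n} x = (1::ennreal)" by auto
    show ?thesis
    proof (rule antisym)
      show "indicator {0<..<b} x \<le> (SUP n. indicator {e n..b - e n} x :: ennreal)"
        using True n by (intro SUP_upper2[of n]) auto
    qed (use True in \<open>auto intro!: SUP_least simp: indicator_def\<close>)
  next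
    case False
    have "x \<notin> {e n..b - e n}" for n using False e(1)[of n] by auto
    then show ?thesis using False by simp
  qed
  have "(\<integral>\<^sup>+x. H x * indicator {0<..<b} x \<partial>lborel) = (\<integral>\<^sup>+x. (SUP n. H x * indicator {e n..b - e n} x) \<partial>lborel)"
    by (simp add: SUP_mult_left_ennreal flip: sup)
  also have "\<dots> = (SUP n. \<integral>\<^sup>+x. H x * indicator {e n..b - e n} x \<partial>lborel)"
  proof (rule nn_integral_monotone_convergence_SUP)
    show "incseq (\<lambda>n x. H x * indicator {e n..b - e n} x)"
    proof (intro monoI le_funI mult_left_mono)
      fix m n :: nat and x assume "m \<le> n"
      from dec[OF this] show "indicator {e m..b - e m} x \<le> (indicator {e n..b - e n} x :: ennreal)"
        by (auto simp: indicator_def)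
    qed auto
  qed measurable
  finally obtain n where "c < (\<integral>\<^sup>+x. H x * indicator {e n..b - e n} x \<partial>lborel)"
    using less by (auto simp: less_SUP_iff)
  then show ?thesis using e[of n] by (intro exI[of _ "e n"] exI[of _ "b - e n"]) auto
qed

text \<open>Averaging \<open>D x = H x / x ^ d\<close>, which is antitone,
  over \<open>{x..l * x}\<close> gives a continuous minorant of \<open>H\<close>; the quantile function of the minorant
  is continuously differentiable.\<close>

lemma approximate_quantile:
  fixes H :: "real \<Rightarrow> real"
  assumes [measurable]: "H \<in> borel_measurable borel"
    and nonneg: "\<And>x. 0 < x \<Longrightarrow> 0 \<le> H x"
    and star: "\<And>x a. 0 < x \<Longrightarrow> 0 < a \<Longrightarrow> a \<le> 1 \<Longrightarrow> a ^ d * H x \<le> H (a * x)"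
    and supp: "\<And>x. R < x \<Longrightarrow> H x = 0"
    and \<phi>: "(\<integral>\<^sup>+x. ennreal (H x) * indicator {0<..} x \<partial>lborel) = ennreal \<phi>" "0 < \<phi>"
    and \<eta>: "0 < \<eta>" "\<eta> < 1"
  shows "\<exists>r r'. (\<forall>u\<in>{0<..<1}. 0 < r u \<and> (r has_real_derivative r' u) (at u) \<and> 0 < r' u \<and> \<eta> * \<phi> \<le> r' u * H (r u))
    \<and> continuous_on {0<..<1} r'"
proof -
  define D where "D x = H x / x ^ d" for x
  have D0: "0 \<le> D x" if "0 < x" for x using nonneg[OF that] that by (simp add: D_def)
  have HD: "H x = x ^ d * D x" if "0 < x" for x using that by (simp add: D_def)
  have Danti: "D y \<le> D x" if "0 < x" "x \<le> y" for x y
  proof -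
    have "(x / y) ^ d * H y \<le> H ((x / y) * y)" using that by (intro star) auto
    then show ?thesis using that by (simp add: D_def field_simps power_divide)
  qed
  \<comment> \<open>The right end of the support on the ray; since \<open>D\<close> is antitone,
    \<open>H\<close> is positive everywhere before it.\<close>
  define b where "b = Sup {x. 0 < x \<and> 0 < H x}"
  have bdd: "bdd_above {x. 0 < x \<and> 0 < H x}"
    by (rule bdd_aboveI[of _ R]) (metis less_irrefl mem_Collect_eq not_le supp)
  have ne: "{x. 0 < x \<and> 0 < H x} \<noteq> {}"
  proof
    assume "{x. 0 < x \<and> 0 < H x} = {}"
    then have "ennreal (H x) * indicator {0<..} x = 0" for x
      by (auto simp: indicator_def ennreal_eq_0_iff not_less)
    then have "ennreal \<phi> = 0" unfolding \<phi>(1)[symmetric] by (simp only: nn_integral_const mult_zero_left)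
    with \<phi>(2) show False by (simp add: ennreal_eq_0_iff)
  qed
  have Hpos: "0 < H x" if x: "0 < x" "x < b" for x
  proof -
    obtain y where y: "0 < y" "0 < H y" "x < y" using less_cSup_iff[OF ne bdd, of x] x by (auto simp: b_def)
    then have "0 < D y" by (simp add: D_def)
    also have "D y \<le> D x" using x y by (intro Danti) auto
    finally show ?thesis using x by (simp add: HD)
  qed
  have Hzero: "H x = 0" if x: "b < x" "0 < x" for x
  proof (rule ccontr)
    assume "H x \<noteq> 0"
    then have "x \<in> {x. 0 < x \<and> 0 < H x}" using nonneg[of x] x by auto
    from cSup_upper[OF this bdd] show False using x by (simp add: b_def)
  qed
  have b0: "0 < b" using ne cSup_upper[OF _ bdd] by (force simp: b_def)
  have "(\<integral>\<^sup>+x. ennreal (H x) * indicator {0<..<b} x \<partial>lborel) = (\<integral>\<^sup>+x. ennreal (H x) * indicator {0<..} x \<partial>lborel)"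
  proof (rule nn_integral_cong_AE)
    have "AE x in lborel. x \<noteq> b" by (rule AE_lborel_singleton)
    then show "AE x in lborel. ennreal (H x) * indicator {0<..<b} x = ennreal (H x) * indicator {0<..} x"
      by eventually_elim (auto simp: indicator_def Hzero)
  qed
  then have \<phi>b: "(\<integral>\<^sup>+x. ennreal (H x) * indicator {0<..<b} x \<partial>lborel) = ennreal \<phi>" by (simp add: \<phi>)
  \<comment> \<open>The permitted loss \<open>\<eta>\<close> is shared: a factor
    \<open>\<eta>'\<close> pays for the restriction to \<open>{\<alpha>..\<beta>}\<close>, the
    remaining \<open>\<eta> / \<eta>'\<close> for the averaging.\<close>
  define \<eta>' where "\<eta>' = (1 + \<eta>) / 2"
  have \<eta>': "\<eta> < \<eta>'" "\<eta>' < 1" "0 < \<eta>'" using \<eta> by (auto simp: \<eta>'_def)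
  obtain \<alpha> \<beta> where ab: "0 < \<alpha>" "\<alpha> < \<beta>" "\<beta> < b"
    and int_ab: "ennreal (\<eta>' * \<phi>) < (\<integral>\<^sup>+x. ennreal (H x) * indicator {\<alpha>..\<beta>} x \<partial>lborel)"
  proof -
    have "ennreal (\<eta>' * \<phi>) < ennreal \<phi>" using \<eta>' \<phi> by (simp add: ennreal_less_iff)
    then have "ennreal (\<eta>' * \<phi>) < (\<integral>\<^sup>+x. ennreal (H x) * indicator {0<..<b} x \<partial>lborel)" by (simp add: \<phi>b)
    from nn_integral_compact_exhaust[OF _ b0 this] that show ?thesis by auto
  qed
  \<comment> \<open>Averaging over a ratio \<open>l\<close> costs \<open>d\<close> powers of
    \<open>l\<close> through the growth condition and one more through the substitution by
    \<open>l * x\<close>; \<open>l\<close> is chosen to use up exactly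
    \<open>\<eta> / \<eta>'\<close>.\<close>
  define l where "l = root (d + 1) (\<eta>' / \<eta>)"
  have l: "1 < l" "l ^ (d + 1) = \<eta>' / \<eta>" 
    using \<eta> \<eta>' real_root_pow_pos2[of "d + 1" "\<eta>' / \<eta>"] by (auto simp: l_def)
  \<comment> \<open>Dilation by \<open>l\<close> carries \<open>{\<delta>..\<rho>}\<close> onto
    \<open>{\<alpha>..\<beta>}\<close>, so \<open>l * x\<close> stays below \<open>b\<close> and the
    lower bound by \<open>H (l * x)\<close> integrates to the mass on
    \<open>{\<alpha>..\<beta>}\<close>.\<close>
  define \<delta> where "\<delta> = \<alpha> / l"
  define \<rho> where "\<rho> = \<beta> / l"
  have \<delta>\<rho>: "0 < \<delta>" "\<delta> < \<rho>" "l * \<delta> = \<alpha>" "l * \<rho> = \<beta>" "\<rho> < \<beta>"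
    using ab l(1) by (auto simp: \<delta>_def \<rho>_def divide_strict_right_mono pos_divide_less_eq)
  then have "\<delta> < \<beta>" by linarith
  note \<delta>\<rho> = \<delta>\<rho> this
  define E where "E x = integral {\<delta>..x} D" for x
  have Dint: "D integrable_on {x..y}" if "0 < x" for x y
  proof -
    have "mono_on {x..y} (\<lambda>x. - D x)" using that by (auto intro!: mono_onI Danti)
    then have "(\<lambda>x. - D x) integrable_on {x..y}" by (rule integrable_on_mono_on)
    then show ?thesis using integrable_neg[of "\<lambda>x. - D x"] by simp
  qed
  have Econt: "continuous_on {\<delta>..\<beta>} E"
    unfolding E_def by (rule indefinite_integral_continuous_1[OF Dint[OF \<delta>\<rho>(1)]])
  define G where "G x = x ^ d * (E (l * x) - E x) / (x * (l - 1))" for x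
  \<comment> \<open>The average of the antitone \<open>D\<close> over \<open>{x..l * x}\<close> lies
    between its end values \<open>D (l * x)\<close> and \<open>D x\<close>.\<close>
  have Gbounds: "G x \<le> H x" "(1 / l) ^ d * H (l * x) \<le> G x" if x: "x \<in> {\<delta>..\<rho>}" for x
  proof -
    have x0: "0 < x" "x \<le> l * x" using x \<delta>\<rho>(1) l by auto
    have "E x + integral {x..l*x} D = E (l * x)"
      unfolding E_def using x x0 by (intro Henstock_Kurzweil_Integration.integral_combine Dint \<delta>\<rho>(1)) auto
    then have G: "G x = x ^ d * (integral {x..l*x} D / (x * (l - 1)))" by (simp add: G_def)
    have "integral {x..l*x} D \<le> integral {x..l*x} (\<lambda>_. D x)"
      using x0 by (intro integral_le Dint) (auto intro: Danti)
    then have u: "integral {x..l*x} D \<le> x * (l - 1) * D x" using x0 by (simp add: algebra_simps)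
    have "integral {x..l*x} (\<lambda>_. D (l * x)) \<le> integral {x..l*x} D"
      using x0 by (intro integral_le Dint) (auto intro: Danti)
    then have w: "x * (l - 1) * D (l * x) \<le> integral {x..l*x} D" using x0 by (simp add: algebra_simps)
    have xl: "0 < x * (l - 1)" using x0 l by simp
    have "integral {x..l*x} D / (x * (l - 1)) \<le> D x"
      using u xl by (simp add: pos_divide_le_eq mult.commute)
    then show "G x \<le> H x" unfolding G HD[OF x0(1)] using x0 by (intro mult_left_mono) auto
    have "D (l * x) \<le> integral {x..l*x} D / (x * (l - 1))"
      using w xl by (simp add: pos_le_divide_eq mult.commute)
    then have "x ^ d * D (l * x) \<le> G x" unfolding G using x0 by (intro mult_left_mono) auto
    moreover have "(1 / l) ^ d * H (l * x) = x ^ d * D (l * x)"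
      using x0 l by (simp add: D_def power_mult_distrib field_simps power_divide)
    ultimately show "(1 / l) ^ d * H (l * x) \<le> G x" by simp
  qed
  have Gpos: "0 < G x" if x: "x \<in> {\<delta>..\<rho>}" for x
  proof -
    have "0 < l * x" using x \<delta>\<rho>(1) l by auto
    moreover have "l * x \<le> \<beta>" using x l unfolding \<delta>\<rho>(4)[symmetric] by auto
    ultimately have "0 < H (l * x)" using ab by (intro Hpos) auto
    then have "0 < (1 / l) ^ d * H (l * x)" using l by simp
    with Gbounds(2)[OF x] show ?thesis by simp
  qed
  have Gcont: "continuous_on {\<delta>..\<rho>} G"
  proof -
    have "continuous_on {\<delta>..\<rho>} (\<lambda>x. E (l * x))"
    proof (rule continuous_on_compose2[OF Econt])
      show "(\<lambda>x. l * x) ` {\<delta>..\<rho>} \<subseteq> {\<delta>..\<beta>}"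
      proof safe
        fix x assume x: "x \<in> {\<delta>..\<rho>}"
        have "1 * \<delta> \<le> l * x" using x \<delta>\<rho> l by (intro mult_mono) auto
        moreover have "l * x \<le> \<beta>" using x l unfolding \<delta>\<rho>(4)[symmetric] by auto
        ultimately show "l * x \<in> {\<delta>..\<beta>}" by auto
      qed
    qed (intro continuous_intros)
    moreover have "continuous_on {\<delta>..\<rho>} E" using \<delta>\<rho> by (intro continuous_on_subset[OF Econt]) auto
    ultimately show ?thesis unfolding G_def using \<delta>\<rho>(1) l by (intro continuous_intros) auto
  qed
  define F where "F x = integral {\<delta>..x} G" for x
  define m where "m = F \<rho>"
  have m\<eta>: "\<eta> * \<phi> \<le> m"
  proof -
    have Gi: "set_integrable lborel {\<delta>..\<rho>} G" by (rule borel_integrable_atLeastAtMost'[OF Gcont])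
    have "ennreal (\<eta> * \<phi>) = ennreal ((1 / l) ^ (d + 1)) * ennreal (\<eta>' * \<phi>)"
      using l \<eta> \<eta>' \<phi>(2) by (simp add: power_divide flip: ennreal_mult)
    also have "\<dots> \<le> ennreal ((1 / l) ^ (d + 1)) * (\<integral>\<^sup>+x. ennreal (H x) * indicator {\<alpha>..\<beta>} x \<partial>lborel)"
      using int_ab by (intro mult_left_mono) auto
    also have "(\<integral>\<^sup>+x. ennreal (H x) * indicator {\<alpha>..\<beta>} x \<partial>lborel)
      = ennreal \<bar>l\<bar> * (\<integral>\<^sup>+x. ennreal (H (0 + l * x)) * indicator {\<alpha>..\<beta>} (0 + l * x) \<partial>lborel)"
      using l by (intro nn_integral_real_affine) auto
    also have "(\<lambda>x. ennreal (H (0 + l * x)) * indicator {\<alpha>..\<beta>} (0 + l * x)) = (\<lambda>x. ennreal (H (l * x)) * indicator {\<delta>..\<rho>} x)"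
      using l by (auto simp: fun_eq_iff indicator_def \<delta>_def \<rho>_def field_simps)
    also have "ennreal ((1 / l) ^ (d + 1)) * (ennreal \<bar>l\<bar> * (\<integral>\<^sup>+x. ennreal (H (l * x)) * indicator {\<delta>..\<rho>} x \<partial>lborel))
      = ennreal ((1 / l) ^ d) * (\<integral>\<^sup>+x. ennreal (H (l * x)) * indicator {\<delta>..\<rho>} x \<partial>lborel)"
      using l by (simp flip: mult.assoc ennreal_mult)
    also have "\<dots> = (\<integral>\<^sup>+x. ennreal ((1 / l) ^ d) * (ennreal (H (l * x)) * indicator {\<delta>..\<rho>} x) \<partial>lborel)"
      by (subst nn_integral_cmult) auto
    also have "\<dots> \<le> (\<integral>\<^sup>+x. ennreal (indicator {\<delta>..\<rho>} x *\<^sub>R G x) \<partial>lborel)"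
    proof (rule nn_integral_mono)
      fix x
      show "ennreal ((1 / l) ^ d) * (ennreal (H (l * x)) * indicator {\<delta>..\<rho>} x) \<le> ennreal (indicator {\<delta>..\<rho>} x *\<^sub>R G x)"
      proof (cases "x \<in> {\<delta>..\<rho>}")
        case True
        then have "0 < l * x" using \<delta>\<rho> l by auto
        then show ?thesis using True Gbounds(2)[OF True] nonneg[of "l * x"] l
          by (simp add: ennreal_leI flip: ennreal_mult)
      qed simp
    qed
    also have "\<dots> = ennreal (LINT x : {\<delta>..\<rho>} | lborel. G x)"
      unfolding set_lebesgue_integral_def using Gi Gpos
      by (intro nn_integral_eq_integral) (auto simp: set_integrable_def indicator_def intro!: AE_I2 less_imp_le)
    also have "(LINT x : {\<delta>..\<rho>} | lborel. G x) = m"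
      unfolding m_def F_def by (rule set_borel_integral_eq_integral(2)[OF Gi])
    finally have "ennreal (\<eta> * \<phi>) \<le> ennreal m" .
    moreover have "0 < \<eta> * \<phi>" using \<eta> \<phi> by simp
    ultimately show ?thesis by (auto simp: ennreal_le_iff2)
  qed
  have m0: "0 < m" using m\<eta> \<eta> \<phi> by (meson less_le_trans mult_pos_pos)
  have Fder: "(F has_real_derivative G x) (at x within {\<delta>..\<rho>})" if "x \<in> {\<delta>..\<rho>}" for x
    unfolding F_def by (rule integral_has_real_derivative[OF Gcont that])
  have Fder': "(F has_real_derivative G x) (at x)" if "x \<in> {\<delta><..<\<rho>}" for x
    using Fder[of x] that at_within_Icc_at[of \<delta> x \<rho>] by auto
  have Fcont: "continuous_on {\<delta>..\<rho>} F"
    using Fder by (intro DERIV_continuous_on)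
  have Fmono: "F x < F y" if "x \<in> {\<delta>..\<rho>}" "y \<in> {\<delta>..\<rho>}" "x < y" for x y
  proof (rule DERIV_pos_imp_increasing_open[OF \<open>x < y\<close>])
    show "continuous_on {x..y} F" using that by (intro continuous_on_subset[OF Fcont]) auto
    show "\<exists>z. (F has_real_derivative z) (at w) \<and> 0 < z" if "x < w" "w < y" for w
      using Fder'[of w] Gpos[of w] that \<open>x \<in> _\<close> \<open>y \<in> _\<close> by (intro exI[of _ "G w"]) auto
  qed
  have F\<delta>: "F \<delta> = 0" by (simp add: F_def)
  have inj: "inj_on F {\<delta>..\<rho>}"
    using Fmono by (intro linorder_inj_onI') (metis less_irrefl)
  have img: "F ` {\<delta>..\<rho>} = {0..m}"
  proof (intro equalityI subsetI)
    fix y assume "y \<in> {0..m}"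
    then obtain x where "\<delta> \<le> x" "x \<le> \<rho>" "F x = y"
      using IVT'[of F \<delta> y \<rho>] F\<delta> Fcont \<delta>\<rho> by (auto simp: m_def)
    then show "y \<in> F ` {\<delta>..\<rho>}" by auto
  next
    fix y assume "y \<in> F ` {\<delta>..\<rho>}"
    then obtain x where x: "x \<in> {\<delta>..\<rho>}" "y = F x" by auto
    then show "y \<in> {0..m}"
      using Fmono[of \<delta> x] Fmono[of x \<rho>] F\<delta> \<delta>\<rho> unfolding m_def by (cases "x = \<delta>"; cases "x = \<rho>") auto
  qed
  define K where "K = the_inv_into {\<delta>..\<rho>} F"
  have Kcont: "continuous_on {0..m} K"
    using continuous_on_inv[OF Fcont compact_Icc, of K] the_inv_into_f_f[OF inj] img by (simp add: K_def)
  have FK: "F (K y) = y" "K y \<in> {\<delta>..\<rho>}" if "y \<in> {0..m}" for y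
    using that img f_the_inv_into_f[OF inj, of y] the_inv_into_into[OF inj, of y "{\<delta>..\<rho>}"] by (auto simp: K_def)
  have KI: "K y \<in> {\<delta><..<\<rho>}" if "y \<in> {0<..<m}" for y
  proof -
    have "K y \<in> {\<delta>..\<rho>}" "F (K y) = y" using FK[of y] that by auto
    moreover have "K y \<noteq> \<delta>" "K y \<noteq> \<rho>" using calculation that F\<delta> by (auto simp: m_def)
    ultimately show ?thesis by auto
  qed
  have Kder: "(K has_real_derivative inverse (G (K y))) (at y)" if y: "y \<in> {0<..<m}" for y
  proof (rule DERIV_inverse_function)
    show "(F has_real_derivative G (K y)) (at (K y))" by (rule Fder'[OF KI[OF y]])
    show "G (K y) \<noteq> 0" using Gpos[of "K y"] KI[OF y] by auto
    show "isCont K y" using continuous_on_interior[OF Kcont, of y] y by simp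
    show "F (K z) = z" if "0 < z" "z < m" for z using FK[of z] that by auto
  qed (use y in auto)
  \<comment> \<open>With \<open>m\<close> the total mass of \<open>G\<close>, this is the quantile
    of \<open>G\<close> at level \<open>u\<close>; by construction
    \<open>r' u * G (r u) = m\<close>, and \<open>G \<le> H\<close> only helps.\<close>
  define r where "r u = K (m * u)" for u
  define r' where "r' u = m / G (r u)" for u
  have um: "m * u \<in> {0<..<m}" if "u \<in> {0<..<1}" for u using that m0 by auto
  have rI: "r u \<in> {\<delta><..<\<rho>}" if "u \<in> {0<..<1}" for u unfolding r_def by (rule KI[OF um[OF that]])
  have "continuous_on {0<..<1} r"
  proof -
    have "continuous_on {0<..<1} (\<lambda>u. K (m * u))"
      using um m0 by (intro continuous_on_compose2[OF Kcont] continuous_intros) force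
    then show ?thesis by (simp add: r_def[abs_def])
  qed
  then have rc: "continuous_on {0<..<1} (\<lambda>u. G (r u))"
    using rI by (intro continuous_on_compose2[OF Gcont]) force+
  have Gr: "0 < G (r u)" "G (r u) \<le> H (r u)" if "u \<in> {0<..<1}" for u
    using Gpos[of "r u"] Gbounds(1)[of "r u"] rI[OF that] by auto
  show ?thesis
  proof (intro exI conjI ballI)
    fix u :: real assume u: "u \<in> {0<..<1}"
    show "0 < r u" using rI[OF u] \<delta>\<rho> by auto
    show "0 < r' u" using Gr[OF u] m0 by (simp add: r'_def)
    have "(r has_real_derivative inverse (G (K (m * u))) * m) (at u)"
      unfolding r_def
    proof (rule DERIV_chain2[where f = K and g = "\<lambda>u. m * u"])
      show "(K has_real_derivative inverse (G (K (m * u)))) (at (m * u))" by (rule Kder[OF um[OF u]])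
    qed (auto intro!: derivative_eq_intros)
    then show "(r has_real_derivative r' u) (at u)" by (simp add: r'_def r_def field_simps)
    have "\<eta> * \<phi> \<le> m" by (rule m\<eta>)
    also have "m = r' u * G (r u)" using Gr[OF u] by (simp add: r'_def)
    also have "\<dots> \<le> r' u * H (r u)" using Gr[OF u] m0 by (intro mult_left_mono) (auto simp: r'_def)
    finally show "\<eta> * \<phi> \<le> r' u * H (r u)" .
  next
    show "continuous_on {0<..<1} r'"
      unfolding r'_def using rc Gr by (intro continuous_intros) (auto simp: less_imp_neq[symmetric] dest: Gr(1))
  qed
qed

text \<open>The weight \<open>t\<close> varies along the quantile parameter, so a bound free of
  \<open>t\<close> is needed. Weighted AM-GM is applied to \<open>a powr - q / t\<close> and
  \<open>b powr - q / (1 - t)\<close>, whose weighted arithmetic mean no longer contains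
  \<open>t\<close>, and the result is raised to the power \<open>- 1 / q\<close>.\<close>

lemma weighted_gm_ge_power_mean:
  fixes a b q t :: real
  assumes "0 < a" "0 < b" "0 < q" "0 < t" "t < 1"
  shows "(a powr - q + b powr - q) powr (- 1 / q) \<le> (t powr (1 / q) * a) powr t * ((1 - t) powr (1 / q) * b) powr (1 - t)"
proof -
  have root: "(e powr - q / u) powr (- 1 / q) = u powr (1 / q) * e" if "0 < u" "0 < e" for u e :: real
  proof -
    have "(e powr - q) powr (- 1 / q) = e" using that assms by (simp add: powr_powr)
    moreover have "u powr (- 1 / q) = 1 / u powr (1 / q)" using powr_minus_divide[of u "1 / q"] by simp
    ultimately show ?thesis using that by (simp add: powr_divide)
  qed
  define X where "X = a powr - q / t"
  define Y where "Y = b powr - q / (1 - t)"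
  have XY: "0 < X" "0 < Y" using assms by (auto simp: X_def Y_def)
  have "X powr t * Y powr (1 - t) \<le> t * X + (1 - t) * Y"
    using assms XY by (intro Youngs_inequality_0) auto
  also have "\<dots> = a powr - q + b powr - q" using assms by (simp add: X_def Y_def)
  finally have "(a powr - q + b powr - q) powr (- 1 / q) \<le> (X powr t * Y powr (1 - t)) powr (- 1 / q)"
    using assms XY by (intro powr_mono2') auto
  also have "\<dots> = (X powr (- 1 / q)) powr t * (Y powr (- 1 / q)) powr (1 - t)"
    using XY by (simp add: powr_mult powr_powr mult_ac)
  also have "X powr (- 1 / q) = t powr (1 / q) * a" unfolding X_def by (rule root) (use assms in auto)
  also have "Y powr (- 1 / q) = (1 - t) powr (1 / q) * b" unfolding Y_def by (rule root) (use assms in auto)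
  finally show ?thesis .
qed

lemma ennreal_le_of_mult_less_one:
  fixes M :: real and I :: ennreal
  assumes M: "0 \<le> M" and le: "\<And>z. 0 < z \<Longrightarrow> z < 1 \<Longrightarrow> ennreal (z * M) \<le> I"
  shows "ennreal M \<le> I"
proof (cases I)
  case (real i)
  have "M \<le> i"
  proof (rule field_le_mult_one_interval)
    fix z :: real assume "0 < z" "z < 1"
    then show "z * M \<le> i" using le[of z] real by simp
  qed
  then show ?thesis using real by (simp add: ennreal_leI)
qed simp

text \<open>At equal quantile level \<open>u\<close> the points \<open>r u\<close> and
  \<open>y u\<close> are merged into \<open>g u = s u powr (- 1 / p)\<close>. The factor
  \<open>t powr c\<close> of the bound on \<open>H3\<close> and the factor
  \<open>t powr (1 / p)\<close> in \<open>g' u\<close> multiply to \<open>t powr (1 / q)\<close>.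
  The resulting lower bound for \<open>H3 (g u) * g' u\<close> is constant in \<open>u\<close>, and
  substitution by \<open>g\<close> concludes.\<close>

lemma transport_inequality:
  fixes H1 H2 H3 :: "real \<Rightarrow> real"
  assumes [measurable]: "H3 \<in> borel_measurable borel"
    and p: "0 < p" and c: "0 \<le> c" and q: "q = 1 / (c + 1 / p)" and \<phi>: "0 < \<phi>1" "0 < \<phi>2"
    and quantile: "\<And>\<eta>. 0 < \<eta> \<Longrightarrow> \<eta> < 1 \<Longrightarrow> \<exists>r r'. (\<forall>u\<in>{0<..<1}. 0 < r u \<and> (r has_real_derivative r' u) (at u)
        \<and> 0 < r' u \<and> \<eta> * \<phi>1 \<le> r' u * H1 (r u)) \<and> continuous_on {0<..<1} r'"
      "\<And>\<eta>. 0 < \<eta> \<Longrightarrow> \<eta> < 1 \<Longrightarrow> \<exists>r r'. (\<forall>u\<in>{0<..<1}. 0 < r u \<and> (r has_real_derivative r' u) (at u)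
        \<and> 0 < r' u \<and> \<eta> * \<phi>2 \<le> r' u * H2 (r u)) \<and> continuous_on {0<..<1} r'"
    and H3: "\<And>x y t s. 0 < x \<Longrightarrow> 0 < y \<Longrightarrow> s = x powr - p + y powr - p \<Longrightarrow> t = x powr - p / s \<Longrightarrow>
        (t powr c * H1 x) powr t * ((1 - t) powr c * H2 y) powr (1 - t) \<le> H3 (s powr (- 1 / p))"
  shows "ennreal ((\<phi>1 powr - q + \<phi>2 powr - q) powr (- 1 / q)) \<le> (\<integral>\<^sup>+x. ennreal (H3 x) * indicator {0<..} x \<partial>lborel)"
proof -
  define M where "M = (\<phi>1 powr - q + \<phi>2 powr - q) powr (- 1 / q)"
  have cp: "0 < c + 1 / p" using c p by (simp add: add_nonneg_pos)
  have q0: "0 < q" using cp by (simp add: q)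
  have main: "ennreal ((1 - 2 * \<epsilon>) * (\<eta> * M)) \<le> (\<integral>\<^sup>+x. ennreal (H3 x) * indicator {0<..} x \<partial>lborel)"
    if \<eta>: "0 < \<eta>" "\<eta> < 1" and \<epsilon>: "0 < \<epsilon>" "\<epsilon> < 1 / 2" for \<eta> \<epsilon>
  proof -
    obtain r r' where r: "\<And>u. u \<in> {0<..<1} \<Longrightarrow> 0 < r u" "\<And>u. u \<in> {0<..<1} \<Longrightarrow> (r has_real_derivative r' u) (at u)"
      "\<And>u. u \<in> {0<..<1} \<Longrightarrow> 0 < r' u" "\<And>u. u \<in> {0<..<1} \<Longrightarrow> \<eta> * \<phi>1 \<le> r' u * H1 (r u)" 
      "continuous_on {0<..<1} r'" using quantile(1)[OF \<eta>] by metis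
    obtain y y' where y: "\<And>u. u \<in> {0<..<1} \<Longrightarrow> 0 < y u" "\<And>u. u \<in> {0<..<1} \<Longrightarrow> (y has_real_derivative y' u) (at u)"
      "\<And>u. u \<in> {0<..<1} \<Longrightarrow> 0 < y' u" "\<And>u. u \<in> {0<..<1} \<Longrightarrow> \<eta> * \<phi>2 \<le> y' u * H2 (y u)" 
      "continuous_on {0<..<1} y'" using quantile(2)[OF \<eta>] by metis
    have sub: "{\<epsilon>..1 - \<epsilon>} \<subseteq> {0<..<1}" using \<epsilon> by auto
    define s where "s u = r u powr - p + y u powr - p" for u
    define g where "g u = s u powr (- 1 / p)" for u
    define g' where "g' u = s u powr (- 1 / p - 1) * (r u powr (- p - 1) * r' u + y u powr (- p - 1) * y' u)" for u
    have s0: "0 < s u" if "u \<in> {0<..<1}" for u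
      using r(1)[OF that] y(1)[OF that] by (simp add: s_def add_pos_pos)
    have sder: "(s has_real_derivative - p * (r u powr (- p - 1) * r' u + y u powr (- p - 1) * y' u)) (at u)"
      if u: "u \<in> {0<..<1}" for u
      unfolding s_def using r(1,2)[OF u] y(1,2)[OF u]
      by (auto intro!: derivative_eq_intros simp: algebra_simps powr_diff)
    have gder: "(g has_real_derivative g' u) (at u)" if u: "u \<in> {0<..<1}" for u
    proof -
      have "(g has_real_derivative (- 1 / p) * s u powr (- 1 / p - 1) *
          (- p * (r u powr (- p - 1) * r' u + y u powr (- p - 1) * y' u))) (at u)"
        unfolding g_def using DERIV_fun_powr[OF sder[OF u] s0[OF u], of "- 1 / p"] s0[OF u]
        by simp
      then show ?thesis using p by (simp add: g'_def)
    qed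
    have rc: "continuous_on {0<..<1} r" "continuous_on {0<..<1} y"
      by (rule DERIV_continuous_on[OF has_field_derivative_at_within], rule r(2), simp)
        (rule DERIV_continuous_on[OF has_field_derivative_at_within], rule y(2), simp)
    have nz: "r u \<noteq> 0" "y u \<noteq> 0" "s u \<noteq> 0" if "0 < u" "u < 1" for u
      using r(1)[of u] y(1)[of u] s0[of u] that by auto
    have sc: "continuous_on {0<..<1} s"
      unfolding s_def by (intro continuous_intros rc) (simp_all add: nz)
    have "continuous_on {0<..<1} g'"
      unfolding g'_def by (intro continuous_intros rc r(5) y(5) sc) (simp_all add: nz)
    then have g'c: "continuous_on {\<epsilon>..1 - \<epsilon>} g'" using sub continuous_on_subset by blast
    have g'0: "0 \<le> g' u" if u: "u \<in> {0<..<1}" for u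
      using r(3)[OF u] y(3)[OF u] by (auto simp: g'_def intro!: mult_nonneg_nonneg add_nonneg_nonneg)
    have key: "\<eta> * M \<le> H3 (g u) * g' u" if u: "u \<in> {0<..<1}" for u
    proof -
      define t where "t = r u powr - p / s u"
      note pos = r(1)[OF u] y(1)[OF u] s0[OF u] r(3)[OF u] y(3)[OF u]
      have t1: "1 - t = y u powr - p / s u" using pos by (simp add: t_def s_def field_simps)
      have "0 < t" unfolding t_def using pos by simp
      moreover have "0 < 1 - t" unfolding t1 using pos by simp
      ultimately have t: "0 < t" "t < 1" by auto
      \<comment> \<open>No sign of \<open>H1\<close> and \<open>H2\<close> is assumed; at quantile
        points it follows from the positive lower bound for \<open>r' u * H1 (r u)\<close> and its
        counterpart.\<close>
      have Hpos: "0 < H1 (r u)" "0 < H2 (y u)"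
        using less_le_trans[OF mult_pos_pos[OF \<eta>(1) \<phi>(1)] r(4)[OF u]]
          less_le_trans[OF mult_pos_pos[OF \<eta>(1) \<phi>(2)] y(4)[OF u]] pos
        by (auto simp: zero_less_mult_iff)
      \<comment> \<open>Both sides equal \<open>(x powr - p / s u) powr (1 + 1 / p)\<close>; this
        exhibits \<open>g' u\<close> as the mean, with weights \<open>t\<close> and
        \<open>1 - t\<close>, of \<open>t powr (1 / p) * r' u\<close> and
        \<open>(1 - t) powr (1 / p) * y' u\<close>.\<close>
      have coef: "s u powr (- 1 / p - 1) * x powr (- p - 1) = (x powr - p / s u) * (x powr - p / s u) powr (1 / p)"
        if "0 < x" for x
      proof -
        have "(x powr - p / s u) powr (1 / p) = (x powr - p) powr (1 / p) / s u powr (1 / p)"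
          by (rule powr_divide)
        moreover have "(x powr - p) powr (1 / p) = x powr (- 1)" using p by (simp add: powr_powr)
        moreover have "s u powr (- 1 / p - 1) = 1 / (s u powr (1 / p) * s u)"
          using pos powr_minus_divide[of "s u" "1 / p"] by (simp add: powr_diff)
        moreover have "x powr (- p - 1) = x powr - p * x powr (- 1)"
          by (subst powr_add[symmetric]) simp
        ultimately show ?thesis using pos by simp
      qed
      have "g' u = s u powr (- 1 / p - 1) * r u powr (- p - 1) * r' u + s u powr (- 1 / p - 1) * y u powr (- p - 1) * y' u"
        by (simp add: g'_def algebra_simps)
      also have "\<dots> = t * (t powr (1 / p) * r' u) + (1 - t) * ((1 - t) powr (1 / p) * y' u)"
        unfolding coef[OF pos(1)] coef[OF pos(2)] t1[symmetric] t_def[symmetric] by (simp add: mult.assoc)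
      finally have "(t powr (1 / p) * r' u) powr t * ((1 - t) powr (1 / p) * y' u) powr (1 - t) \<le> g' u"
        using t pos Youngs_inequality_0[of t "1 - t" "t powr (1 / p) * r' u" "(1 - t) powr (1 / p) * y' u"] by simp
      moreover have "(t powr c * H1 (r u)) powr t * ((1 - t) powr c * H2 (y u)) powr (1 - t) \<le> H3 (g u)"
        using H3[OF pos(1,2) s_def t_def] by (simp add: g_def)
      ultimately have "((t powr c * H1 (r u)) powr t * ((1 - t) powr c * H2 (y u)) powr (1 - t)) *
          ((t powr (1 / p) * r' u) powr t * ((1 - t) powr (1 / p) * y' u) powr (1 - t)) \<le> H3 (g u) * g' u"
        by (intro mult_mono) (auto intro: order_trans[rotated])
      also have "((t powr c * H1 (r u)) powr t * ((1 - t) powr c * H2 (y u)) powr (1 - t)) *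
          ((t powr (1 / p) * r' u) powr t * ((1 - t) powr (1 / p) * y' u) powr (1 - t))
        = ((t powr c * H1 (r u)) * (t powr (1 / p) * r' u)) powr t *
          (((1 - t) powr c * H2 (y u)) * ((1 - t) powr (1 / p) * y' u)) powr (1 - t)"
        using Hpos pos t by (simp add: powr_mult mult_ac)
      also have "(t powr c * H1 (r u)) * (t powr (1 / p) * r' u) = t powr (1 / q) * (r' u * H1 (r u))"
        by (simp add: q powr_add mult_ac)
      also have "((1 - t) powr c * H2 (y u)) * ((1 - t) powr (1 / p) * y' u) = (1 - t) powr (1 / q) * (y' u * H2 (y u))"
        by (simp add: q powr_add mult_ac)
      finally have *: "(t powr (1 / q) * (r' u * H1 (r u))) powr t * ((1 - t) powr (1 / q) * (y' u * H2 (y u))) powr (1 - t)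
        \<le> H3 (g u) * g' u" .
      have "\<eta> * M = \<eta> powr t * \<eta> powr (1 - t) * M" using \<eta> by (simp flip: powr_add)
      also have "\<dots> \<le> \<eta> powr t * \<eta> powr (1 - t) * ((t powr (1 / q) * \<phi>1) powr t * ((1 - t) powr (1 / q) * \<phi>2) powr (1 - t))"
        unfolding M_def using \<phi> q0 t by (intro mult_left_mono weighted_gm_ge_power_mean) auto
      also have "\<dots> = (t powr (1 / q) * (\<eta> * \<phi>1)) powr t * ((1 - t) powr (1 / q) * (\<eta> * \<phi>2)) powr (1 - t)"
        using \<eta> \<phi> t by (simp add: powr_mult mult_ac)
      also have "\<dots> \<le> (t powr (1 / q) * (r' u * H1 (r u))) powr t * ((1 - t) powr (1 / q) * (y' u * H2 (y u))) powr (1 - t)"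
      proof -
        have m: "(w powr (1 / q) * x) powr v \<le> (w powr (1 / q) * x') powr v"
          if "0 \<le> x" "x \<le> x'" "0 \<le> v" for w x x' v :: real
          using that by (intro powr_mono2 mult_left_mono) auto
        show ?thesis using r(4)[OF u] y(4)[OF u] t \<eta> \<phi> by (intro mult_mono[OF m m]) auto
      qed
      also note *
      finally show ?thesis .
    qed
    have "ennreal ((1 - 2 * \<epsilon>) * (\<eta> * M)) = (\<integral>\<^sup>+u. ennreal (\<eta> * M) * indicator {\<epsilon>..1 - \<epsilon>} u \<partial>lborel)"
      using \<epsilon> \<eta> by (simp add: nn_integral_cmult mult.commute[of "ennreal (\<eta> * M)"] M_def flip: ennreal_mult)
    also have "\<dots> \<le> (\<integral>\<^sup>+u. ennreal (H3 (g u)) * ennreal (g' u) * indicator {\<epsilon>..1 - \<epsilon>} u \<partial>lborel)"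
    proof (rule nn_integral_mono)
      fix u
      show "ennreal (\<eta> * M) * indicator {\<epsilon>..1 - \<epsilon>} u \<le> ennreal (H3 (g u)) * ennreal (g' u) * indicator {\<epsilon>..1 - \<epsilon>} u"
      proof (cases "u \<in> {\<epsilon>..1 - \<epsilon>}")
        case True
        with sub have u: "u \<in> {0<..<1}" by blast
        have "ennreal (\<eta> * M) \<le> ennreal (H3 (g u) * g' u)" using key[OF u] by (rule ennreal_leI)
        then show ?thesis using True g'0[OF u] by (simp add: ennreal_mult'')
      qed simp
    qed
    also have "\<dots> = (\<integral>\<^sup>+x. ennreal (H3 x) * indicator {g \<epsilon>..g (1 - \<epsilon>)} x \<partial>lborel)"
      using sub \<epsilon> by (intro nn_integral_substitution_aux[symmetric] g'c gder g'0) auto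
    also have "\<dots> \<le> (\<integral>\<^sup>+x. ennreal (H3 x) * indicator {0<..} x \<partial>lborel)"
    proof (intro nn_integral_mono mult_left_mono)
      fix x
      have "0 < g \<epsilon>" using s0[of \<epsilon>] \<epsilon> by (simp add: g_def)
      then show "indicator {g \<epsilon>..g (1 - \<epsilon>)} x \<le> (indicator {0<..} x :: ennreal)" by (auto simp: indicator_def)
    qed simp
    finally show ?thesis .
  qed
  have "ennreal M \<le> (\<integral>\<^sup>+x. ennreal (H3 x) * indicator {0<..} x \<partial>lborel)"
  proof (rule ennreal_le_of_mult_less_one)
    fix z :: real assume z: "0 < z" "z < 1"
    \<comment> \<open>\<open>z\<close> is split as \<open>sqrt z * sqrt z\<close>: one factor is the
      length of the retained parameter interval, the other is \<open>\<eta>\<close>.\<close>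
    then have w: "0 < sqrt z" "sqrt z < 1" by auto
    have e: "1 - 2 * ((1 - sqrt z) / 2) = sqrt z" by (simp add: field_simps)
    have "z * M = (1 - 2 * ((1 - sqrt z) / 2)) * (sqrt z * M)"
      unfolding e using z by (simp flip: mult.assoc)
    also have "ennreal \<dots> \<le> (\<integral>\<^sup>+x. ennreal (H3 x) * indicator {0<..} x \<partial>lborel)"
      using w by (intro main) auto
    finally show "ennreal (z * M) \<le> (\<integral>\<^sup>+x. ennreal (H3 x) * indicator {0<..} x \<partial>lborel)" .
  qed (simp add: M_def)
  then show ?thesis by (simp add: M_def)
qed

section \<open>Symmetric log-concave densities and p-convex bodies\<close>

lemma log_concave_functionD:
  assumes "log_concave_function f" "0 < t" "t < 1"
  shows "f x powr t * f y powr (1 - t) \<le> f (t *\<^sub>R x + (1 - t) *\<^sub>R y)"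
  using assms unfolding log_concave_function_def by blast

lemma log_concave_function_nonneg: "log_concave_function f \<Longrightarrow> 0 \<le> f x"
  unfolding log_concave_function_def by blast

lemma log_concave_function_ge:
  assumes f: "log_concave_function f" and t: "0 < t" "t < 1" and "c1 \<le> f x" "c2 \<le> f y" "0 \<le> c1" "0 \<le> c2"
  shows "c1 powr t * c2 powr (1 - t) \<le> f (t *\<^sub>R x + (1 - t) *\<^sub>R y)"
proof -
  have "c1 powr t * c2 powr (1 - t) \<le> f x powr t * f y powr (1 - t)"
    using assms by (intro mult_mono powr_mono2) auto
  also note log_concave_functionD[OF f t]
  finally show ?thesis .
qed

lemma convex_log_concave_superlevel:
  assumes f: "log_concave_function f" and c: "0 < c"
  shows "convex {x. c \<le> f x}"
proof (rule convexI)
  fix x y and u v :: real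
  assume xy: "x \<in> {x. c \<le> f x}" "y \<in> {x. c \<le> f x}" and uv: "0 \<le> u" "0 \<le> v" "u + v = 1"
  show "u *\<^sub>R x + v *\<^sub>R y \<in> {x. c \<le> f x}"
  proof (cases "u = 0 \<or> v = 0")
    case True
    then show ?thesis using xy uv by auto
  next
    case False
    then have u: "0 < u" "u < 1" "v = 1 - u" using uv by auto
    have "c = c powr u * c powr (1 - u)" using c by (simp flip: powr_add)
    also have "\<dots> \<le> f (u *\<^sub>R x + (1 - u) *\<^sub>R y)" using xy c u by (intro log_concave_function_ge[OF f]) auto
    finally show ?thesis using u by simp
  qed
qed

lemma convex_log_concave_positive:
  assumes f: "log_concave_function f"
  shows "convex {x. 0 < f x}"
proof (rule convexI)
  fix x y and u v :: real
  assume xy: "x \<in> {x. 0 < f x}" "y \<in> {x. 0 < f x}" and uv: "0 \<le> u" "0 \<le> v" "u + v = 1"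
  then have "min (f x) (f y) \<le> f (u *\<^sub>R x + v *\<^sub>R y)"
    using convexD[OF convex_log_concave_superlevel[OF f, of "min (f x) (f y)"], of x y u v] by simp
  then show "u *\<^sub>R x + v *\<^sub>R y \<in> {x. 0 < f x}" using xy by auto
qed

lemma measure_support_subset_closed:
  assumes "closed S" "emeasure \<mu> (- S) = 0"
  shows "measure_support \<mu> \<subseteq> S"
proof
  fix x assume x: "x \<in> measure_support \<mu>"
  show "x \<in> S"
  proof (rule ccontr)
    assume "x \<notin> S"
    then have "emeasure \<mu> (- S) > 0"
      using x \<open>closed S\<close> unfolding measure_support_def by (auto simp: open_Compl)
    then show False using assms by simp
  qed
qed

lemma lborel_distr_diff: "distr lborel borel (\<lambda>x. a - x) = (lborel :: 'a::euclidean_space measure)"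
  using lborel_affine[of "- 1" a] by (simp add: density_1)

lemma AE_lborel_reflect:
  fixes a :: "'a::euclidean_space"
  assumes [measurable]: "Measurable.pred borel P" and "AE x in lborel. P x"
  shows "AE x in lborel. P (a - x)"
proof -
  have "AE x in distr lborel borel (\<lambda>x. a - x). P x" using assms(2) unfolding lborel_distr_diff .
  then show ?thesis by (subst (asm) AE_distr_iff) auto
qed

lemma AE_lborel_open_witness:
  fixes S :: "'a::euclidean_space set"
  assumes "AE x in lborel. P x" "open S" "S \<noteq> {}"
  shows "\<exists>x\<in>S. P x"
proof (rule ccontr)
  assume "\<not> ?thesis"
  then have S: "S \<subseteq> {x\<in>space lborel. \<not> P x}" by auto
  from assms(1) obtain N where "{x\<in>space lborel. \<not> P x} \<subseteq> N" "N \<in> null_sets lborel"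
    by (auto simp: eventually_ae_filter)
  then have "negligible S"
    using S by (meson negligible_iff_null_sets negligible_subset null_sets_completionI order_trans)
  then show False using open_not_negligible assms by blast
qed

context
  fixes \<mu> :: "'a::euclidean_space measure" and f :: "'a \<Rightarrow> real"
  assumes nd: "nondegenerate_measure \<mu>" and dens: "log_concave_density \<mu> f" and sym: "symmetric_measure \<mu>"
begin

lemma log_concave_density_measurable: "f \<in> borel_measurable borel"
  and log_concave_density_log_concave: "log_concave_function f"
  and log_concave_density_eq: "\<mu> = density lborel (\<lambda>x. ennreal (f x))"
  using dens by (auto simp: log_concave_density_def)

lemma log_concave_density_emeasure:
  "A \<in> sets borel \<Longrightarrow> emeasure \<mu> A = (\<integral>\<^sup>+x. ennreal (f x) * indicator A x \<partial>lborel)"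
  using log_concave_density_measurable unfolding log_concave_density_eq by (subst emeasure_density) auto

text \<open>The reflected measure has density \<open>f (- x)\<close>, and uniqueness of densities
  gives agreement only almost everywhere.\<close>

lemma symmetric_density_AE_even: "AE x in lborel. f (- x) = f x"
proof -
  note [measurable] = log_concave_density_measurable
  have "density lborel (\<lambda>x. ennreal (f (- x))) = density lborel (\<lambda>x. ennreal (f x))"
  proof (rule measure_eqI)
    fix A :: "'a set" assume "A \<in> sets (density lborel (\<lambda>x. ennreal (f (- x))))"
    then have [measurable]: "A \<in> sets borel" by simp
    have neg: "uminus ` A = {x. - x \<in> A}" by force
    have [measurable]: "uminus ` A \<in> sets borel" unfolding neg by measurable
    have "emeasure (density lborel (\<lambda>x. ennreal (f (- x)))) A = (\<integral>\<^sup>+x. ennreal (f (0 - x)) * indicator A x \<partial>lborel)"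
      by (simp add: emeasure_density)
    also have "\<dots> = (\<integral>\<^sup>+x. ennreal (f (0 - x)) * indicator (uminus ` A) (0 - x) \<partial>lborel)"
      by (intro nn_integral_cong) (auto simp: neg indicator_def)
    also have "\<dots> = (\<integral>\<^sup>+x. ennreal (f x) * indicator (uminus ` A) x \<partial>distr lborel borel (\<lambda>x. 0 - x))"
      by (subst nn_integral_distr) auto
    also have "\<dots> = emeasure \<mu> (uminus ` A)"
      unfolding lborel_distr_diff by (simp add: log_concave_density_emeasure)
    also have "\<dots> = emeasure \<mu> A"
      using sym by (simp add: symmetric_measure_def log_concave_density_eq)
    finally show "emeasure (density lborel (\<lambda>x. ennreal (f (- x)))) A = emeasure (density lborel (\<lambda>x. ennreal (f x))) A"
      by (simp add: log_concave_density_eq)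
  qed simp
  then have "AE x in lborel. ennreal (f (- x)) = ennreal (f x)"
    by (subst (asm) sigma_finite_measure.density_unique_iff[OF sigma_finite_lborel]) auto
  then show ?thesis
    using log_concave_function_nonneg[OF log_concave_density_log_concave] by simp
qed

text \<open>Otherwise the convex set where \<open>f\<close> is positive has empty interior, hence
  lies in a hyperplane, or it lies in a half-space bounded by a hyperplane through the origin; then
  symmetry makes both open half-spaces null. In either case the support of \<open>\<mu>\<close> lies
  in a hyperplane.\<close>

lemma zero_in_interior_positive_density: "0 \<in> interior {x. 0 < f x}"
proof (rule ccontr)
  assume not: "0 \<notin> interior {x. 0 < f x}"
  let ?C = "{x. 0 < f x}"
  have conv: "convex ?C" by (rule convex_log_concave_positive[OF log_concave_density_log_concave])
  have null: "emeasure \<mu> A = 0" if "A \<in> sets borel" "A \<inter> ?C = {}" for A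
  proof -
    have "ennreal (f x) * indicator A x = 0" for x
      using that log_concave_function_nonneg[OF log_concave_density_log_concave, of x]
      by (auto simp: indicator_def ennreal_eq_0_iff)
    then have "(\<lambda>x. ennreal (f x) * indicator A x) = (\<lambda>x. 0)" by blast
    then show ?thesis using that by (simp only: log_concave_density_emeasure nn_integral_const mult_zero_left)
  qed
  have hyper: False if "a \<noteq> 0" "emeasure \<mu> (- {x. a \<bullet> x = b}) = 0" for a b
    using measure_support_subset_closed[OF closed_hyperplane that(2)] that(1) nd
    unfolding nondegenerate_measure_def by blast
  show False
  proof (cases "interior ?C = {}")
    case True
    obtain a b where ab: "a \<noteq> 0" "?C \<subseteq> {x. a \<bullet> x = b}"
      using empty_interior_subset_hyperplane[OF conv True] by blast
    have "emeasure \<mu> (- {x. a \<bullet> x = b}) = 0"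
      using ab by (intro null) auto
    then show False using hyper ab by blast
  next
    case False
    obtain a where a: "a \<noteq> 0" "\<forall>x\<in>interior ?C. 0 \<le> a \<bullet> x"
      using separating_hyperplane_set_0[OF convex_interior[OF conv] not] by blast
    have "closure (interior ?C) \<subseteq> {x. 0 \<le> a \<bullet> x}"
      using a by (intro closure_minimal closed_halfspace_ge) auto
    then have C: "?C \<subseteq> {x. 0 \<le> a \<bullet> x}"
      using convex_closure_interior[OF conv False] closure_subset[of ?C] by auto
    have m[measurable]: "{x. a \<bullet> x < 0} \<in> sets borel" "{x. 0 < a \<bullet> x} \<in> sets borel" by measurable
    have n1: "emeasure \<mu> {x. a \<bullet> x < 0} = 0" using C by (intro null) auto
    have "uminus ` {x. a \<bullet> x < 0} = {x. 0 < a \<bullet> x}"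
      by (auto simp: image_iff) (metis inner_minus_right minus_minus neg_less_0_iff_less)
    then have n2: "emeasure \<mu> {x. 0 < a \<bullet> x} = 0"
      using sym n1 m(1) unfolding symmetric_measure_def by (metis log_concave_density_eq sets_density sets_lborel)
    have "emeasure \<mu> (- {x. a \<bullet> x = 0}) \<le> emeasure \<mu> {x. a \<bullet> x < 0} + emeasure \<mu> {x. 0 < a \<bullet> x}"
    proof -
      have "- {x. a \<bullet> x = 0} = {x. a \<bullet> x < 0} \<union> {x. 0 < a \<bullet> x}" by auto
      then show ?thesis
        using m by (simp only:) (intro emeasure_subadditive, auto simp: log_concave_density_eq)
    qed
    then show False using hyper[of a 0] a n1 n2 by simp
  qed
qed

text \<open>The density need not be even at every point, and its sections need not be even almost
  everywhere a priori; the last property is the quantitative substitute for evenness.\<close>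

lemma symmetric_log_concave_density_bounds:
  obtains c \<delta> where "0 < c" "0 < \<delta>" "\<And>x. norm x < \<delta> \<Longrightarrow> c \<le> f x" "\<And>x. f x \<le> f 0"
    "\<And>x l. 0 < l \<Longrightarrow> l < 1 \<Longrightarrow> (c / f 0) powr (1 - l) * f x \<le> f (- (l *\<^sub>R x))"
proof -
  note [measurable] = log_concave_density_measurable
  note f = log_concave_density_log_concave
  obtain c \<delta> where c: "0 < c" and \<delta>: "0 < \<delta>" and low: "\<And>x. norm x < \<delta> \<Longrightarrow> c \<le> f x"
  proof -
    obtain e where e: "0 < e" "cball 0 e \<subseteq> {x. 0 < f x}"
      using zero_in_interior_positive_density unfolding mem_interior_cball by blast
    define d where "d = e / real DIM('a)"
    have d: "0 < d" using e by (simp add: d_def)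
    \<comment> \<open>Without continuity of \<open>f\<close>, a uniform lower bound comes from the
      finitely many vertices of a cube: superlevel sets are convex and thus contain the whole
      cube.\<close>
    obtain S :: "'a set" where S: "finite S" "cbox (0 - (\<Sum>i\<in>Basis. d *\<^sub>R i)) (0 + (\<Sum>i\<in>Basis. d *\<^sub>R i)) = convex hull S"
      using cube_convex_hull[OF d, of "0::'a"] by blast
    have Spos: "0 < f s" if "s \<in> S" for s
    proof -
      have "s \<in> cbox (0 - (\<Sum>i\<in>Basis. d *\<^sub>R i)) (0 + (\<Sum>i\<in>Basis. d *\<^sub>R i))"
        unfolding S(2) using that by (rule hull_inc)
      then have "\<bar>s \<bullet> i\<bar> \<le> d" if "i \<in> Basis" for i
        using that by (auto simp: mem_box abs_le_iff inner_sum_left_Basis minus_le_iff)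
      then have "norm s \<le> (\<Sum>i\<in>(Basis::'a set). d)"
        by (intro order_trans[OF norm_le_l1] sum_mono)
      then have "norm s \<le> e" by (simp add: d_def)
      then show ?thesis using e by auto
    qed
    define c where "c = Min (insert 1 (f ` S))"
    have c: "0 < c" unfolding c_def using S(1) Spos by (subst Min_gr_iff) auto
    have "S \<subseteq> {x. c \<le> f x}" using S(1) by (auto simp: c_def)
    then have hull: "convex hull S \<subseteq> {x. c \<le> f x}"
      by (intro hull_minimal convex_log_concave_superlevel f c)
    have "c \<le> f x" if "norm x < d" for x
    proof -
      have "\<bar>x \<bullet> i\<bar> \<le> d" if "i \<in> Basis" for i
        using Basis_le_norm[OF that, of x] \<open>norm x < d\<close> by linarith
      then have "x \<in> cbox (0 - (\<Sum>i\<in>Basis. d *\<^sub>R i)) (0 + (\<Sum>i\<in>Basis. d *\<^sub>R i))"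
        by (auto simp: mem_box abs_le_iff inner_sum_left_Basis minus_le_iff)
      then show ?thesis using hull S(2) by auto
    qed
    then show ?thesis using that c d by blast
  qed
  have refl: "f x powr l * c powr (1 - l) \<le> f (- (l *\<^sub>R x))" if l: "0 < l" "l < 1" for x l
  proof -
    define v where "v = f x powr l * c powr (1 - l)"
    have v0: "0 \<le> v" by (simp add: v_def)
    let ?B = "ball (l *\<^sub>R x) ((1 - l) * \<delta>)"
    have onB: "v \<le> f y" if "y \<in> ?B" for y
    proof -
      define z where "z = (1 / (1 - l)) *\<^sub>R (y - l *\<^sub>R x)"
      have y: "y = l *\<^sub>R x + (1 - l) *\<^sub>R z" using l by (simp add: z_def)
      have "norm (y - l *\<^sub>R x) < (1 - l) * \<delta>" using that by (simp add: dist_norm norm_minus_commute)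
      then have "norm z < \<delta>" using l by (simp add: z_def pos_divide_less_eq mult.commute)
      then show ?thesis unfolding v_def y using c log_concave_function_nonneg[OF f]
        by (intro log_concave_function_ge[OF f] l low) auto
    qed
    \<comment> \<open>The points \<open>y\<close> and \<open>2 l x - y\<close> are symmetric about
      \<open>l x\<close>. Almost every \<open>y\<close> has \<open>f\<close> even at both, and then
      \<open>- l x\<close> is the midpoint of \<open>- y\<close> and its partner.\<close>
    have "AE y in lborel. f (- (2 *\<^sub>R l *\<^sub>R x - y)) = f (2 *\<^sub>R l *\<^sub>R x - y)"
      by (rule AE_lborel_reflect[OF _ symmetric_density_AE_even]) measurable
    with symmetric_density_AE_even
    have "AE y in lborel. f (- y) = f y \<and> f (- (2 *\<^sub>R l *\<^sub>R x - y)) = f (2 *\<^sub>R l *\<^sub>R x - y)" by eventually_elim simp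
    moreover have "0 < (1 - l) * \<delta>" using l \<delta> by simp
    then have "?B \<noteq> {}" by simp
    ultimately have "\<exists>y\<in>?B. f (- y) = f y \<and> f (- (2 *\<^sub>R l *\<^sub>R x - y)) = f (2 *\<^sub>R l *\<^sub>R x - y)"
      by (intro AE_lborel_open_witness) auto
    then obtain y where y: "y \<in> ?B" "f (- y) = f y" "f (- (2 *\<^sub>R l *\<^sub>R x - y)) = f (2 *\<^sub>R l *\<^sub>R x - y)"
      by blast
    have y': "2 *\<^sub>R l *\<^sub>R x - y \<in> ?B"
    proof -
      have "l *\<^sub>R x - (2 *\<^sub>R l *\<^sub>R x - y) = - (l *\<^sub>R x - y)"
        by (simp only: scaleR_2) simp
      then have "dist (l *\<^sub>R x) (2 *\<^sub>R l *\<^sub>R x - y) = dist (l *\<^sub>R x) y" by (metis dist_norm norm_minus_cancel)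
      then show ?thesis using y(1) by simp
    qed
    have "v = v powr (1/2) * v powr (1 - 1/2)" using v0 by (simp flip: powr_add)
    also have "\<dots> \<le> f ((1/2) *\<^sub>R (- y) + (1 - 1/2) *\<^sub>R (- (2 *\<^sub>R l *\<^sub>R x - y)))"
      using onB[OF y(1)] onB[OF y'] y v0 by (intro log_concave_function_ge[OF f]) auto
    also have "(1/2) *\<^sub>R (- y) + (1 - 1/2) *\<^sub>R (- (2 *\<^sub>R l *\<^sub>R x - y)) = - (l *\<^sub>R x)"
      by (simp only: scaleR_2) (simp add: algebra_simps flip: scaleR_add_left)
    finally show ?thesis by (simp add: v_def)
  qed
  have f0: "c \<le> f 0" using low[of 0] \<delta> by simp
  \<comment> \<open>The origin is the midpoint of \<open>l x\<close> and \<open>- l x\<close>; the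
    lower bounds at these two points combine to a quantity tending to \<open>f x\<close> as
    \<open>l\<close> tends to 1.\<close>
  have max: "f x \<le> f 0" for x
  proof (cases "f x = 0")
    case True
    then show ?thesis using f0 c by simp
  next
    case False
    then have fx: "0 < f x" using log_concave_function_nonneg[OF f, of x] by simp
    have "((\<lambda>l. f x powr l * (f 0 * c) powr ((1 - l) / 2)) \<longlongrightarrow> f x powr 1 * (f 0 * c) powr ((1 - 1) / 2)) (at_left 1)"
      using fx f0 c by (intro tendsto_intros) auto
    then have lim: "((\<lambda>l. f x powr l * (f 0 * c) powr ((1 - l) / 2)) \<longlongrightarrow> f x) (at_left 1)"
      using fx f0 c by simp
    show ?thesis
    proof (rule tendsto_upperbound[OF lim])
      have "f x powr l * (f 0 * c) powr ((1 - l) / 2) \<le> f 0" if l: "0 < l" "l < 1" for l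
      proof -
        have "f x powr l * (f 0 * c) powr ((1 - l) / 2)
          = (f x powr l * f 0 powr (1 - l)) powr (1/2) * (f x powr l * c powr (1 - l)) powr (1 - 1/2)"
          using fx f0 c by (simp add: powr_mult powr_powr mult_ac field_simps flip: powr_add)
        also have "\<dots> \<le> f ((1/2) *\<^sub>R (l *\<^sub>R x) + (1 - 1/2) *\<^sub>R (- (l *\<^sub>R x)))"
          using log_concave_functionD[OF f l, of x 0] refl[OF l, of x]
          by (intro log_concave_function_ge[OF f]) auto
        finally show ?thesis by simp
      qed
      then show "eventually (\<lambda>l. f x powr l * (f 0 * c) powr ((1 - l) / 2) \<le> f 0) (at_left 1)"
        using eventually_at_left_real[of 0 1] by (auto elim: eventually_mono)
    qed simp
  qed
  \<comment> \<open>Replacing part of the power of \<open>f x\<close> by one of the maximum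
    \<open>f 0\<close> makes the bound linear in \<open>f x\<close>, so that it survives integration
    over fibres and rays.\<close>
  have "(c / f 0) powr (1 - l) * f x \<le> f (- (l *\<^sub>R x))" if l: "0 < l" "l < 1" for x l
  proof (cases "f x = 0")
    case True
    then show ?thesis using log_concave_function_nonneg[OF f] by simp
  next
    case False
    then have fx: "0 < f x" using log_concave_function_nonneg[OF f, of x] by simp
    have "f x = f x powr l * f x powr (1 - l)" using fx by (simp flip: powr_add)
    also have "\<dots> \<le> f x powr l * f 0 powr (1 - l)"
      using fx max[of x] l by (intro mult_left_mono powr_mono2) auto
    finally have "(c / f 0) powr (1 - l) * f x \<le> (c / f 0) powr (1 - l) * (f x powr l * f 0 powr (1 - l))"
      by (intro mult_left_mono) auto
    also have "\<dots> = f x powr l * c powr (1 - l)"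
      using f0 c by (simp add: powr_divide)
    also note refl[OF l]
    finally show ?thesis .
  qed
  then show ?thesis using that c \<delta> low max by blast
qed

end

lemma log_concave_function_star:
  assumes f: "log_concave_function f" and max: "\<And>x. f x \<le> f 0" and l: "0 < l" "l \<le> 1"
  shows "f x \<le> f (l *\<^sub>R x)"
proof (cases "l = 1")
  case False
  then have l: "0 < l" "l < 1" using l by auto
  have "f x = f x powr l * f x powr (1 - l)"
    using log_concave_function_nonneg[OF f, of x] by (cases "f x = 0") (auto simp flip: powr_add)
  also have "\<dots> \<le> f (l *\<^sub>R x + (1 - l) *\<^sub>R 0)"
    using log_concave_function_nonneg[OF f] by (intro log_concave_function_ge[OF f] l max) auto
  finally show ?thesis by simp
qed simp

section \<open>The Minkowski functional of a p-convex body\<close>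

lemma minkowski_functional_set_ne:
  assumes "p_convex p K"
  shows "{c. 0 \<le> c \<and> x \<in> (\<lambda>y. c *\<^sub>R y) ` K} \<noteq> {}"
  using assms unfolding p_convex_def by blast

lemma minkowski_functional_nonneg:
  assumes "p_convex p K"
  shows "0 \<le> minkowski_functional K x"
  unfolding minkowski_functional_def using minkowski_functional_set_ne[OF assms, of x]
  by (intro cInf_greatest) auto

lemma minkowski_functional_scaleR_le:
  assumes "x \<in> K" "0 \<le> a"
  shows "minkowski_functional K (a *\<^sub>R x) \<le> a"
  unfolding minkowski_functional_def using assms
  by (intro cInf_lower bdd_belowI[of _ 0]) auto

lemma origin_star_shapedD:
  assumes "origin_star_shaped K" "x \<in> K" "0 \<le> a" "a \<le> 1"
  shows "a *\<^sub>R x \<in> K"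
proof -
  have "a *\<^sub>R x \<in> closed_segment 0 x" using assms by (auto simp: in_segment)
  then show ?thesis using assms unfolding origin_star_shaped_def by blast
qed

text \<open>If the functional is at most 1, then \<open>(1 / l) *\<^sub>R x\<close> lies in
  \<open>K\<close> for every \<open>l > 1\<close>; closedness of \<open>K\<close> allows
  \<open>l\<close> to tend to 1.\<close>

lemma minkowski_functional_le_1_iff:
  assumes K: "p_convex p K"
  shows "minkowski_functional K x \<le> 1 \<longleftrightarrow> x \<in> K"
proof
  assume "x \<in> K"
  then show "minkowski_functional K x \<le> 1" using minkowski_functional_scaleR_le[of x K 1] by simp
next
  assume le: "minkowski_functional K x \<le> 1"
  have K': "closed K" "origin_star_shaped K" using K by (auto simp: p_convex_def body_def compact_imp_closed)
  have mem: "(1 / l) *\<^sub>R x \<in> K" if l: "1 < l" for l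
  proof -
    have "Inf {c. 0 \<le> c \<and> x \<in> (\<lambda>y. c *\<^sub>R y) ` K} < l" using le l by (simp add: minkowski_functional_def)
    then obtain c y where c: "0 \<le> c" "x = c *\<^sub>R y" "y \<in> K" "c < l"
      using cInf_lessD[OF minkowski_functional_set_ne[OF K, of x], of l] by fast
    then have "(c / l) *\<^sub>R y \<in> K" using l by (intro origin_star_shapedD[OF K'(2)]) auto
    then show ?thesis using c by simp
  qed
  have "((\<lambda>l. (1 / l) *\<^sub>R x) \<longlongrightarrow> (1 / 1) *\<^sub>R x) (at_right (1::real))" by (intro tendsto_intros) auto
  then have lim: "((\<lambda>l. (1 / l) *\<^sub>R x) \<longlongrightarrow> x) (at_right (1::real))" by simp
  show "x \<in> K"
  proof (rule Lim_in_closed_set[OF K'(1) _ _ lim])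
    show "eventually (\<lambda>l. (1 / l) *\<^sub>R x \<in> K) (at_right (1::real))"
      using mem by (auto simp: eventually_at_right_field intro!: exI[of _ 2])
  qed simp
qed

lemma p_convexD:
  assumes K: "p_convex p K" and p: "0 < p" and xy: "x \<in> K" "y \<in> K" and ab: "0 \<le> a" "0 \<le> b" "a powr p + b powr p \<le> 1"
  shows "a *\<^sub>R x + b *\<^sub>R y \<in> K"
proof -
  let ?m = "minkowski_functional K"
  have "?m (a *\<^sub>R x + b *\<^sub>R y) powr p \<le> ?m (a *\<^sub>R x) powr p + ?m (b *\<^sub>R y) powr p"
    using K by (simp add: p_convex_def)
  also have "\<dots> \<le> a powr p + b powr p"
    using xy ab p by (intro add_mono powr_mono2 minkowski_functional_scaleR_le minkowski_functional_nonneg[OF K]) auto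
  finally have le: "?m (a *\<^sub>R x + b *\<^sub>R y) powr p \<le> 1" using ab by simp
  have "?m (a *\<^sub>R x + b *\<^sub>R y) \<le> 1"
  proof (rule ccontr)
    assume "\<not> ?thesis"
    then have "1 powr p < ?m (a *\<^sub>R x + b *\<^sub>R y) powr p" using p by (intro powr_less_mono2) auto
    then show False using le by simp
  qed
  then show ?thesis by (simp add: minkowski_functional_le_1_iff[OF K])
qed

text \<open>A ball around an interior point \<open>z\<close> is combined with \<open>- z\<close>
  using equal coefficients \<open>a\<close>, where \<open>a powr p = 1 / 2\<close>; the centre
  cancels and a ball of radius \<open>a * e\<close> about the origin remains.\<close>

lemma p_convex_contains_ball:
  assumes K: "p_convex p K" and p: "0 < p" and sym: "origin_symmetric K"
  obtains e where "0 < e" "\<And>x. norm x < e \<Longrightarrow> x \<in> K"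
proof -
  obtain z e where z: "0 < e" "ball z e \<subseteq> K"
    using K unfolding p_convex_def body_def by (metis equals0I mem_interior)
  define a :: real where "a = (1 / 2) powr (1 / p)"
  have a: "0 < a" "a powr p = 1 / 2" using p by (auto simp: a_def powr_powr)
  have "z \<in> K" using z by auto
  then have mz: "- z \<in> K" using sym unfolding origin_symmetric_def by (metis imageI)
  have "x \<in> K" if x: "norm x < a * e" for x
  proof -
    have "norm ((1 / a) *\<^sub>R x) < e" using x a by (simp add: pos_divide_less_eq mult.commute)
    then have "z + (1 / a) *\<^sub>R x \<in> K" using z by (auto simp: dist_norm)
    from p_convexD[OF K p this mz, of a a] a
    have "a *\<^sub>R (z + (1 / a) *\<^sub>R x) + a *\<^sub>R (- z) \<in> K" by simp
    then show ?thesis using a by (simp add: algebra_simps)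
  qed
  then show ?thesis using that[of "a * e"] a z by auto
qed

section \<open>Sections of p-convex bodies\<close>

text \<open>\<open>N\<close> turns out to be the Minkowski functional of the set. The upper bound
  \<open>M\<close> makes the set bounded, the lower bound \<open>m\<close> puts a ball into it; no
  continuity of \<open>\<rho>\<close> is assumed.\<close>

lemma p_convex_of_radial_bounds:
  fixes \<rho> :: "'a::euclidean_space \<Rightarrow> real"
  defines "N \<equiv> \<lambda>x. norm x / \<rho> (x /\<^sub>R norm x)"
  assumes q: "0 < q" and m: "0 < m" and \<rho>: "\<And>u. norm u = 1 \<Longrightarrow> m \<le> \<rho> u" "\<And>u. norm u = 1 \<Longrightarrow> \<rho> u \<le> M"
    and tri: "\<And>x y. N (x + y) powr q \<le> N x powr q + N y powr q"
  shows "p_convex q {r *\<^sub>R u |r u. norm u = 1 \<and> 0 \<le> r \<and> r \<le> \<rho> u}" (is "p_convex q ?L")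
proof -
  have unit: "norm (x /\<^sub>R norm x) = 1" if "x \<noteq> 0" for x :: 'a using that by simp
  have \<rho>pos: "0 < \<rho> u" if "norm u = 1" for u using \<rho>(1)[OF that] m by simp
  have N0: "N 0 = 0" by (simp add: N_def)
  have Npos: "0 < N x" if "x \<noteq> 0" for x using that \<rho>pos[OF unit[OF that]] by (simp add: N_def)
  have Nnn: "0 \<le> N x" for x using Npos[of x] N0 by (cases "x = 0") auto
  have Nle: "N x \<le> norm x / m" for x
  proof (cases "x = 0")
    case False
    then show ?thesis using \<rho>(1)[OF unit[OF False]] m by (simp add: N_def frac_le)
  qed (simp add: N0)
  have Nge: "norm x \<le> M * N x" for x
  proof (cases "x = 0")
    case False
    have "norm x = \<rho> (x /\<^sub>R norm x) * N x" using \<rho>pos[OF unit[OF False]] by (simp add: N_def)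
    also have "\<dots> \<le> M * N x" using \<rho>(2)[OF unit[OF False]] Nnn by (intro mult_right_mono) auto
    finally show ?thesis .
  qed (simp add: N0)
  have zero: "0 \<in> ?L"
  proof -
    obtain u :: 'a where "norm u = 1" using vector_choose_size[of 1] by auto
    then show ?thesis using \<rho>pos[of u] by (auto intro!: exI[of _ "0::real"] exI[of _ u])
  qed
  have mem: "x \<in> (\<lambda>y. c *\<^sub>R y) ` ?L \<longleftrightarrow> N x \<le> c" if c: "0 \<le> c" for x c
  proof
    assume "x \<in> (\<lambda>y. c *\<^sub>R y) ` ?L"
    then obtain r u where x: "x = (c * r) *\<^sub>R u" "norm u = 1" "0 \<le> r" "r \<le> \<rho> u" by auto
    show "N x \<le> c"
    proof (cases "c * r = 0")
      case False
      then have cr: "0 < c * r" using c x by (simp add: less_le)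
      have nx: "norm x = c * r" using x cr by simp
      have "x /\<^sub>R norm x = inverse (c * r) *\<^sub>R x" by (simp only: nx)
      also have "\<dots> = u" unfolding x(1) scaleR_scaleR using False by (simp only: left_inverse scaleR_one not_False_eq_True)
      finally have "x /\<^sub>R norm x = u" .
      then have "N x = c * r / \<rho> u" by (simp add: N_def nx)
      also have "\<dots> \<le> c * \<rho> u / \<rho> u"
        using x \<rho>pos[OF x(2)] c by (intro divide_right_mono mult_left_mono) auto
      finally show ?thesis using \<rho>pos[OF x(2)] by simp
    qed (use x c N0 in auto)
  next
    assume le: "N x \<le> c"
    show "x \<in> (\<lambda>y. c *\<^sub>R y) ` ?L"
    proof (cases "x = 0")
      case True
      then show ?thesis using zero by (intro image_eqI[of _ _ 0]) auto
    next
      case False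
      then have c0: "0 < c" using Npos[OF False] le by simp
      have "norm x / c \<le> \<rho> (x /\<^sub>R norm x)"
        using le c0 \<rho>pos[OF unit[OF False]] by (simp add: N_def pos_divide_le_eq mult.commute)
      then have "(norm x / c) *\<^sub>R (x /\<^sub>R norm x) \<in> ?L" using unit[OF False] c0
        by (intro CollectI exI[of _ "norm x / c"] exI[of _ "x /\<^sub>R norm x"]) auto
      moreover have "x = c *\<^sub>R ((norm x / c) *\<^sub>R (x /\<^sub>R norm x))" using c0 False by simp
      ultimately show ?thesis by blast
    qed
  qed
  have L: "?L = {x. N x \<le> 1}" using mem[of 1] by auto
  have mink: "minkowski_functional ?L x = N x" for x
  proof -
    have "{c. 0 \<le> c \<and> x \<in> (\<lambda>y. c *\<^sub>R y) ` ?L} = {c. 0 \<le> c \<and> N x \<le> c}"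
      by (intro Collect_cong conj_cong refl mem)
    also have "\<dots> = {N x..}" using Nnn[of x] by auto
    finally have "{c. 0 \<le> c \<and> x \<in> (\<lambda>y. c *\<^sub>R y) ` ?L} = {N x..}" .
    then show ?thesis by (simp add: minkowski_functional_def)
  qed
  have "closed ?L"
    unfolding L closed_sequential_limits
  proof (intro allI impI, elim conjE)
    fix X x assume X: "\<forall>n. X n \<in> {x. N x \<le> 1}" and lim: "X \<longlonglongrightarrow> x"
    have "(\<lambda>n. 1 + (norm (x - X n) / m) powr q) \<longlonglongrightarrow> 1 + (norm (x - x) / m) powr q"
      using lim q m by (intro tendsto_intros tendsto_powr' ) (auto intro!: tendsto_intros)
    then have "(\<lambda>n. 1 + (norm (x - X n) / m) powr q) \<longlonglongrightarrow> 1" by simp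
    moreover have "N x powr q \<le> 1 + (norm (x - X n) / m) powr q" for n
    proof -
      have "N x powr q \<le> N (X n) powr q + N (x - X n) powr q" using tri[of "X n" "x - X n"] by simp
      also have "\<dots> \<le> 1 powr q + (norm (x - X n) / m) powr q"
        using X Nle[of "x - X n"] q by (intro add_mono powr_mono2 Nnn) auto
      finally show ?thesis by simp
    qed
    ultimately have le: "N x powr q \<le> 1" by (intro LIMSEQ_le_const) auto
    have "N x \<le> 1"
    proof (rule ccontr)
      assume "\<not> N x \<le> 1"
      then have "1 powr q < N x powr q" using q by (intro powr_less_mono2) auto
      with le show False by simp
    qed
    then show "x \<in> {x. N x \<le> 1}" by simp
  qed
  moreover have "bounded ?L"
  proof (rule boundedI)
    fix x assume "x \<in> ?L"
    then obtain r u where "x = r *\<^sub>R u" "norm u = 1" "0 \<le> r" "r \<le> \<rho> u" by auto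
    then show "norm x \<le> M" using \<rho>(2)[of u] by simp
  qed
  moreover have "0 \<in> interior ?L"
  proof -
    have "ball 0 m \<subseteq> ?L"
    proof
      fix x :: 'a assume "x \<in> ball 0 m"
      then have "norm x / m \<le> 1" using m by simp
      with Nle[of x] show "x \<in> ?L" unfolding L by simp
    qed
    then show ?thesis using m by (auto simp: mem_interior)
  qed
  moreover have "closed_segment 0 x \<subseteq> ?L" if x: "x \<in> ?L" for x
  proof
    fix y assume "y \<in> closed_segment 0 x"
    then obtain s where s: "0 \<le> s" "s \<le> 1" "y = s *\<^sub>R x" by (auto simp: in_segment)
    obtain r u where r: "x = r *\<^sub>R u" "norm u = 1" "0 \<le> r" "r \<le> \<rho> u" using x by auto
    have "s * r \<le> r" using s r by (simp add: mult_left_le_one_le)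
    then show "y \<in> ?L" using s r by (intro CollectI exI[of _ "s * r"] exI[of _ u]) auto
  qed
  moreover have "\<exists>c\<ge>0. x \<in> (\<lambda>y. c *\<^sub>R y) ` ?L" for x
    using mem[OF Nnn, of x x] Nnn[of x] by blast
  ultimately show ?thesis
    unfolding p_convex_def body_def origin_star_shaped_def mink
    using zero tri by (auto simp: compact_eq_bounded_closed)
qed

lemma closed_hyperplane_0: "closed {x::'a::euclidean_space. x \<bullet> u = 0}"
  using closed_hyperplane[of u 0] by (simp add: inner_commute)

section \<open>Fibre and ray integrals of the truncated density\<close>

context
  fixes f :: "'a::euclidean_space \<Rightarrow> real" and K :: "'a set" and p c \<epsilon> R :: real
  assumes f_meas [measurable]: "f \<in> borel_measurable borel"
    and f: "log_concave_function f" and f_max: "\<And>x. f x \<le> f 0"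
    and c: "0 < c" and f_reflect: "\<And>x l. 0 < l \<Longrightarrow> l < 1 \<Longrightarrow> (c / f 0) powr (1 - l) * f x \<le> f (- (l *\<^sub>R x))"
    and \<epsilon>: "0 < \<epsilon>" and f_low: "\<And>x. norm x \<le> \<epsilon> \<Longrightarrow> c \<le> f x" and K_low: "\<And>x. norm x \<le> \<epsilon> \<Longrightarrow> x \<in> K"
    and p: "0 < p" "p \<le> 1" and K: "p_convex p K" and K_sym: "origin_symmetric K"
    and R: "0 < R" and K_bound: "\<And>x. x \<in> K \<Longrightarrow> norm x \<le> R"
begin

definition trunc_density :: "'a \<Rightarrow> ennreal" where
  "trunc_density x = ennreal (f x) * indicator K x"

text \<open>This is \<open>J\<close>, with \<open>B\<close> in the role of a basis of
  \<open>F\<close>; \<open>e\<close> is left arbitrary.\<close>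

definition fibre_integral :: "'a set \<Rightarrow> 'a \<Rightarrow> ennreal" where
  "fibre_integral B e = (\<integral>\<^sup>+x. trunc_density (e + x) \<partial>frame_measure B)"

lemma f_pos: "0 < f 0"
  using f_low[of 0] c \<epsilon> by simp

lemma K_borel [measurable]: "K \<in> sets borel"
  using K by (auto simp: p_convex_def body_def intro: borel_compact)

lemma trunc_density_measurable [measurable]: "trunc_density \<in> borel_measurable borel"
  unfolding trunc_density_def[abs_def] by measurable

lemma trunc_density_le: "trunc_density x \<le> ennreal (f 0) * indicator (cball 0 R) x"
  using f_max[of x] K_bound[of x] by (auto simp: trunc_density_def indicator_def intro: ennreal_leI)

lemma trunc_density_ge: "ennreal c * indicator (cball 0 \<epsilon>) x \<le> trunc_density x"
  using f_low[of x] K_low[of x] by (auto simp: trunc_density_def indicator_def intro: ennreal_leI)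

lemma trunc_density_star:
  assumes l: "0 < l" "l \<le> 1"
  shows "trunc_density x \<le> trunc_density (l *\<^sub>R x)"
proof (cases "x \<in> K")
  case True
  then have "l *\<^sub>R x \<in> K" using K l by (intro origin_star_shapedD) (auto simp: p_convex_def)
  then show ?thesis using True log_concave_function_star[OF f f_max l, of x]
    by (simp add: trunc_density_def ennreal_leI)
qed (simp add: trunc_density_def)

lemma trunc_density_reflect:
  assumes l: "0 < l" "l < 1"
  shows "ennreal ((c / f 0) powr (1 - l)) * trunc_density x \<le> trunc_density (- (l *\<^sub>R x))"
proof (cases "x \<in> K")
  case True
  then have "l *\<^sub>R x \<in> K" using K l by (intro origin_star_shapedD) (auto simp: p_convex_def)
  then have "- (l *\<^sub>R x) \<in> K" using K_sym unfolding origin_symmetric_def by (metis imageI)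
  then show ?thesis using True f_reflect[OF l, of x] log_concave_function_nonneg[OF f, of x]
    by (simp add: trunc_density_def ennreal_leI flip: ennreal_mult)
qed (simp add: trunc_density_def)

text \<open>The coefficient \<open>a = t powr (1 / p)\<close> satisfies \<open>a \<le> t\<close>
  because \<open>p \<le> 1\<close>. So \<open>a *\<^sub>R x\<close> is \<open>t\<close> times the
  shrunken point \<open>(a / t) *\<^sub>R x\<close>, where \<open>f\<close> is at least
  \<open>f x\<close>; log-concavity with weights \<open>t\<close> and \<open>1 - t\<close> then
  applies.\<close>

lemma trunc_density_p_concave:
  assumes t: "0 < t" "t < 1"
  shows "ennreal_powr (trunc_density x) t * ennreal_powr (trunc_density y) (1 - t)
    \<le> trunc_density (t powr (1 / p) *\<^sub>R x + (1 - t) powr (1 / p) *\<^sub>R y)"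
proof (cases "x \<in> K \<and> y \<in> K")
  case True
  define a where "a = t powr (1 / p)"
  define b where "b = (1 - t) powr (1 / p)"
  have small: "s powr (1 / p) \<le> s" "0 < s powr (1 / p)" if "0 < s" "s < 1" for s
  proof -
    have "s powr (1 / p) \<le> s powr 1" using that p by (intro powr_mono') auto
    then show "s powr (1 / p) \<le> s" "0 < s powr (1 / p)" using that by auto
  qed
  have ab: "0 < a" "a \<le> t" "0 < b" "b \<le> 1 - t" using small[of t] small[of "1 - t"] t by (auto simp: a_def b_def)
  have "a powr p + b powr p = 1" using t p by (simp add: a_def b_def powr_powr)
  then have mem: "a *\<^sub>R x + b *\<^sub>R y \<in> K" using True ab by (intro p_convexD[OF K p(1)]) auto
  have "f x powr t * f y powr (1 - t) \<le> f (t *\<^sub>R ((a / t) *\<^sub>R x) + (1 - t) *\<^sub>R ((b / (1 - t)) *\<^sub>R y))"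
    using t ab log_concave_function_nonneg[OF f]
    by (intro log_concave_function_ge[OF f] log_concave_function_star[OF f f_max]) auto
  also have "t *\<^sub>R ((a / t) *\<^sub>R x) + (1 - t) *\<^sub>R ((b / (1 - t)) *\<^sub>R y) = a *\<^sub>R x + b *\<^sub>R y" using t by simp
  finally have "ennreal (f x powr t * f y powr (1 - t)) \<le> ennreal (f (a *\<^sub>R x + b *\<^sub>R y))" by (rule ennreal_leI)
  then show ?thesis using True mem log_concave_function_nonneg[OF f]
    by (simp add: trunc_density_def ennreal_powr_ennreal ennreal_mult flip: a_def b_def)
qed (auto simp: trunc_density_def)

lemma emeasure_section_eq:
  assumes B: "orthonormal B" "span B = {x. x \<bullet> u = 0}"
  shows "emeasure (section_measure f {x. x \<bullet> u = 0}) (K \<inter> {x. x \<bullet> u = 0}) = (\<integral>\<^sup>+x. trunc_density x \<partial>frame_measure B)"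
proof -
  have [measurable]: "{x. x \<bullet> u = 0} \<in> sets borel" by (rule borel_closed[OF closed_hyperplane_0])
  have "emeasure (section_measure f {x. x \<bullet> u = 0}) (K \<inter> {x. x \<bullet> u = 0})
      = (\<integral>\<^sup>+x. ennreal (f x) * indicator (K \<inter> {x. x \<bullet> u = 0}) x \<partial>frame_measure B)"
    unfolding section_measure_def subspace_lborel_eq_frame_measure[OF B]
    by (subst emeasure_density) auto
  also have "\<dots> = (\<integral>\<^sup>+x. trunc_density x \<partial>frame_measure B)"
    by (rule nn_integral_frame_measure_cong) (auto simp: trunc_density_def B(2) indicator_def)
  finally show ?thesis .
qed

lemma nn_integral_trunc_density_le:
  assumes B: "orthonormal B"
  shows "(\<integral>\<^sup>+x. trunc_density x \<partial>frame_measure B) \<le> ennreal (f 0 * (2 * R) ^ card B)"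
proof -
  have "(\<integral>\<^sup>+x. trunc_density x \<partial>frame_measure B) \<le> (\<integral>\<^sup>+x. ennreal (f 0) * indicator (cball 0 R) x \<partial>frame_measure B)"
    by (intro nn_integral_mono trunc_density_le)
  also have "\<dots> = ennreal (f 0) * emeasure (frame_measure B) (cball 0 R)"
    by (subst nn_integral_cmult_indicator) auto
  also have "\<dots> \<le> ennreal (f 0) * ennreal ((2 * R) ^ card B)"
    using R by (intro mult_left_mono emeasure_frame_measure_cball_le B) auto
  finally show ?thesis using f_pos R by (simp add: ennreal_mult)
qed

lemma nn_integral_trunc_density_ge:
  assumes B: "orthonormal B"
  shows "ennreal (c * (2 * \<epsilon> / (real (card B) + 1)) ^ card B) \<le> (\<integral>\<^sup>+x. trunc_density x \<partial>frame_measure B)"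
proof -
  have "real (card B) \<le> (real (card B) + 1)\<^sup>2" by (simp add: power2_eq_square algebra_simps)
  then have "ennreal c * ennreal ((2 * \<epsilon> / (real (card B) + 1)) ^ card B)
      \<le> ennreal c * emeasure (frame_measure B) (cball 0 \<epsilon>)"
    using \<epsilon> by (intro mult_left_mono emeasure_frame_measure_cball_ge B) auto
  also have "\<dots> = (\<integral>\<^sup>+x. ennreal c * indicator (cball 0 \<epsilon>) x \<partial>frame_measure B)"
    by (subst nn_integral_cmult_indicator) auto
  also have "\<dots> \<le> (\<integral>\<^sup>+x. trunc_density x \<partial>frame_measure B)"
    by (intro nn_integral_mono trunc_density_ge)
  finally show ?thesis using c \<epsilon> by (simp add: ennreal_mult)
qed

lemma fibre_integral_measurable:
  assumes B: "finite B"
  shows "fibre_integral B \<in> borel_measurable borel"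
proof -
  interpret P: sigma_finite_measure "\<Pi>\<^sub>M b\<in>B. (lborel :: real measure)" by (rule lborel_product.sigma_finite[OF B])
  have "fibre_integral B = (\<lambda>e. \<integral>\<^sup>+g. trunc_density (e + (\<Sum>b\<in>B. g b *\<^sub>R b)) \<partial>(\<Pi>\<^sub>M b\<in>B. lborel))"
    unfolding fibre_integral_def[abs_def] by (subst nn_integral_frame_measure) auto
  also have "\<dots> \<in> borel_measurable borel" by measurable
  finally show ?thesis .
qed

lemma fibre_integral_le:
  assumes B: "orthonormal B" and e: "\<And>b. b \<in> B \<Longrightarrow> e \<bullet> b = 0"
  shows "fibre_integral B e \<le> ennreal (f 0 * (2 * R) ^ card B)"
    and "R < norm e \<Longrightarrow> fibre_integral B e = 0"
proof -
  have ge: "norm x \<le> norm (e + x)" "norm e \<le> norm (e + x)" if x: "x \<in> span B" for x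
  proof -
    have "orthogonal e x" using x
      by (induction rule: span_induct_alt) (auto simp: orthogonal_def inner_add_right e)
    then have "(norm (e + x))\<^sup>2 = (norm e)\<^sup>2 + (norm x)\<^sup>2" by (rule norm_add_Pythagorean)
    then have "(norm x)\<^sup>2 \<le> (norm (e + x))\<^sup>2" "(norm e)\<^sup>2 \<le> (norm (e + x))\<^sup>2" by auto
    then show "norm x \<le> norm (e + x)" "norm e \<le> norm (e + x)" by (auto intro: power2_le_imp_le)
  qed
  have "fibre_integral B e \<le> (\<integral>\<^sup>+x. ennreal (f 0) * indicator (cball 0 R) x \<partial>frame_measure B)"
    unfolding fibre_integral_def
  proof (rule nn_integral_frame_measure_mono)
    fix x assume "x \<in> span B"
    then show "trunc_density (e + x) \<le> ennreal (f 0) * indicator (cball 0 R) x"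
      using order_trans[OF trunc_density_le[of "e + x"]] ge(1)[of x] by (auto simp: indicator_def)
  qed measurable
  also have "\<dots> = ennreal (f 0) * emeasure (frame_measure B) (cball 0 R)"
    by (subst nn_integral_cmult_indicator) auto
  also have "\<dots> \<le> ennreal (f 0) * ennreal ((2 * R) ^ card B)"
    using R by (intro mult_left_mono emeasure_frame_measure_cball_le B) auto
  finally show "fibre_integral B e \<le> ennreal (f 0 * (2 * R) ^ card B)" using f_pos R by (simp add: ennreal_mult)
  assume e: "R < norm e"
  have "fibre_integral B e = (\<integral>\<^sup>+x. 0 \<partial>frame_measure B)"
    unfolding fibre_integral_def
  proof (rule nn_integral_frame_measure_cong)
    fix x assume "x \<in> span B"
    then have "e + x \<notin> K" using ge(2)[of x] e K_bound[of "e + x"] by auto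
    then show "trunc_density (e + x) = 0" by (simp add: trunc_density_def)
  qed measurable
  then show "fibre_integral B e = 0" by simp
qed

lemma fibre_integral_dilate:
  assumes B: "finite B" and l: "l \<noteq> 0"
  shows "fibre_integral B (l *\<^sub>R e) = ennreal (\<bar>l\<bar> ^ card B) * (\<integral>\<^sup>+x. trunc_density (l *\<^sub>R (e + x)) \<partial>frame_measure B)"
  unfolding fibre_integral_def
  by (subst nn_integral_frame_measure_affine[OF _ B span_zero l]) (simp_all add: scaleR_add_right)

text \<open>Shrinking \<open>e\<close> and the fibre together does not decrease the integrand; the
  power of \<open>l\<close> is the Jacobian on the fibre. This is the growth condition behind the
  approximate quantiles.\<close>

lemma fibre_integral_star:
  assumes B: "finite B" and l: "0 < l" "l \<le> 1"
  shows "ennreal (l ^ card B) * fibre_integral B e \<le> fibre_integral B (l *\<^sub>R e)"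
proof -
  have "ennreal (l ^ card B) * fibre_integral B e
     \<le> ennreal (l ^ card B) * (\<integral>\<^sup>+x. trunc_density (l *\<^sub>R (e + x)) \<partial>frame_measure B)"
    unfolding fibre_integral_def by (intro mult_left_mono nn_integral_mono trunc_density_star l) auto
  then show ?thesis using l fibre_integral_dilate[OF B, of l e] by simp
qed

lemma fibre_integral_reflect:
  assumes B: "finite B" and l: "0 < l" "l < 1"
  shows "ennreal (l ^ card B * (c / f 0) powr (1 - l)) * fibre_integral B e \<le> fibre_integral B (- (l *\<^sub>R e))"
proof -
  have "ennreal (l ^ card B * (c / f 0) powr (1 - l)) * fibre_integral B e
     = ennreal (l ^ card B) * (\<integral>\<^sup>+x. ennreal ((c / f 0) powr (1 - l)) * trunc_density (e + x) \<partial>frame_measure B)"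
    unfolding fibre_integral_def using l by (subst nn_integral_cmult) (auto simp: ennreal_mult mult.assoc)
  also have "\<dots> \<le> ennreal (l ^ card B) * (\<integral>\<^sup>+x. trunc_density (- (l *\<^sub>R (e + x))) \<partial>frame_measure B)"
    by (intro mult_left_mono nn_integral_mono trunc_density_reflect l) auto
  also have "\<dots> = fibre_integral B (- (l *\<^sub>R e))"
    using l fibre_integral_dilate[OF B, of "- l" e] by simp
  finally show ?thesis .
qed

text \<open>Fibre variables are rescaled by \<open>t powr (1 - 1 / p)\<close> and
  \<open>(1 - t) powr (1 - 1 / p)\<close>, so that the coefficients \<open>t powr (1 / p)\<close>
  and \<open>(1 - t) powr (1 / p)\<close> become \<open>t\<close> and \<open>1 - t\<close>, as
  Prekopa--Leindler requires. The powers with exponent \<open>\<kappa>\<close> are the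
  Jacobians.\<close>

lemma fibre_integral_p_concave:
  assumes B: "finite B" and t: "0 < t" "t < 1"
  defines "\<kappa> \<equiv> (1 / p - 1) * real (card B)"
  shows "ennreal_powr (ennreal (t powr \<kappa>) * fibre_integral B e1) t
      * ennreal_powr (ennreal ((1 - t) powr \<kappa>) * fibre_integral B e2) (1 - t)
    \<le> fibre_integral B (t powr (1 / p) *\<^sub>R e1 + (1 - t) powr (1 / p) *\<^sub>R e2)"
proof -
  have scale: "(\<integral>\<^sup>+x. trunc_density (e + s powr (1 - 1 / p) *\<^sub>R x) \<partial>frame_measure B)
      = ennreal (s powr \<kappa>) * fibre_integral B e" if "0 < s" for s e
  proof -
    have "fibre_integral B e = ennreal ((s powr (1 - 1 / p)) ^ card B) *
        (\<integral>\<^sup>+x. trunc_density (e + s powr (1 - 1 / p) *\<^sub>R x) \<partial>frame_measure B)"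
      unfolding fibre_integral_def using that
      by (subst nn_integral_frame_measure_affine[OF _ B span_zero, of _ "s powr (1 - 1 / p)"]) auto
    also have "(s powr (1 - 1 / p)) ^ card B = s powr (- \<kappa>)"
      using that by (simp add: \<kappa>_def powr_powr algebra_simps flip: powr_realpow)
    finally show ?thesis using that by (simp flip: mult.assoc ennreal_mult powr_add)
  qed
  have "ennreal_powr (\<integral>\<^sup>+x. trunc_density (e1 + t powr (1 - 1 / p) *\<^sub>R x) \<partial>frame_measure B) t
      * ennreal_powr (\<integral>\<^sup>+x. trunc_density (e2 + (1 - t) powr (1 - 1 / p) *\<^sub>R x) \<partial>frame_measure B) (1 - t)
    \<le> (\<integral>\<^sup>+x. trunc_density ((t powr (1 / p) *\<^sub>R e1 + (1 - t) powr (1 / p) *\<^sub>R e2) + x) \<partial>frame_measure B)"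
  proof (rule prekopa_leindler_frame_measure[OF _ _ _ B t])
    fix x y
    have cancel: "s powr (1 / p) * s powr (1 - 1 / p) = s" if "0 < s" for s :: real
      using that by (simp flip: powr_add)
    have "t powr (1 / p) *\<^sub>R (e1 + t powr (1 - 1 / p) *\<^sub>R x) + (1 - t) powr (1 / p) *\<^sub>R (e2 + (1 - t) powr (1 - 1 / p) *\<^sub>R y)
      = t powr (1 / p) *\<^sub>R e1 + (1 - t) powr (1 / p) *\<^sub>R e2 + (t *\<^sub>R x + (1 - t) *\<^sub>R y)"
      using t by (simp add: scaleR_add_right cancel)
    then show "ennreal_powr (trunc_density (e1 + t powr (1 - 1 / p) *\<^sub>R x)) t
        * ennreal_powr (trunc_density (e2 + (1 - t) powr (1 - 1 / p) *\<^sub>R y)) (1 - t)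
      \<le> trunc_density (t powr (1 / p) *\<^sub>R e1 + (1 - t) powr (1 / p) *\<^sub>R e2 + (t *\<^sub>R x + (1 - t) *\<^sub>R y))"
      using trunc_density_p_concave[OF t] by metis
  qed measurable
  then show ?thesis using t by (simp add: scale flip: fibre_integral_def)
qed

text \<open>This is \<open>\<Phi>\<close>; its homogeneity of degree -1 makes the reciprocal a
  candidate for a norm.\<close>

definition ray_integral :: "'a set \<Rightarrow> 'a \<Rightarrow> ennreal" where
  "ray_integral B w = (\<integral>\<^sup>+r. fibre_integral B (r *\<^sub>R w) * indicator {0<..} r \<partial>lborel)"

lemma ray_integral_scaleR:
  assumes B: "finite B" and a: "0 < a"
  shows "ray_integral B w = ennreal a * ray_integral B (a *\<^sub>R w)"
proof -
  note [measurable] = fibre_integral_measurable[OF B]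
  have "ray_integral B w = ennreal \<bar>a\<bar> * (\<integral>\<^sup>+r. fibre_integral B ((0 + a * r) *\<^sub>R w) * indicator {0<..} (0 + a * r) \<partial>lborel)"
    unfolding ray_integral_def using a by (intro nn_integral_real_affine) auto
  also have "(\<lambda>r. indicator {0<..} (0 + a * r) :: ennreal) = indicator {0<..}"
    using a by (auto simp: fun_eq_iff indicator_def zero_less_mult_iff)
  finally show ?thesis using a by (simp add: ray_integral_def mult.commute)
qed

text \<open>The reflection bound along the ray has the factor \<open>C l\<close>, which includes the
  change of variable by \<open>l\<close> and tends to 1 as \<open>l\<close> tends to 1. In the limit
  opposite rays are compared exactly, although \<open>f\<close> need not be even on them.\<close>

lemma ray_integral_uminus_ge:
  assumes B: "finite B"
  shows "ray_integral B w \<le> ray_integral B (- w)"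
proof -
  note [measurable] = fibre_integral_measurable[OF B]
  define C where "C l = l * (l ^ card B * (c / f 0) powr (1 - l))" for l
  have le: "ennreal (C l) * ray_integral B w \<le> ray_integral B (- w)" if l: "0 < l" "l < 1" for l
  proof -
    have "ennreal (C l) * ray_integral B w = ennreal l * (\<integral>\<^sup>+r. (ennreal (l ^ card B * (c / f 0) powr (1 - l)) *
        fibre_integral B (r *\<^sub>R w)) * indicator {0<..} r \<partial>lborel)"
      using l unfolding ray_integral_def C_def
      by (subst nn_integral_cmult[symmetric], simp, subst nn_integral_cmult[symmetric], simp)
         (auto intro!: nn_integral_cong simp: ennreal_mult mult_ac)
    also have "\<dots> \<le> ennreal l * (\<integral>\<^sup>+r. fibre_integral B (- (l *\<^sub>R (r *\<^sub>R w))) * indicator {0<..} r \<partial>lborel)"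
      by (intro mult_left_mono nn_integral_mono mult_right_mono fibre_integral_reflect[OF B l]) auto
    also have "\<dots> = ennreal l * ray_integral B (l *\<^sub>R (- w))"
      by (simp add: ray_integral_def mult.commute)
    also have "\<dots> = ray_integral B (- w)" by (rule ray_integral_scaleR[OF B l(1), symmetric])
    finally show ?thesis .
  qed
  have cf: "0 < c / f 0" using c f_pos by simp
  have "((\<lambda>l. C l) \<longlongrightarrow> 1 * (1 ^ card B * (c / f 0) powr (1 - 1))) (at_left 1)"
    unfolding C_def using cf by (intro tendsto_intros) auto
  then have "((\<lambda>l. C l) \<longlongrightarrow> 1) (at_left 1)" using c f_pos by simp
  then have "((\<lambda>l. ennreal (C l)) \<longlongrightarrow> ennreal 1) (at_left 1)" by (rule tendsto_ennrealI)
  then have "((\<lambda>l. ennreal (C l) * ray_integral B w) \<longlongrightarrow> ennreal 1 * ray_integral B w) (at_left 1)"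
    by (intro tendsto_mult_ennreal tendsto_const) auto
  then have "((\<lambda>l. ennreal (C l) * ray_integral B w) \<longlongrightarrow> ray_integral B w) (at_left 1)" by simp
  then show ?thesis
  proof (rule tendsto_upperbound)
    show "eventually (\<lambda>l. ennreal (C l) * ray_integral B w \<le> ray_integral B (- w)) (at_left 1)"
      using eventually_at_left_real[of 0 1] le by (auto elim: eventually_mono)
  qed simp
qed

lemma ray_integral_uminus: "finite B \<Longrightarrow> ray_integral B (- w) = ray_integral B w"
  using ray_integral_uminus_ge[of B w] ray_integral_uminus_ge[of B "- w"] by simp

abbreviation section_mass :: "'a \<Rightarrow> ennreal" where
  "section_mass u \<equiv> emeasure (section_measure f {x. x \<bullet> u = 0}) (K \<inter> {x. x \<bullet> u = 0})"

lemma section_mass_bounds: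
  assumes u: "norm u = 1"
  defines "d \<equiv> DIM('a) - 1"
  shows "ennreal (c * (2 * \<epsilon> / (real d + 1)) ^ d) \<le> section_mass u" 
    and "section_mass u \<le> ennreal (f 0 * (2 * R) ^ d)"
proof -
  have S: "subspace {x. x \<bullet> u = 0}" using subspace_hyperplane[of u] by (simp add: inner_commute)
  obtain B where "orthonormal_basis_of {x. x \<bullet> u = 0} B" using orthonormal_basis_of_exists[OF S] by blast
  then have B: "orthonormal B" "span B = {x. x \<bullet> u = 0}" by (auto simp: orthonormal_basis_of_def orthonormal_def)
  have "u \<noteq> 0" using u by auto
  then have "dim {x. x \<bullet> u = 0} = d" unfolding d_def using dim_hyperplane[of u] by (simp add: inner_commute)
  then have d: "card B = d"
    using B dim_eq_card_independent[OF orthonormal_independent[OF B(1)]] by (metis dim_span)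
  show "ennreal (c * (2 * \<epsilon> / (real d + 1)) ^ d) \<le> section_mass u" "section_mass u \<le> ennreal (f 0 * (2 * R) ^ d)"
    unfolding emeasure_section_eq[OF B]
    using nn_integral_trunc_density_ge[OF B(1)] nn_integral_trunc_density_le[OF B(1)] by (simp_all add: d)
qed

text \<open>By dimension count \<open>insert w B\<close> is an orthonormal basis of the hyperplane
  orthogonal to \<open>u\<close>. Integration along \<open>w\<close> splits into two opposite rays
  of equal mass, hence the factor 2.\<close>

lemma section_mass_eq_ray_integral:
  assumes B: "orthonormal B" "card B + 2 = DIM('a)" "\<And>b. b \<in> B \<Longrightarrow> b \<bullet> u = 0" "\<And>b. b \<in> B \<Longrightarrow> b \<bullet> w = 0"
    and uw: "norm u = 1" "norm w = 1" "w \<bullet> u = 0"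
  shows "section_mass u = 2 * ray_integral B w"
proof -
  have fin: "finite B" using orthonormal_finite[OF B(1)] .
  note [measurable] = fibre_integral_measurable[OF fin]
  have wB: "w \<notin> B" using B(4)[of w] uw(2) by (auto simp: dot_square_norm)
  have on: "orthonormal (insert w B)"
    using B(1) B(4) uw(2) unfolding orthonormal_def
    by (auto simp: pairwise_insert orthogonal_def inner_commute)
  have S: "subspace {x. x \<bullet> u = 0}" using subspace_hyperplane[of u] by (simp add: inner_commute)
  have "u \<noteq> 0" using uw(1) by auto
  then have "dim {x. x \<bullet> u = 0} = DIM('a) - 1" using dim_hyperplane[of u] by (simp add: inner_commute)
  moreover have "dim (span (insert w B)) = card (insert w B)"
    using dim_eq_card_independent[OF orthonormal_independent[OF on]] by simp
  moreover have "card (insert w B) = DIM('a) - 1" using wB fin B(2) by simp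
  moreover have "span (insert w B) \<subseteq> {x. x \<bullet> u = 0}"
    using B(3) uw(3) by (intro span_minimal[OF _ S]) auto
  ultimately have sp: "span (insert w B) = {x. x \<bullet> u = 0}"
    by (intro subspace_dim_equal subspace_span S) simp_all
  have "section_mass u = (\<integral>\<^sup>+r. fibre_integral B (r *\<^sub>R w) \<partial>lborel)"
    unfolding emeasure_section_eq[OF on sp] fibre_integral_def
    by (rule nn_integral_frame_measure_insert[OF _ fin wB]) measurable
  also have "\<dots> = (\<integral>\<^sup>+r. fibre_integral B (r *\<^sub>R w) * indicator {0<..} r + fibre_integral B (r *\<^sub>R w) * indicator {..<0} r \<partial>lborel)"
  proof (rule nn_integral_cong_AE)
    have "AE r in lborel. r \<noteq> (0::real)" by (rule AE_lborel_singleton)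
    then show "AE r in lborel. fibre_integral B (r *\<^sub>R w)
        = fibre_integral B (r *\<^sub>R w) * indicator {0<..} r + fibre_integral B (r *\<^sub>R w) * indicator {..<0} r"
      by eventually_elim (auto simp: indicator_def)
  qed
  also have "\<dots> = ray_integral B w + (\<integral>\<^sup>+r. fibre_integral B (r *\<^sub>R w) * indicator {..<0} r \<partial>lborel)"
    unfolding ray_integral_def by (subst nn_integral_add) auto
  also have "(\<integral>\<^sup>+r. fibre_integral B (r *\<^sub>R w) * indicator {..<0} r \<partial>lborel)
     = ennreal \<bar>- 1\<bar> * (\<integral>\<^sup>+r. fibre_integral B ((0 + (- 1) * r) *\<^sub>R w) * indicator {..<0} (0 + (- 1) * r) \<partial>lborel)"
    by (intro nn_integral_real_affine) auto
  also have "\<dots> = ray_integral B (- w)"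
    unfolding ray_integral_def by (auto intro!: nn_integral_cong simp: indicator_def)
  finally show ?thesis using ray_integral_uminus[OF fin, of w] by (simp add: mult_2)
qed

text \<open>Transport applied to the profiles of \<open>J\<close> along the three rays.
  Orthogonality to \<open>B\<close> bounds the fibre integrals, so passing to real values by
  \<open>enn2real\<close> loses nothing.\<close>

lemma ray_integral_q_concave:
  assumes B: "orthonormal B" and w: "w1 \<noteq> 0" "w2 \<noteq> 0" "w1 + w2 \<noteq> 0"
    and wB: "\<And>b. b \<in> B \<Longrightarrow> w1 \<bullet> b = 0" "\<And>b. b \<in> B \<Longrightarrow> w2 \<bullet> b = 0"
    and \<phi>: "ray_integral B w1 = ennreal \<phi>1" "0 < \<phi>1" "ray_integral B w2 = ennreal \<phi>2" "0 < \<phi>2"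
    and q: "q = 1 / ((1 / p - 1) * real (card B) + 1 / p)"
  shows "ennreal ((\<phi>1 powr - q + \<phi>2 powr - q) powr (- 1 / q)) \<le> ray_integral B (w1 + w2)"
proof -
  have fin: "finite B" using orthonormal_finite[OF B] .
  note [measurable] = fibre_integral_measurable[OF fin]
  define H where "H w r = enn2real (fibre_integral B (r *\<^sub>R w))" for w r
  have Hm [measurable]: "H w \<in> borel_measurable borel" for w unfolding H_def[abs_def] by measurable
  have HJ: "ennreal (H w r) = fibre_integral B (r *\<^sub>R w)" if "\<And>b. b \<in> B \<Longrightarrow> w \<bullet> b = 0" for w r
  proof -
    have "fibre_integral B (r *\<^sub>R w) \<le> ennreal (f 0 * (2 * R) ^ card B)"
      using that by (intro fibre_integral_le[OF B]) auto
    also have "\<dots> < top" by simp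
    finally show ?thesis unfolding H_def by (intro ennreal_enn2real) auto
  qed
  have Hnn: "0 \<le> H w r" for w r by (simp add: H_def)
  have quant: "\<exists>r r'. (\<forall>u\<in>{0<..<1}. 0 < r u \<and> (r has_real_derivative r' u) (at u) \<and> 0 < r' u \<and> \<eta> * \<phi> \<le> r' u * H w (r u))
      \<and> continuous_on {0<..<1} r'"
    if \<eta>: "0 < \<eta>" "\<eta> < 1" and w: "w \<noteq> 0" "\<And>b. b \<in> B \<Longrightarrow> w \<bullet> b = 0"
      and \<phi>: "ray_integral B w = ennreal \<phi>" "0 < \<phi>" for \<eta> \<phi> w
  proof (rule approximate_quantile[where d = "card B" and R = "R / norm w", OF _ _ _ _ _ \<phi>(2) \<eta>])
    show "a ^ card B * H w x \<le> H w (a * x)" if "0 < x" "0 < a" "a \<le> 1" for x a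
    proof -
      have "ennreal (a ^ card B * H w x) = ennreal (a ^ card B) * fibre_integral B (x *\<^sub>R w)"
        using that by (simp add: ennreal_mult Hnn HJ w)
      also have "\<dots> \<le> fibre_integral B (a *\<^sub>R (x *\<^sub>R w))" by (rule fibre_integral_star[OF fin that(2,3)])
      also have "\<dots> = ennreal (H w (a * x))" by (simp add: HJ w)
      finally show ?thesis using Hnn by (simp add: ennreal_le_iff)
    qed
    show "H w x = 0" if "R / norm w < x" for x
    proof -
      have "0 < x" using that R w by (meson divide_pos_pos less_trans zero_less_norm_iff)
      then have "R < norm (x *\<^sub>R w)" using that w by (simp add: pos_divide_less_eq)
      then have "fibre_integral B (x *\<^sub>R w) = 0" using w by (intro fibre_integral_le(2)[OF B]) auto
      then show ?thesis by (simp add: H_def)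
    qed
    show "(\<integral>\<^sup>+x. ennreal (H w x) * indicator {0<..} x \<partial>lborel) = ennreal \<phi>"
      using \<phi>(1) by (simp add: HJ w ray_integral_def)
  qed (use Hnn in auto)
  have w3B: "(w1 + w2) \<bullet> b = 0" if "b \<in> B" for b using wB that by (simp add: inner_add_left)
  have "ennreal ((\<phi>1 powr - q + \<phi>2 powr - q) powr (- 1 / q)) \<le> (\<integral>\<^sup>+x. ennreal (H (w1 + w2) x) * indicator {0<..} x \<partial>lborel)"
  proof (rule transport_inequality[where ?H1.0 = "H w1" and ?H2.0 = "H w2" and c = "(1 / p - 1) * real (card B)"])
    fix x y t s :: real
    assume xy: "0 < x" "0 < y" and s: "s = x powr - p + y powr - p" and t: "t = x powr - p / s"
    have s0: "0 < s" unfolding s using xy by (intro add_pos_pos) auto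
    have t1: "1 - t = y powr - p / s" using s0 by (simp add: t s field_simps)
    have t0: "0 < t" unfolding t using s0 xy by simp
    have "0 < 1 - t" unfolding t1 using s0 xy by simp
    then have t01: "0 < t" "t < 1" using t0 by auto
    \<comment> \<open>This identity determines the weights: after multiplication by \<open>x\<close>
      and \<open>y\<close> respectively, both coefficients equal \<open>s powr (- 1 / p)\<close>, so
      the combined point lies on the ray of \<open>w1 + w2\<close>.\<close>
    have root: "(z powr - p / s) powr (1 / p) * z = s powr (- 1 / p)" if "0 < z" for z
    proof -
      have "(z powr - p / s) powr (1 / p) = (z powr - p) powr (1 / p) / s powr (1 / p)" by (rule powr_divide)
      moreover have "(z powr - p) powr (1 / p) = 1 / z"
        using p that powr_minus_divide[of z 1] by (simp only: powr_powr) simp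
      ultimately show ?thesis using that powr_minus_divide[of s "1 / p"] by simp
    qed
    let ?\<kappa> = "(1 / p - 1) * real (card B)"
    have "ennreal ((t powr ?\<kappa> * H w1 x) powr t * ((1 - t) powr ?\<kappa> * H w2 y) powr (1 - t))
      = ennreal_powr (ennreal (t powr ?\<kappa>) * fibre_integral B (x *\<^sub>R w1)) t
        * ennreal_powr (ennreal ((1 - t) powr ?\<kappa>) * fibre_integral B (y *\<^sub>R w2)) (1 - t)"
      using Hnn wB by (simp add: ennreal_powr_ennreal ennreal_mult flip: HJ)
        (simp add: ennreal_powr_ennreal flip: ennreal_mult)
    also have "\<dots> \<le> fibre_integral B (t powr (1 / p) *\<^sub>R (x *\<^sub>R w1) + (1 - t) powr (1 / p) *\<^sub>R (y *\<^sub>R w2))"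
      by (rule fibre_integral_p_concave[OF fin t01])
    also have "t powr (1 / p) *\<^sub>R (x *\<^sub>R w1) + (1 - t) powr (1 / p) *\<^sub>R (y *\<^sub>R w2) = s powr (- 1 / p) *\<^sub>R (w1 + w2)"
      using root[OF xy(1)] root[OF xy(2)] by (simp add: scaleR_add_right flip: t t1)
    also have "fibre_integral B \<dots> = ennreal (H (w1 + w2) (s powr (- 1 / p)))" using w3B by (simp add: HJ)
    finally show "(t powr ?\<kappa> * H w1 x) powr t * ((1 - t) powr ?\<kappa> * H w2 y) powr (1 - t) \<le> H (w1 + w2) (s powr (- 1 / p))"
      using Hnn by (simp add: ennreal_le_iff)
  qed (use p q \<phi> w wB quant in \<open>auto intro!: mult_nonneg_nonneg\<close>)
  also have "\<dots> = ray_integral B (w1 + w2)" by (simp add: HJ w3B ray_integral_def)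
  finally show ?thesis .
qed

section \<open>The triangle inequality for the norm of the intersection body\<close>

lemma section_norm_triangle:
  assumes dim: "2 \<le> DIM('a)"
  defines "q \<equiv> inverse ((1 / p - 1) * (real DIM('a) - 1) + 1)"
  defines "N \<equiv> \<lambda>x. norm x / enn2real (section_mass (x /\<^sub>R norm x))"
  shows "N (x + y) powr q \<le> N x powr q + N y powr q"
proof (cases "x = 0 \<or> y = 0 \<or> x + y = 0")
  case True
  have "N 0 = 0" by (simp add: N_def)
  then show ?thesis using True by auto
next
  case False
  then have nz: "x \<noteq> 0" "y \<noteq> 0" "x + y \<noteq> 0" by auto
  define e1 where "e1 = x /\<^sub>R norm x"
  have e1: "norm e1 = 1" using nz by (simp add: e1_def)
  obtain e2 where e2: "norm e2 = 1" "e1 \<bullet> e2 = 0" "y = (y \<bullet> e1) *\<^sub>R e1 + (y \<bullet> e2) *\<^sub>R e2"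
  proof (cases "y - (y \<bullet> e1) *\<^sub>R e1 = 0")
    case True
    \<comment> \<open>If \<open>y\<close> is parallel to \<open>x\<close>, any orthogonal direction
      completes the plane; one exists since the dimension is at least 2.\<close>
    obtain z where z: "z \<noteq> 0" "orthogonal e1 z" using orthogonal_to_vector_exists[OF dim, of e1] by blast
    have y: "y = (y \<bullet> e1) *\<^sub>R e1" using True by simp
    have "e1 \<bullet> (z /\<^sub>R norm z) = 0" using z by (simp add: orthogonal_def)
    moreover have "y \<bullet> (z /\<^sub>R norm z) = 0" by (subst y) (use z in \<open>simp add: orthogonal_def\<close>)
    ultimately show ?thesis using that[of "z /\<^sub>R norm z"] z y by simp
  next
    case False
    define z where "z = y - (y \<bullet> e1) *\<^sub>R e1"
    have z: "z \<noteq> 0" "e1 \<bullet> z = 0"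
      using False e1 by (auto simp: z_def inner_diff_right inner_commute dot_square_norm)
    have y: "y = (y \<bullet> e1) *\<^sub>R e1 + z" by (simp add: z_def)
    have "y \<bullet> z = z \<bullet> z" by (subst (1) y) (simp add: inner_add_left z)
    then have "(y \<bullet> (z /\<^sub>R norm z)) *\<^sub>R (z /\<^sub>R norm z) = z"
      using z by (simp add: dot_square_norm power2_eq_square field_simps)
    then show ?thesis using that[of "z /\<^sub>R norm z"] z y by simp
  qed
  have ee: "e1 \<bullet> e1 = 1" "e2 \<bullet> e2 = 1" "e2 \<bullet> e1 = 0" using e1 e2 by (auto simp: dot_square_norm inner_commute)
  obtain B where B: "orthonormal B" "card B + 2 = DIM('a)" and B12: "\<And>b. b \<in> B \<Longrightarrow> b \<bullet> e1 = 0" "\<And>b. b \<in> B \<Longrightarrow> b \<bullet> e2 = 0"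
  proof -
    define S where "S = {z\<in>UNIV. \<forall>v\<in>span {e1, e2}. orthogonal v z}"
    have on: "orthonormal {e1, e2}" using e1 e2 by (auto simp: orthonormal_def pairwise_def orthogonal_def inner_commute)
    have ne: "e1 \<noteq> e2" using e2 ee by auto
    have "dim S + dim (span {e1, e2}) = dim (UNIV :: 'a set)"
      unfolding S_def by (rule dim_subspace_orthogonal_to_vectors) auto
    moreover have "dim (span {e1, e2}) = 2"
      using dim_eq_card_independent[OF orthonormal_independent[OF on]] ne by simp
    ultimately have dS: "dim S + 2 = DIM('a)" by simp
    have "subspace S" unfolding S_def by (auto simp: subspace_def orthogonal_clauses)
    then obtain B where B: "orthonormal_basis_of S B" using orthonormal_basis_of_exists by blast
    have oB: "orthonormal B" using B by (simp add: orthonormal_basis_of_def orthonormal_def)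
    have "dim S = card B"
      using B dim_eq_card_independent[OF orthonormal_independent[OF oB]]
      unfolding orthonormal_basis_of_def by (metis dim_span)
    moreover have "b \<bullet> e1 = 0 \<and> b \<bullet> e2 = 0" if "b \<in> B" for b
    proof -
      have "b \<in> S" using B that by (auto simp: orthonormal_basis_of_def)
      then show ?thesis
        unfolding S_def by (auto simp: orthogonal_def inner_commute span_base)
    qed
    ultimately show ?thesis using that oB dS by auto
  qed
  have fin: "finite B" using orthonormal_finite[OF B(1)] .
  \<comment> \<open>A quarter turn of the plane, extended by zero to the complement. It is linear,
    so sums are preserved, and \<open>rot z\<close> is orthogonal to \<open>z\<close> and to
    \<open>B\<close>, as required for the section orthogonal to \<open>z\<close>.\<close>
  define rot where "rot z = (z \<bullet> e1) *\<^sub>R e2 - (z \<bullet> e2) *\<^sub>R e1" for z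
  have rot_add: "rot (a + b) = rot a + rot b" for a b by (simp add: rot_def inner_add_left algebra_simps)
  have rot_scale: "rot (r *\<^sub>R a) = r *\<^sub>R rot a" for r a by (simp add: rot_def algebra_simps)
  have rotB: "rot z \<bullet> b = 0" "b \<bullet> rot z = 0" if "b \<in> B" for b z
    using B12 that by (auto simp: rot_def inner_diff_left inner_diff_right inner_commute)
  define E where "E = {z. z = (z \<bullet> e1) *\<^sub>R e1 + (z \<bullet> e2) *\<^sub>R e2}"
  have xE: "x \<in> E"
  proof -
    have "x = norm x *\<^sub>R e1" using nz by (simp add: e1_def)
    then show ?thesis unfolding E_def using ee e2 by (metis (mono_tags, lifting) add.right_neutral inner_scaleR_left mem_Collect_eq mult.right_neutral mult_zero_right scaleR_zero_left)
  qed
  have yE: "y \<in> E" using e2(3) by (simp add: E_def)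
  have xyE: "x + y \<in> E"
  proof -
    have "x + y = ((x \<bullet> e1) *\<^sub>R e1 + (x \<bullet> e2) *\<^sub>R e2) + ((y \<bullet> e1) *\<^sub>R e1 + (y \<bullet> e2) *\<^sub>R e2)"
      using xE yE unfolding E_def by simp
    also have "\<dots> = ((x + y) \<bullet> e1) *\<^sub>R e1 + ((x + y) \<bullet> e2) *\<^sub>R e2" by (simp add: inner_add_left algebra_simps)
    finally show ?thesis unfolding E_def by (rule CollectI)
  qed
  have key: "\<exists>\<phi>>0. ray_integral B (rot z) = ennreal \<phi> \<and> N z = 1 / (2 * \<phi>) \<and> rot z \<noteq> 0" if z: "z \<in> E" "z \<noteq> 0" for z
  proof -
    define u where "u = z /\<^sub>R norm z"
    have u: "norm u = 1" "z = norm z *\<^sub>R u" using z by (auto simp: u_def)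
    have uE: "u = (u \<bullet> e1) *\<^sub>R e1 + (u \<bullet> e2) *\<^sub>R e2"
    proof -
      have "u = ((z \<bullet> e1) *\<^sub>R e1 + (z \<bullet> e2) *\<^sub>R e2) /\<^sub>R norm z" using z(1) unfolding E_def u_def by simp
      also have "\<dots> = (u \<bullet> e1) *\<^sub>R e1 + (u \<bullet> e2) *\<^sub>R e2" by (simp add: u_def scaleR_add_right)
      finally show ?thesis .
    qed
    have "u \<bullet> u = (u \<bullet> e1)\<^sup>2 + (u \<bullet> e2)\<^sup>2"
      by (subst (2) uE) (simp add: inner_add_right power2_eq_square)
    then have uu: "(u \<bullet> e1)\<^sup>2 + (u \<bullet> e2)\<^sup>2 = 1" using u by (simp add: dot_square_norm)
    have "rot u \<bullet> rot u = (u \<bullet> e1)\<^sup>2 + (u \<bullet> e2)\<^sup>2"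
      using ee e2 by (simp add: rot_def inner_diff_left inner_diff_right power2_eq_square)
    then have nrot: "norm (rot u) = 1" using uu by (simp add: norm_eq_1)
    have ru: "rot u \<bullet> u = 0" by (simp add: rot_def inner_diff_left inner_commute[of e1 u] inner_commute[of e2 u])
    have Bu: "b \<bullet> u = 0" if "b \<in> B" for b
      by (subst uE) (use B12 that in \<open>simp add: inner_add_right\<close>)
    have sec: "section_mass u = 2 * ray_integral B (rot u)"
      by (rule section_mass_eq_ray_integral[OF B Bu rotB(2) u(1) nrot ru])
    have rz: "rot z = norm z *\<^sub>R rot u" using u(2) rot_scale by metis
    have nzp: "0 < norm z" using z by simp
    have ray: "ray_integral B (rot u) = ennreal (norm z) * ray_integral B (rot z)"
      unfolding rz by (rule ray_integral_scaleR[OF fin nzp])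
    define d where "d = DIM('a) - 1"
    have b: "ennreal (c * (2 * \<epsilon> / (real d + 1)) ^ d) \<le> section_mass u" "section_mass u \<le> ennreal (f 0 * (2 * R) ^ d)"
      unfolding d_def by (rule section_mass_bounds[OF u(1)])+
    have s: "section_mass u = ennreal (2 * norm z) * ray_integral B (rot z)"
      unfolding sec ray using nzp by (simp add: ennreal_mult mult.assoc)
    have "section_mass u < top" using b(2) by (rule le_less_trans) simp
    then have "ray_integral B (rot z) \<noteq> top" using s nzp by (auto simp: ennreal_mult_top)
    then obtain \<phi> where \<phi>: "ray_integral B (rot z) = ennreal \<phi>" "0 \<le> \<phi>" by (cases "ray_integral B (rot z)") auto
    have se: "section_mass u = ennreal (2 * norm z * \<phi>)" using s \<phi> nzp by (simp add: ennreal_mult)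
    have "0 < c * (2 * \<epsilon> / (real d + 1)) ^ d" using c \<epsilon> by simp
    then have "0 < section_mass u" using b(1) by (metis ennreal_less_zero_iff less_le_trans)
    then have "0 < \<phi>" using se nzp \<phi>(2) by (auto simp: zero_less_mult_iff)
    moreover have "N z = 1 / (2 * \<phi>)"
      using nzp se \<phi>(2) unfolding N_def u_def[symmetric] by simp
    moreover have "rot z \<noteq> 0" unfolding rz using nrot nzp by auto
    ultimately show ?thesis using \<phi>(1) by blast
  qed
  obtain \<phi>1 where 1: "0 < \<phi>1" "ray_integral B (rot x) = ennreal \<phi>1" "N x = 1 / (2 * \<phi>1)" "rot x \<noteq> 0" using key[OF xE nz(1)] by blast
  obtain \<phi>2 where 2: "0 < \<phi>2" "ray_integral B (rot y) = ennreal \<phi>2" "N y = 1 / (2 * \<phi>2)" "rot y \<noteq> 0" using key[OF yE nz(2)] by blast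
  obtain \<phi>3 where 3: "0 < \<phi>3" "ray_integral B (rot (x + y)) = ennreal \<phi>3" "N (x + y) = 1 / (2 * \<phi>3)" "rot (x + y) \<noteq> 0"
    using key[OF xyE nz(3)] by blast
  have cardB: "real (card B) = real DIM('a) - 2" using B(2) by linarith
  \<comment> \<open>The fibre dimension \<open>n - 2\<close> gives \<open>1 / q\<close> as
    \<open>(1 / p - 1) * (n - 2) + 1 / p\<close>; moving one copy of \<open>1 / p - 1\<close> into
    the product leaves the summand 1.\<close>
  have q: "q = 1 / ((1 / p - 1) * real (card B) + 1 / p)"
  proof -
    have "(i - 1) * (n - 1) + 1 = (i - 1) * (n - 2) + i" for i n :: real by (simp add: algebra_simps)
    then show ?thesis unfolding q_def cardB by (simp only: inverse_eq_divide)
  qed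
  have "0 < (1 / p - 1) * real (card B) + 1 / p" using p by (intro add_nonneg_pos mult_nonneg_nonneg) auto
  then have q0: "0 < q" by (simp add: q)
  have "ennreal ((\<phi>1 powr - q + \<phi>2 powr - q) powr (- 1 / q)) \<le> ray_integral B (rot x + rot y)"
    using 1 2 3 by (intro ray_integral_q_concave[OF B(1) _ _ _ _ _ _ _ _ _ q] rotB) (auto simp: rot_add)
  then have le: "(\<phi>1 powr - q + \<phi>2 powr - q) powr (- 1 / q) \<le> \<phi>3"
    using 3 by (simp add: rot_add)
  have pos: "0 < \<phi>1 powr - q + \<phi>2 powr - q" using 1 2 by (intro add_pos_pos) auto
  have "\<phi>3 powr - q \<le> ((\<phi>1 powr - q + \<phi>2 powr - q) powr (- 1 / q)) powr - q"
    using le q0 pos by (intro powr_mono2') auto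
  also have "\<dots> = \<phi>1 powr - q + \<phi>2 powr - q" using q0 pos by (simp add: powr_powr)
  finally have main: "\<phi>3 powr - q \<le> \<phi>1 powr - q + \<phi>2 powr - q" .
  have inv: "(1 / (2 * \<phi>)) powr q = 2 powr - q * \<phi> powr - q" if "0 < \<phi>" for \<phi>
    using that by (simp add: powr_divide powr_mult powr_minus_divide)
  show ?thesis
    unfolding 1(3) 2(3) 3(3) inv[OF 1(1)] inv[OF 2(1)] inv[OF 3(1)] distrib_left[symmetric]
    by (intro mult_left_mono main) simp
qed

lemma intersection_body_p_convex:
  assumes dim: "2 \<le> DIM('a)"
  shows "p_convex (inverse ((1 / p - 1) * (real DIM('a) - 1) + 1)) (intersection_body f K)"
proof -
  define d where "d = DIM('a) - 1"
  define m where "m = c * (2 * \<epsilon> / (real d + 1)) ^ d"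
  have m: "0 < m" using c \<epsilon> by (simp add: m_def)
  have fin: "section_mass u < top" if "norm u = 1" for u
    using section_mass_bounds(2)[OF that] by (rule le_less_trans) simp
  have eq: "intersection_body f K = {r *\<^sub>R u |r u. norm u = 1 \<and> 0 \<le> r \<and> r \<le> enn2real (section_mass u)}"
  proof -
    have "ennreal r \<le> section_mass u \<longleftrightarrow> r \<le> enn2real (section_mass u)" if "norm u = 1" "0 \<le> r" for r u
      using fin[OF that(1)] that(2) by (cases "section_mass u") auto
    then show ?thesis unfolding intersection_body_def by blast
  qed
  show ?thesis
    unfolding eq
  proof (rule p_convex_of_radial_bounds[where m = m and M = "f 0 * (2 * R) ^ d"])
    have "0 < (1 / p - 1) * (real DIM('a) - 1) + 1" using p dim by (intro add_nonneg_pos mult_nonneg_nonneg) auto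
    then show "0 < inverse ((1 / p - 1) * (real DIM('a) - 1) + 1)" by simp
    fix u :: 'a assume u: "norm u = 1"
    show "m \<le> enn2real (section_mass u)"
      using section_mass_bounds(1)[OF u] fin[OF u] m unfolding m_def d_def
      by (cases "section_mass u") auto
    show "enn2real (section_mass u) \<le> f 0 * (2 * R) ^ d"
      using section_mass_bounds(2)[OF u] f_pos R unfolding d_def
      by (intro enn2real_leI) auto
  qed (use m section_norm_triangle[OF dim] in auto)
qed

end

theorem corollary1:
  fixes \<mu> :: "'a::euclidean_space measure"
    and f :: "'a \<Rightarrow> real"
    and K :: "'a set"
    and p :: real
  assumes "DIM('a) \<ge> 2"
    and "log_concave_measure \<mu>"
    and "nondegenerate_measure \<mu>"
    and "log_concave_density \<mu> f"
    and "symmetric_measure \<mu>"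
    and "0 < p" and "p \<le> 1"
    and "origin_symmetric K"
    and "p_convex p K"
  shows "p_convex (inverse ((1 / p - 1) * (real DIM('a) - 1) + 1)) (intersection_body f K)"
proof -
  obtain c \<delta> where f: "0 < c" "0 < \<delta>" "\<And>x. norm x < \<delta> \<Longrightarrow> c \<le> f x" "\<And>x. f x \<le> f 0"
    "\<And>x l. 0 < l \<Longrightarrow> l < 1 \<Longrightarrow> (c / f 0) powr (1 - l) * f x \<le> f (- (l *\<^sub>R x))"
    using symmetric_log_concave_density_bounds[OF assms(3-5)] by blast
  obtain e where e: "0 < e" "\<And>x. norm x < e \<Longrightarrow> x \<in> K"
    using p_convex_contains_ball[OF assms(9,6,8)] by blast
  have "bounded K" using assms(9) by (simp add: p_convex_def body_def compact_imp_bounded)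
  then obtain R where R: "0 < R" "\<And>x. x \<in> K \<Longrightarrow> norm x \<le> R" using bounded_pos by blast
  show ?thesis
    \<comment> \<open>The bounds on \<open>f\<close> and \<open>K\<close> hold on open balls; half
      of the smaller radius makes them hold on the closed ball of radius
      \<open>\<epsilon>\<close>.\<close>
    using f e R assms
    by (intro intersection_body_p_convex[where c = c and \<epsilon> = "min \<delta> e / 2" and R = R])
      (auto simp: log_concave_density_def)
qed

end
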